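(* There is an algorithm which, given a path instance with interval vertex weights (positions $0=x_0<x_1<\dots<x_n$, edge capacities $c_0,\dots,c_{n-1}>0$, and weight intervals $[w_i^-,w_i^+]$, $0\le w_i^-\le w_i^+$, for $i=0,\dots,n$), computes the minmax regret value $$R_{OPT}(P)=\min_{x\in[x_0,x_n]}\ \max_{s\in\mathcal S}\bigl(\Theta(P,x:s)-\Theta_{OPT}(P:s)\bigr)$$ of the 1-sink location problem in $O(n^4\log n)$ time.
   Context: A path $P$ has vertices $v_0,\dots,v_n$ at real positions $0=x_0<x_1<\dots<x_n$; edge $e_i=(v_i,v_{i+1})$ ($0\le i<n$) has length $d_i=x_{i+1}-x_i>0$ (travel time) and capacity $c_i>0$ (amount of flow that can enter it per unit time). Any point $x\in[x_0,x_n]$ (vertex or interior of an edge) may be the sink. A scenario $s=(w_0(s),\dots,w_n(s))$ assigns a nonnegative amount of flow to each vertex; $W_{i,j}(s)=\sum_{t=i}^j w_t(s)$. For $x\le x'$ in $[x_0,x_n]$ let $d(x,x')=x'-x$ and $c(x,x')=\min\{c_t: i\le t<j\}$ where $i=\max\{i':x_{i'}\le x\}$ and $j=\min\{j':x_{j'}\ge x'\}$ (the minimum capacity on the path between $x$ and $x'$). For $x_i<x$ put $g_i(x:s)=d(x_i,x)+W_{0,i}(s)/c(x_i,x)$ if $W_{0,i}(s)>0$ and $g_i(x:s)=0$ otherwise; for $x_i>x$ put $h_i(x:s)=d(x,x_i)+W_{i,n}(s)/c(x,x_i)$ if $W_{i,n}(s)>0$ and $0$ otherwise. The (confluent dynamic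 flow) evacuation times to the sink $x$ are $\Theta_L(P,x:s)=\max_{i:x_i<x}g_i(x:s)$, $\Theta_R(P,x:s)=\max_{i:x_i>x}h_i(x:s)$ (a maximum over an empty set is $0$), $\Theta(P,x:s)=\max\{\Theta_L(P,x:s),\Theta_R(P,x:s)\}$, and $\Theta_{OPT}(P:s)=\min_{x\in[x_0,x_n]}\Theta(P,x:s)$. The set of legal scenarios is $\mathcal S=\prod_{i=0}^n[w_i^-,w_i^+]$. The regret of $x$ under $s$ is $R(P,x:s)=\Theta(P,x:s)-\Theta_{OPT}(P:s)$, $R_{\max}(P,x)=\max_{s\in\mathcal S}R(P,x:s)$, and $R_{OPT}(P)=\min_{x\in[x_0,x_n]}R_{\max}(P,x)$. *)

theory Defs
  imports Complex_Main "HOL-Library.FuncSet" "HOL-Library.Landau_Symbols"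
begin

section \<open>Minmax regret 1-sink location on a dynamic path\<close>

text \<open>Vertices are \<open>0, \<dots>, edges I\<close>; edge \<open>i < edges I\<close> joins vertices \<open>i\<close> and \<open>Suc i\<close>. The
  functions are meaningful only on these index ranges.\<close>

record path_instance =
  edges :: nat
  pos :: "nat \<Rightarrow> real"
  cap :: "nat \<Rightarrow> real"
  wlo :: "nat \<Rightarrow> real"
  whi :: "nat \<Rightarrow> real"

definition valid_instance :: "path_instance \<Rightarrow> bool" where
  "valid_instance I \<longleftrightarrow>
     pos I 0 = 0 \<and>
     (\<forall>i<edges I. pos I i < pos I (Suc i)) \<and>
     (\<forall>i<edges I. 0 < cap I i) \<and>
     (\<forall>i\<le>edges I. 0 \<le> wlo I i \<and> wlo I i \<le> whi I i)"

type_synonym scenario = "nat \<Rightarrow> real"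

definition scenarios :: "path_instance \<Rightarrow> scenario set" where
  "scenarios I = (\<Pi>\<^sub>E i\<in>{..edges I}. {wlo I i..whi I i})"

definition sinks :: "path_instance \<Rightarrow> real set" where
  "sinks I = {pos I 0..pos I (edges I)}"

definition weight :: "scenario \<Rightarrow> nat \<Rightarrow> nat \<Rightarrow> real" where
  "weight s i j = (\<Sum>t=i..j. s t)"

definition path_cap :: "path_instance \<Rightarrow> real \<Rightarrow> real \<Rightarrow> real" where
  "path_cap I x x' =
     (let i = Max {i'. i' \<le> edges I \<and> pos I i' \<le> x};
          j = Min {j'. j' \<le> edges I \<and> x' \<le> pos I j'}
      in Min (cap I ` {i..<j}))"

definition left_time :: "path_instance \<Rightarrow> scenario \<Rightarrow> nat \<Rightarrow> real \<Rightarrow> real" where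
  "left_time I s i x =
     (if weight s 0 i > 0
      then (x - pos I i) + weight s 0 i / path_cap I (pos I i) x else 0)"

definition right_time :: "path_instance \<Rightarrow> scenario \<Rightarrow> nat \<Rightarrow> real \<Rightarrow> real" where
  "right_time I s i x =
     (if weight s i (edges I) > 0
      then (pos I i - x) + weight s i (edges I) / path_cap I x (pos I i) else 0)"

text \<open>The evacuation times of the individual vertices are nonnegative, so inserting \<open>0\<close> only
  fixes the value of the maximum over the empty set.\<close>

definition evac_left :: "path_instance \<Rightarrow> real \<Rightarrow> scenario \<Rightarrow> real" where
  "evac_left I x s =
     Max (insert 0 ((\<lambda>i. left_time I s i x) ` {i. i \<le> edges I \<and> pos I i < x}))"

definition evac_right :: "path_instance \<Rightarrow> real \<Rightarrow> scenario \<Rightarrow> real" where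
  "evac_right I x s =
     Max (insert 0 ((\<lambda>i. right_time I s i x) ` {i. i \<le> edges I \<and> x < pos I i}))"

definition evac_time :: "path_instance \<Rightarrow> real \<Rightarrow> scenario \<Rightarrow> real" where
  "evac_time I x s = max (evac_left I x s) (evac_right I x s)"

text \<open>The minima and maxima over sinks and scenarios range over infinite sets; they are
  rendered as infima and suprema of nonempty bounded sets of reals.\<close>

definition opt_evac_time :: "path_instance \<Rightarrow> scenario \<Rightarrow> real" where
  "opt_evac_time I s = (INF x\<in>sinks I. evac_time I x s)"

definition regret :: "path_instance \<Rightarrow> real \<Rightarrow> scenario \<Rightarrow> real" where
  "regret I x s = evac_time I x s - opt_evac_time I s"

definition max_regret :: "path_instance \<Rightarrow> real \<Rightarrow> real" where
  "max_regret I x = (SUP s\<in>scenarios I. regret I x s)"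

definition minmax_regret :: "path_instance \<Rightarrow> real" where
  "minmax_regret I = (INF x\<in>sinks I. max_regret I x)"


section \<open>Real RAM programs\<close>

text \<open>
  Algorithms are programs of a while language over the unit-cost real RAM. The store consists of
  unbounded arrays of natural numbers (used for indices and control) and unbounded arrays of
  reals; a scalar variable is cell \<open>0\<close> of an array. Reals admit the four field operations and
  comparison. The only real constants are \<open>0\<close> and \<open>1\<close>, so that a program cannot carry an
  infinite amount of information, and there is neither rounding nor any other way from reals to
  naturals except branching. Naturals admit only addition, truncated subtraction and comparison,
  since unit-cost multiplication of unbounded integers would be unreasonably powerful.
\<close>

datatype nexp =
    NConst nat
  | NLoad nat nexp
  | NAdd nexp nexp
  | NSub nexp nexp

datatype rexp =
    RZero
  | ROne
  | RLoad nat nexp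
  | RAdd rexp rexp
  | RSub rexp rexp
  | RMul rexp rexp
  | RDiv rexp rexp

datatype bexp =
    NLess nexp nexp
  | RLess rexp rexp
  | Not bexp
  | And bexp bexp

datatype com =
    Skip
  | NStore nat nexp nexp
  | RStore nat nexp rexp
  | Seq com com
  | If bexp com com
  | While bexp com

record store =
  narr :: "nat \<Rightarrow> nat \<Rightarrow> nat"
  rarr :: "nat \<Rightarrow> nat \<Rightarrow> real"

primrec nval :: "nexp \<Rightarrow> store \<Rightarrow> nat" where
  "nval (NConst k) \<sigma> = k"
| "nval (NLoad a e) \<sigma> = narr \<sigma> a (nval e \<sigma>)"
| "nval (NAdd e f) \<sigma> = nval e \<sigma> + nval f \<sigma>"
| "nval (NSub e f) \<sigma> = nval e \<sigma> - nval f \<sigma>"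

primrec rval :: "rexp \<Rightarrow> store \<Rightarrow> real" where
  "rval RZero \<sigma> = 0"
| "rval ROne \<sigma> = 1"
| "rval (RLoad a e) \<sigma> = rarr \<sigma> a (nval e \<sigma>)"
| "rval (RAdd e f) \<sigma> = rval e \<sigma> + rval f \<sigma>"
| "rval (RSub e f) \<sigma> = rval e \<sigma> - rval f \<sigma>"
| "rval (RMul e f) \<sigma> = rval e \<sigma> * rval f \<sigma>"
| "rval (RDiv e f) \<sigma> = rval e \<sigma> / rval f \<sigma>"

primrec bval :: "bexp \<Rightarrow> store \<Rightarrow> bool" where
  "bval (NLess e f) \<sigma> \<longleftrightarrow> nval e \<sigma> < nval f \<sigma>"
| "bval (RLess e f) \<sigma> \<longleftrightarrow> rval e \<sigma> < rval f \<sigma>"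
| "bval (Not b) \<sigma> \<longleftrightarrow> \<not> bval b \<sigma>"
| "bval (And b b') \<sigma> \<longleftrightarrow> bval b \<sigma> \<and> bval b' \<sigma>"

text \<open>Every constant, memory access, arithmetic operation, comparison and Boolean connective
  costs one unit.\<close>

primrec ncost :: "nexp \<Rightarrow> nat" where
  "ncost (NConst k) = 1"
| "ncost (NLoad a e) = 1 + ncost e"
| "ncost (NAdd e f) = 1 + ncost e + ncost f"
| "ncost (NSub e f) = 1 + ncost e + ncost f"

primrec rcost :: "rexp \<Rightarrow> nat" where
  "rcost RZero = 1"
| "rcost ROne = 1"
| "rcost (RLoad a e) = 1 + ncost e"
| "rcost (RAdd e f) = 1 + rcost e + rcost f"
| "rcost (RSub e f) = 1 + rcost e + rcost f"
| "rcost (RMul e f) = 1 + rcost e + rcost f"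
| "rcost (RDiv e f) = 1 + rcost e + rcost f"

primrec bcost :: "bexp \<Rightarrow> nat" where
  "bcost (NLess e f) = 1 + ncost e + ncost f"
| "bcost (RLess e f) = 1 + rcost e + rcost f"
| "bcost (Not b) = 1 + bcost b"
| "bcost (And b b') = 1 + bcost b + bcost b'"

definition nstore :: "nat \<Rightarrow> nat \<Rightarrow> nat \<Rightarrow> store \<Rightarrow> store" where
  "nstore a i v \<sigma> = \<sigma>\<lparr>narr := (narr \<sigma>)(a := (narr \<sigma> a)(i := v))\<rparr>"

definition rstore :: "nat \<Rightarrow> nat \<Rightarrow> real \<Rightarrow> store \<Rightarrow> store" where
  "rstore a i v \<sigma> = \<sigma>\<lparr>rarr := (rarr \<sigma>)(a := (rarr \<sigma> a)(i := v))\<rparr>"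

text \<open>\<open>exec p \<sigma> t \<tau>\<close>: started in \<open>\<sigma>\<close>, program \<open>p\<close> halts in \<open>\<tau>\<close> after exactly \<open>t\<close> units of time.\<close>

inductive exec :: "com \<Rightarrow> store \<Rightarrow> nat \<Rightarrow> store \<Rightarrow> bool" where
  Skip: "exec Skip \<sigma> 1 \<sigma>"
| NStore: "exec (NStore a i e) \<sigma> (1 + ncost i + ncost e) (nstore a (nval i \<sigma>) (nval e \<sigma>) \<sigma>)"
| RStore: "exec (RStore a i e) \<sigma> (1 + ncost i + rcost e) (rstore a (nval i \<sigma>) (rval e \<sigma>) \<sigma>)"
| Seq: "exec p \<sigma> t \<sigma>' \<Longrightarrow> exec q \<sigma>' u \<sigma>'' \<Longrightarrow> exec (Seq p q) \<sigma> (t + u) \<sigma>''"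
| IfTrue: "bval b \<sigma> \<Longrightarrow> exec p \<sigma> t \<sigma>' \<Longrightarrow> exec (If b p q) \<sigma> (1 + bcost b + t) \<sigma>'"
| IfFalse: "\<not> bval b \<sigma> \<Longrightarrow> exec q \<sigma> t \<sigma>' \<Longrightarrow> exec (If b p q) \<sigma> (1 + bcost b + t) \<sigma>'"
| WhileFalse: "\<not> bval b \<sigma> \<Longrightarrow> exec (While b p) \<sigma> (1 + bcost b) \<sigma>"
| WhileTrue: "bval b \<sigma> \<Longrightarrow> exec p \<sigma> t \<sigma>' \<Longrightarrow> exec (While b p) \<sigma>' u \<sigma>'' \<Longrightarrow>
    exec (While b p) \<sigma> (1 + bcost b + t + u) \<sigma>''"

inductive_cases SkipE: "exec Skip \<sigma> t \<tau>"
inductive_cases NStoreE: "exec (NStore a i e) \<sigma> t \<tau>"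
inductive_cases RStoreE: "exec (RStore a i e) \<sigma> t \<tau>"
inductive_cases SeqE: "exec (Seq p q) \<sigma> t \<tau>"
inductive_cases IfE: "exec (If b p q) \<sigma> t \<tau>"
inductive_cases WhileE: "exec (While b p) \<sigma> t \<tau>"

lemma exec_deterministic:
  "exec p \<sigma> t \<tau> \<Longrightarrow> exec p \<sigma> t' \<tau>' \<Longrightarrow> t' = t \<and> \<tau>' = \<tau>"
proof (induction arbitrary: t' \<tau>' rule: exec.induct)
  case (Skip \<sigma>)
  from Skip.prems show ?case by (auto elim: SkipE)
next
  case (NStore a i e \<sigma>)
  from NStore.prems show ?case by (auto elim: NStoreE)
next
  case (RStore a i e \<sigma>)
  from RStore.prems show ?case by (auto elim: RStoreE)
next
  case (Seq p \<sigma> t \<sigma>' q u \<sigma>'')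
  from Seq.prems obtain t1 \<rho> u1 where
    "exec p \<sigma> t1 \<rho>" "exec q \<rho> u1 \<tau>'" "t' = t1 + u1" by (rule SeqE)
  with Seq.IH show ?case by metis
next
  case (IfTrue b \<sigma> p t \<sigma>' q)
  from IfTrue.prems IfTrue.hyps(1) obtain t1 where
    "exec p \<sigma> t1 \<tau>'" "t' = 1 + bcost b + t1" by (auto elim: IfE)
  with IfTrue.IH show ?case by metis
next
  case (IfFalse b \<sigma> q t \<sigma>' p)
  from IfFalse.prems IfFalse.hyps(1) obtain t1 where
    "exec q \<sigma> t1 \<tau>'" "t' = 1 + bcost b + t1" by (auto elim: IfE)
  with IfFalse.IH show ?case by metis
next
  case (WhileFalse b \<sigma> p)
  from WhileFalse.prems WhileFalse.hyps show ?case by (auto elim: WhileE)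
next
  case (WhileTrue b \<sigma> p t \<sigma>' u \<sigma>'')
  from WhileTrue.prems WhileTrue.hyps(1) obtain t1 \<rho> u1 where
    "exec p \<sigma> t1 \<rho>" "exec (While b p) \<rho> u1 \<tau>'" "t' = 1 + bcost b + t1 + u1"
    by (auto elim: WhileE)
  with WhileTrue.IH show ?case by metis
qed


section \<open>Input and output\<close>

text \<open>Initially natural array \<open>0\<close> holds the number of edges in its cell \<open>0\<close>, and real arrays
  \<open>0, \<dots>, 3\<close> hold positions, capacities, lower and upper weights. All other cells are zero. The
  result is expected in cell \<open>0\<close> of real array \<open>4\<close>.\<close>

definition initial_store :: "path_instance \<Rightarrow> store" where
  "initial_store I =
     \<lparr>narr = (\<lambda>a i. if a = 0 \<and> i = 0 then edges I else 0),
      rarr = (\<lambda>a i.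
        if a = 0 \<and> i \<le> edges I then pos I i
        else if a = 1 \<and> i < edges I then cap I i
        else if a = 2 \<and> i \<le> edges I then wlo I i
        else if a = 3 \<and> i \<le> edges I then whi I i
        else 0)\<rparr>"

definition result :: "store \<Rightarrow> real" where
  "result \<sigma> = rarr \<sigma> 4 0"

end

theory Submission
  imports Defs
begin

text \<open>
  Among the vertices left of a sink \<open>x\<close> that attain the evacuation time, one may pick a vertex \<open>i\<close> of positive
  weight. Its regret is \<open>x - x\<^sub>i + W\<^sub>0\<^sub>i / C\<close> minus the optimal time, where the capacity \<open>C\<close> is the same for all
  \<open>x\<close> on an edge. Hence on every edge the maximal left regret is \<open>max 0 (x + R)\<close> for a constant \<open>R\<close>, and
  symmetrically on the right, so that the minimum over \<open>x\<close> is elementary once these constants are known.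

  For fixed \<open>i\<close> and \<open>C\<close>, weights after \<open>i\<close> are minimal, and one maximises \<open>W\<^sub>0\<^sub>i / C - \<theta>\<close> over all scenarios, all
  locations \<open>y\<close> of the optimal sink and all times \<open>\<theta>\<close> sufficient for \<open>y\<close>. If \<open>y\<close> ranges over a vertex or over an edge,
  then the left side depends on \<open>u = \<theta> - y\<close> and the right side on \<open>v = \<theta> + y\<close> only, and the maximal weight of
  either side is a minimum of hinge functions of \<open>u\<close> or \<open>v\<close>, attained by filling the vertices near \<open>y\<close> first.
  Such a minimum has at most one concave kink per hinge. At a vertex the objective is a function of \<open>\<theta>\<close>, maximal at
  a kink of one side. On an edge it is a sum of a function of \<open>u\<close> and a concave function of \<open>v\<close>, so an optimum
  combines the best \<open>v\<close> with a kink \<open>u\<close>, unless it lies at an end of the edge, where the vertex is at least as good.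
  Enumerating \<open>i\<close>, \<open>y\<close>, \<open>C\<close> and the kinks gives four nested loops.
\<close>

section \<open>A language of bounded loops\<close>

text \<open>Subtracting the optimal time, a minimum over sinks, is taking a maximum over sinks. So
  the adversary may choose the competing sink and its time together with the scenario, and a single
  joint maximisation remains. The obstacle is that evacuation times jump when a vertex starts to
  send flow: suprema over scenarios need not be attained. Hence the feasible points with positive
  weight at \<open>i\<close> are replaced by their closure, and suprema are approached only up to an
  arbitrary \<open>e\<close>. The left side is not concave because vertices before \<open>i\<close>
  may have no flow to send, whereas every right vertex up to \<open>i\<close> does send flow.

  The running time has no logarithm because neither the tables of a side nor its candidates depend
  on \<open>C\<close>. For fixed \<open>i\<close> and slot, evaluating a side at all candidates
  takes quadratic time, and so does combining the candidates with all capacities afterwards. Pairing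
  left with right candidates for every capacity would cost another factor; on an edge this is
  avoided by choosing one best right point per capacity.\<close>

datatype expr =
    Pure rexp
  | IfE bexp expr expr
  | Fold nat nat expr expr

datatype stmt =
    Tab nat nat expr
  | Sq stmt stmt
  | ForS nat stmt

type_synonym heap = "nat \<Rightarrow> nat \<Rightarrow> real"

definition store_of :: "(nat \<Rightarrow> nat) \<Rightarrow> heap \<Rightarrow> store" where
  "store_of env h = \<lparr>narr = (\<lambda>a i. env a), rarr = h\<rparr>"

primrec expr_val :: "expr \<Rightarrow> (nat \<Rightarrow> nat) \<Rightarrow> heap \<Rightarrow> real" where
  "expr_val (Pure e) env h = rval e (store_of env h)"
| "expr_val (IfE b e e') env h = (if bval b (store_of env h) then expr_val e env h else expr_val e' env h)"
| "expr_val (Fold r v e e') env h =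
     fold (\<lambda>k y. expr_val e' (env(v := k)) (h(r := (\<lambda>_. y)))) [0..<Suc (env 0)] (expr_val e env h)"

primrec run_stmt :: "stmt \<Rightarrow> (nat \<Rightarrow> nat) \<Rightarrow> heap \<Rightarrow> heap" where
  "run_stmt (Tab X v e) env h = h(X := (\<lambda>k. if k \<le> env 0 then expr_val e (env(v := k)) h else h X k))"
| "run_stmt (Sq p q) env h = run_stmt q env (run_stmt p env h)"
| "run_stmt (ForS v p) env h = fold (\<lambda>k. run_stmt p (env(v := k))) [0..<Suc (env 0)] h"

text \<open>Everything a program says about naturals is a bounded loop counter, so its meaning is a function
  of the counter values and the real arrays, and its cost is read off the nesting depth. A fold keeps
  its running value in its accumulator array.

  Loop counters live in cell \<open>0\<close> of their natural array; array \<open>0\<close> holds the number of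
  edges. Real arrays from \<open>100\<close> on serve as accumulators of folds.\<close>

primrec nexp_ok :: "nat set \<Rightarrow> nexp \<Rightarrow> bool" where
  "nexp_ok S (NConst k) = True"
| "nexp_ok S (NLoad a e) = (a \<in> S \<and> e = NConst 0)"
| "nexp_ok S (NAdd e f) = (nexp_ok S e \<and> nexp_ok S f)"
| "nexp_ok S (NSub e f) = (nexp_ok S e \<and> nexp_ok S f)"

primrec rexp_ok :: "nat set \<Rightarrow> nat set \<Rightarrow> rexp \<Rightarrow> bool" where
  "rexp_ok S B RZero = True"
| "rexp_ok S B ROne = True"
| "rexp_ok S B (RLoad a e) = (a \<in> B \<and> nexp_ok S e \<and> (a \<ge> 100 \<longrightarrow> e = NConst 0))"
| "rexp_ok S B (RAdd e f) = (rexp_ok S B e \<and> rexp_ok S B f)"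
| "rexp_ok S B (RSub e f) = (rexp_ok S B e \<and> rexp_ok S B f)"
| "rexp_ok S B (RMul e f) = (rexp_ok S B e \<and> rexp_ok S B f)"
| "rexp_ok S B (RDiv e f) = (rexp_ok S B e \<and> rexp_ok S B f)"

primrec bexp_ok :: "nat set \<Rightarrow> nat set \<Rightarrow> bexp \<Rightarrow> bool" where
  "bexp_ok S B (NLess e f) = (nexp_ok S e \<and> nexp_ok S f)"
| "bexp_ok S B (RLess e f) = (rexp_ok S B e \<and> rexp_ok S B f)"
| "bexp_ok S B (Not b) = bexp_ok S B b"
| "bexp_ok S B (And b b') = (bexp_ok S B b \<and> bexp_ok S B b')"

primrec expr_ok :: "nat set \<Rightarrow> nat set \<Rightarrow> expr \<Rightarrow> bool" where
  "expr_ok S B (Pure e) = rexp_ok S B e"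
| "expr_ok S B (IfE b e e') = (bexp_ok S B b \<and> expr_ok S B e \<and> expr_ok S B e')"
| "expr_ok S B (Fold r v e e') =
     (r \<ge> 100 \<and> r \<notin> B \<and> v \<notin> S \<and> expr_ok S B e \<and> expr_ok (insert v S) (insert r B) e')"

text \<open>The entries of a table may not read the table itself, so overwriting its cells one after
  the other has the effect of the simultaneous update in \<open>run_stmt\<close>.\<close>

primrec stmt_ok :: "nat set \<Rightarrow> stmt \<Rightarrow> bool" where
  "stmt_ok S (Tab X v e) = (X < 100 \<and> v \<notin> S \<and> expr_ok (insert v S) ({..<100} - {X}) e)"
| "stmt_ok S (Sq p q) = (stmt_ok S p \<and> stmt_ok S q)"
| "stmt_ok S (ForS v p) = (v \<notin> S \<and> stmt_ok (insert v S) p)"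

definition loop :: "nat \<Rightarrow> com \<Rightarrow> com" where
  "loop v p = Seq (NStore v (NConst 0) (NConst 0))
     (While (NLess (NLoad v (NConst 0)) (NAdd (NLoad 0 (NConst 0)) (NConst 1)))
       (Seq p (NStore v (NConst 0) (NAdd (NLoad v (NConst 0)) (NConst 1)))))"

primrec compile_expr :: "expr \<Rightarrow> nat \<Rightarrow> nexp \<Rightarrow> com" where
  "compile_expr (Pure e) X i = RStore X i e"
| "compile_expr (IfE b e e') X i = If b (compile_expr e X i) (compile_expr e' X i)"
| "compile_expr (Fold r v e e') X i =
     Seq (compile_expr e r (NConst 0)) (Seq (loop v (compile_expr e' r (NConst 0))) (RStore X i (RLoad r (NConst 0))))"

primrec compile_stmt :: "stmt \<Rightarrow> com" where
  "compile_stmt (Tab X v e) = loop v (compile_expr e X (NLoad v (NConst 0)))"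
| "compile_stmt (Sq p q) = Seq (compile_stmt p) (compile_stmt q)"
| "compile_stmt (ForS v p) = loop v (compile_stmt p)"

primrec expr_depth :: "expr \<Rightarrow> nat" where
  "expr_depth (Pure e) = 0"
| "expr_depth (IfE b e e') = max (expr_depth e) (expr_depth e')"
| "expr_depth (Fold r v e e') = max (expr_depth e) (Suc (expr_depth e'))"

primrec stmt_depth :: "stmt \<Rightarrow> nat" where
  "stmt_depth (Tab X v e) = Suc (expr_depth e)"
| "stmt_depth (Sq p q) = max (stmt_depth p) (stmt_depth q)"
| "stmt_depth (ForS v p) = Suc (stmt_depth p)"

section \<open>Correctness and running time of compiled loops\<close>

lemma nexp_ok_cong:
  assumes "nexp_ok S e" "\<And>a. a \<in> S \<Longrightarrow> narr \<sigma> a 0 = narr \<sigma>' a 0"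
  shows "nval e \<sigma> = nval e \<sigma>'"
  using assms by (induction e) auto

text \<open>In \<open>expr_val\<close> a fold accumulator is a constant array, but compiled code
  writes only its cell 0. Arrays from 100 on are therefore compared at cell 0 only, the one cell
  where \<open>rexp_ok\<close> lets them be read.\<close>

definition agree :: "nat set \<Rightarrow> heap \<Rightarrow> heap \<Rightarrow> bool" where
  "agree B h h' \<longleftrightarrow> (\<forall>a\<in>B. h a 0 = h' a 0 \<and> (a < 100 \<longrightarrow> h a = h' a))"

lemma rexp_ok_cong:
  assumes "rexp_ok S B e" "\<And>a. a \<in> S \<Longrightarrow> narr \<sigma> a 0 = narr \<sigma>' a 0" "agree B (rarr \<sigma>) (rarr \<sigma>')"
  shows "rval e \<sigma> = rval e \<sigma>'"
  using assms
proof (induction e)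
  case (RLoad a e)
  then have "nval e \<sigma> = nval e \<sigma>'" by (auto intro: nexp_ok_cong)
  with RLoad show ?case by (cases "a < 100") (auto simp: agree_def)
qed auto

lemma bexp_ok_cong:
  assumes "bexp_ok S B e" "\<And>a. a \<in> S \<Longrightarrow> narr \<sigma> a 0 = narr \<sigma>' a 0" "agree B (rarr \<sigma>) (rarr \<sigma>')"
  shows "bval e \<sigma> = bval e \<sigma>'"
  using assms by (induction e) (auto simp: nexp_ok_cong[of S _ \<sigma> \<sigma>'] rexp_ok_cong[of S B _ \<sigma> \<sigma>'])

text \<open>The invariant has to survive writes to the counter, since the loop performs them itself.
  A round costs 14 for guard and increment; initialisation and last guard cost 3 + 8, charged to the
  rounds, of which there is at least one: 14 + 11 = 25.\<close>

lemma loop_exec: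
  assumes "v \<noteq> 0"
    and n: "\<And>k \<sigma>. Inv k \<sigma> \<Longrightarrow> narr \<sigma> 0 0 = n"
    and upd: "\<And>k \<sigma> x. Inv k \<sigma> \<Longrightarrow> Inv k (nstore v 0 x \<sigma>)"
    and init: "Inv 0 \<sigma>"
    and step: "\<And>k \<sigma>. k \<le> n \<Longrightarrow> Inv k \<sigma> \<Longrightarrow> narr \<sigma> v 0 = k \<Longrightarrow>
      \<exists>t \<sigma>'. exec p \<sigma> t \<sigma>' \<and> t \<le> c \<and> narr \<sigma>' v 0 = k \<and> Inv (Suc k) \<sigma>'"
  shows "\<exists>t \<sigma>'. exec (loop v p) \<sigma> t \<sigma>' \<and> t \<le> (c + 25) * Suc n \<and> Inv (Suc n) \<sigma>'"
proof -
  let ?b = "NLess (NLoad v (NConst 0)) (NAdd (NLoad 0 (NConst 0)) (NConst 1))"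
  let ?i = "NStore v (NConst 0) (NAdd (NLoad v (NConst 0)) (NConst 1))"
  have while: "\<exists>t \<sigma>'. exec (While ?b (Seq p ?i)) \<sigma> t \<sigma>' \<and> t \<le> (c + 14) * d + 8 \<and> Inv (Suc n) \<sigma>'"
    if "k + d = Suc n" "Inv k \<sigma>" "narr \<sigma> v 0 = k" for k d \<sigma>
    using that
  proof (induction d arbitrary: k \<sigma>)
    case 0
    then have "\<not> bval ?b \<sigma>" using n[OF 0(2)] by simp
    then have "exec (While ?b (Seq p ?i)) \<sigma> (1 + bcost ?b) \<sigma>" by (rule exec.WhileFalse)
    with 0 show ?case by (intro exI[of _ "1 + bcost ?b"] exI[of _ \<sigma>]) (simp add: numeral_eq_Suc)
  next
    case (Suc d)
    then obtain t \<sigma>1 where 1: "exec p \<sigma> t \<sigma>1" "t \<le> c" "narr \<sigma>1 v 0 = k" "Inv (Suc k) \<sigma>1"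
      using step[of k \<sigma>] by auto
    let ?\<sigma>2 = "nstore v 0 (Suc k) \<sigma>1"
    have "exec ?i \<sigma>1 6 ?\<sigma>2"
      using exec.NStore[of v "NConst 0" "NAdd (NLoad v (NConst 0)) (NConst 1)" \<sigma>1] 1
      by (simp add: numeral_eq_Suc)
    with 1 have 2: "exec (Seq p ?i) \<sigma> (t + 6) ?\<sigma>2" by (blast intro: exec.Seq)
    obtain u \<sigma>3 where 3: "exec (While ?b (Seq p ?i)) ?\<sigma>2 u \<sigma>3" "u \<le> (c + 14) * d + 8" "Inv (Suc n) \<sigma>3"
      using Suc.IH[of "Suc k" ?\<sigma>2] Suc.prems upd[OF 1(4)] by (auto simp: nstore_def)
    have "bval ?b \<sigma>" using Suc.prems n[OF Suc.prems(2)] by simp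
    from exec.WhileTrue[OF this 2 3(1)] show ?case
      using 1(2) 3 by (intro exI[of _ "1 + bcost ?b + (t + 6) + u"] exI[of _ \<sigma>3]) simp
  qed
  let ?\<sigma> = "nstore v 0 0 \<sigma>"
  have 1: "exec (NStore v (NConst 0) (NConst 0)) \<sigma> 3 ?\<sigma>"
    using exec.NStore[of v "NConst 0" "NConst 0" \<sigma>] by (simp add: numeral_eq_Suc)
  obtain t \<sigma>' where 2: "exec (While ?b (Seq p ?i)) ?\<sigma> t \<sigma>'" "t \<le> (c + 14) * Suc n + 8" "Inv (Suc n) \<sigma>'"
    using while[of 0 "Suc n" ?\<sigma>] upd[OF init] by (auto simp: nstore_def)
  have "(c + 14) * n \<le> (c + 25) * n" by simp
  then have "3 + t \<le> (c + 25) * Suc n" using 2(2) unfolding mult_Suc_right by linarith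
  with exec.Seq[OF 1 2(1)] 2(3) show ?thesis unfolding loop_def by blast
qed

text \<open>The coefficient in front of the power of the number of rounds whose exponent is
  \<open>expr_depth\<close>; \<open>d\<close> is the cost of the target index. The 30 in a fold
  covers the loop overhead 25 and the final copy out of the accumulator.\<close>

primrec expr_cost :: "expr \<Rightarrow> nat \<Rightarrow> nat" where
  "expr_cost (Pure e) d = 1 + d + rcost e"
| "expr_cost (IfE b e e') d = 1 + bcost b + expr_cost e d + expr_cost e' d"
| "expr_cost (Fold r v e e') d = expr_cost e 1 + expr_cost e' 1 + 30 + d"

primrec stmt_cost :: "stmt \<Rightarrow> nat" where
  "stmt_cost (Tab X v e) = expr_cost e 2 + 25"
| "stmt_cost (Sq p q) = stmt_cost p + stmt_cost q"
| "stmt_cost (ForS v p) = stmt_cost p + 25"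

lemma pow_le: "a * Suc n ^ d \<le> a * Suc n ^ e" if "d \<le> e"
  using that by (simp add: power_increasing del: power_Suc)

text \<open>The frame protects only arrays in \<open>B\<close> and below 100, and only counters in
  \<open>S\<close>: nested folds overwrite accumulators and counters that are not in scope. A target
  below 100 must change in a single cell, because it is a table under construction.\<close>

lemma compile_expr_exec:
  assumes "expr_ok S B e" "0 \<in> S" "nexp_ok S i" "\<And>a. a \<in> S \<Longrightarrow> narr \<sigma> a 0 = env a" "agree B (rarr \<sigma>) h"
    "X \<ge> 100 \<Longrightarrow> i = NConst 0"
  shows "\<exists>t \<sigma>'. exec (compile_expr e X i) \<sigma> t \<sigma>' \<and> t \<le> expr_cost e (ncost i) * Suc (env 0) ^ expr_depth e \<and>
    (\<forall>a\<in>S. narr \<sigma>' a 0 = env a) \<and>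
    (\<forall>a. a \<noteq> X \<and> (a \<in> B \<or> a < 100) \<longrightarrow> rarr \<sigma>' a = rarr \<sigma> a) \<and>
    rarr \<sigma>' X (nval i \<sigma>) = expr_val e env h \<and>
    (X < 100 \<longrightarrow> rarr \<sigma>' X = (rarr \<sigma> X)(nval i \<sigma> := expr_val e env h))"
  using assms
proof (induction e arbitrary: S B env h \<sigma> X i)
  case (Pure e)
  have "rval e \<sigma> = rval e (store_of env h)"
    using Pure.prems by (intro rexp_ok_cong[of S B]) (auto simp: store_of_def)
  then show ?case using exec.RStore[of X i e \<sigma>] Pure.prems
    by (intro exI conjI) (auto simp: rstore_def)
next
  case (IfE b e e')
  have b: "bval b \<sigma> = bval b (store_of env h)"
    using IfE.prems by (intro bexp_ok_cong[of S B]) (auto simp: store_of_def)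
  let ?k = "\<lambda>e. expr_cost e (ncost i)" and ?N = "Suc (env 0)"
  have m: "?k e * ?N ^ expr_depth e \<le> ?k e * ?N ^ max (expr_depth e) (expr_depth e')"
    "?k e' * ?N ^ expr_depth e' \<le> ?k e' * ?N ^ max (expr_depth e) (expr_depth e')"
    "1 + bcost b \<le> (1 + bcost b) * ?N ^ max (expr_depth e) (expr_depth e')"
    using mult_le_mono2[of 1 "?N ^ max (expr_depth e) (expr_depth e')" "1 + bcost b"] pow_le[of "expr_depth e" "max (expr_depth e) (expr_depth e')"]
      pow_le[of "expr_depth e'" "max (expr_depth e) (expr_depth e')"] by auto
  show ?case
  proof (cases "bval b \<sigma>")
    case True
    obtain t \<sigma>' where 1: "exec (compile_expr e X i) \<sigma> t \<sigma>'" "t \<le> ?k e * ?N ^ expr_depth e"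
      "\<forall>a\<in>S. narr \<sigma>' a 0 = env a" "\<forall>a. a \<noteq> X \<and> (a \<in> B \<or> a < 100) \<longrightarrow> rarr \<sigma>' a = rarr \<sigma> a"
      "rarr \<sigma>' X (nval i \<sigma>) = expr_val e env h" "X < 100 \<longrightarrow> rarr \<sigma>' X = (rarr \<sigma> X)(nval i \<sigma> := expr_val e env h)"
      using IfE.IH(1)[OF _ IfE.prems(2-6)] IfE.prems(1) unfolding expr_ok.simps by blast
    have "1 + bcost b + t \<le> expr_cost (IfE b e e') (ncost i) * ?N ^ max (expr_depth e) (expr_depth e')"
      using m 1(2) unfolding expr_cost.simps add_mult_distrib by linarith
    then show ?thesis using exec.IfTrue[OF True 1(1), of "compile_expr e' X i"] 1 b True by (intro exI conjI) auto
  next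
    case False
    obtain t \<sigma>' where 1: "exec (compile_expr e' X i) \<sigma> t \<sigma>'" "t \<le> ?k e' * ?N ^ expr_depth e'"
      "\<forall>a\<in>S. narr \<sigma>' a 0 = env a" "\<forall>a. a \<noteq> X \<and> (a \<in> B \<or> a < 100) \<longrightarrow> rarr \<sigma>' a = rarr \<sigma> a"
      "rarr \<sigma>' X (nval i \<sigma>) = expr_val e' env h" "X < 100 \<longrightarrow> rarr \<sigma>' X = (rarr \<sigma> X)(nval i \<sigma> := expr_val e' env h)"
      using IfE.IH(2)[OF _ IfE.prems(2-6)] IfE.prems(1) unfolding expr_ok.simps by blast
    have "1 + bcost b + t \<le> expr_cost (IfE b e e') (ncost i) * ?N ^ max (expr_depth e) (expr_depth e')"
      using m 1(2) unfolding expr_cost.simps add_mult_distrib by linarith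
    then show ?thesis using exec.IfFalse[OF False 1(1), of "compile_expr e X i"] 1 b False by (intro exI conjI) auto
  qed
next
  case (Fold r v e e')
  let ?N = "Suc (env 0)" and ?z = "NConst 0"
  have ok: "r \<ge> 100" "r \<notin> B" "v \<notin> S" "expr_ok S B e" "expr_ok (insert v S) (insert r B) e'" "v \<noteq> 0"
    using Fold.prems(1,2) by (auto intro: Nat.gr0I)
  obtain t1 \<sigma>1 where 1: "exec (compile_expr e r ?z) \<sigma> t1 \<sigma>1" "t1 \<le> expr_cost e 1 * ?N ^ expr_depth e"
      "\<forall>a\<in>S. narr \<sigma>1 a 0 = env a" "\<forall>a. a \<noteq> r \<and> (a \<in> B \<or> a < 100) \<longrightarrow> rarr \<sigma>1 a = rarr \<sigma> a"
      "rarr \<sigma>1 r 0 = expr_val e env h"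
    using Fold.IH(1)[of S B ?z \<sigma> env h r] Fold.prems ok by auto
  define g where "g k = fold (\<lambda>k y. expr_val e' (env(v := k)) (h(r := (\<lambda>_. y)))) [0..<k] (expr_val e env h)" for k
  define Inv where "Inv k \<sigma>' \<longleftrightarrow> (\<forall>a\<in>S. narr \<sigma>' a 0 = env a) \<and>
     (\<forall>a. a \<noteq> r \<and> (a \<in> B \<or> a < 100) \<longrightarrow> rarr \<sigma>' a = rarr \<sigma> a) \<and> rarr \<sigma>' r 0 = g k" for k and \<sigma>' :: store
  have "\<exists>t \<sigma>'. exec (loop v (compile_expr e' r ?z)) \<sigma>1 t \<sigma>' \<and> t \<le> (expr_cost e' 1 * ?N ^ expr_depth e' + 25) * ?N \<and> Inv ?N \<sigma>'"
  proof (rule loop_exec)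
    show "v \<noteq> 0" by fact
    show "narr \<sigma> 0 0 = env 0" if "Inv k \<sigma>" for k \<sigma> using that Fold.prems(2) by (auto simp: Inv_def)
    show "Inv k (nstore v 0 x \<sigma>)" if "Inv k \<sigma>" for k \<sigma> x
      using that ok(3) by (auto simp: Inv_def nstore_def)
    show "Inv 0 \<sigma>1" using 1 by (auto simp: Inv_def g_def)
    show "\<exists>t \<sigma>'. exec (compile_expr e' r ?z) \<sigma>2 t \<sigma>' \<and> t \<le> expr_cost e' 1 * ?N ^ expr_depth e' \<and> narr \<sigma>' v 0 = k \<and> Inv (Suc k) \<sigma>'"
      if "k \<le> env 0" "Inv k \<sigma>2" "narr \<sigma>2 v 0 = k" for k \<sigma>2
    proof -
      have "agree (insert r B) (rarr \<sigma>2) (h(r := (\<lambda>_. g k)))"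
        using that(2) ok(1,2) Fold.prems(5) by (auto simp: Inv_def agree_def)
      moreover have "\<And>a. a \<in> insert v S \<Longrightarrow> narr \<sigma>2 a 0 = (env(v := k)) a"
        using that(2,3) by (auto simp: Inv_def)
      ultimately obtain t \<sigma>' where 2: "exec (compile_expr e' r ?z) \<sigma>2 t \<sigma>'" "t \<le> expr_cost e' 1 * ?N ^ expr_depth e'"
        "\<forall>a\<in>insert v S. narr \<sigma>' a 0 = (env(v := k)) a"
        "\<forall>a. a \<noteq> r \<and> (a \<in> insert r B \<or> a < 100) \<longrightarrow> rarr \<sigma>' a = rarr \<sigma>2 a"
        "rarr \<sigma>' r 0 = expr_val e' (env(v := k)) (h(r := (\<lambda>_. g k)))"
        using Fold.IH(2)[of "insert v S" "insert r B" ?z \<sigma>2 "env(v := k)" "h(r := (\<lambda>_. g k))" r, OF ok(5)]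
          ok(1,6) Fold.prems(2) by (auto simp del: fun_upd_apply) (auto simp: fun_upd_apply)
      have "narr \<sigma>' a 0 = env a" if "a \<in> S" for a using 2(3) that ok(3) by force
      then have "Inv (Suc k) \<sigma>'" using 2 that(2) by (auto simp: Inv_def g_def)
      with 2 show ?thesis by auto
    qed
  qed
  then obtain t2 \<sigma>2 where 2: "exec (loop v (compile_expr e' r ?z)) \<sigma>1 t2 \<sigma>2"
      "t2 \<le> (expr_cost e' 1 * ?N ^ expr_depth e' + 25) * ?N" "Inv ?N \<sigma>2" by blast
  let ?\<sigma>3 = "rstore X (nval i \<sigma>2) (rarr \<sigma>2 r 0) \<sigma>2"
  have 3: "exec (RStore X i (RLoad r ?z)) \<sigma>2 (3 + ncost i) ?\<sigma>3"
    using exec.RStore[of X i "RLoad r ?z" \<sigma>2] by (simp add: numeral_eq_Suc)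
  have i: "nval i \<sigma>2 = nval i \<sigma>"
    using Fold.prems(3) 2(3) Fold.prems(4) by (intro nexp_ok_cong[of S]) (auto simp: Inv_def)
  have g: "rarr \<sigma>2 r 0 = expr_val (Fold r v e e') env h" using 2(3) by (simp add: Inv_def g_def)
  let ?D = "max (expr_depth e) (Suc (expr_depth e'))"
  have "t1 \<le> expr_cost e 1 * ?N ^ ?D" using 1(2) pow_le[of "expr_depth e" ?D "expr_cost e 1" "env 0"] by linarith
  moreover have "t2 \<le> expr_cost e' 1 * ?N ^ ?D + 25 * ?N ^ ?D"
  proof -
    have "(expr_cost e' 1 * ?N ^ expr_depth e' + 25) * ?N = expr_cost e' 1 * ?N ^ Suc (expr_depth e') + 25 * ?N ^ 1"
      by (simp add: algebra_simps)
    moreover have "25 * ?N ^ 1 \<le> 25 * ?N ^ ?D" "expr_cost e' 1 * ?N ^ Suc (expr_depth e') \<le> expr_cost e' 1 * ?N ^ ?D"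
      by (intro pow_le; simp)+
    ultimately show ?thesis using 2(2) by linarith
  qed
  moreover have "3 + ncost i \<le> (3 + ncost i) * ?N ^ ?D" by simp
  ultimately have "t1 + (t2 + (3 + ncost i)) \<le> expr_cost (Fold r v e e') (ncost i) * ?N ^ ?D"
    by (simp add: algebra_simps)
  moreover have "rarr ?\<sigma>3 a = rarr \<sigma> a" if "a \<noteq> X \<and> (a \<in> B \<or> a < 100)" for a
    using that 2(3) ok(1,2) by (auto simp: rstore_def Inv_def)
  moreover have "rarr ?\<sigma>3 X = (rarr \<sigma> X)(nval i \<sigma> := expr_val (Fold r v e e') env h)" if "X < 100"
    using that 2(3) ok(1) i g by (auto simp: rstore_def Inv_def)
  moreover have "\<forall>a\<in>S. narr ?\<sigma>3 a 0 = env a" using 2(3) by (auto simp: rstore_def Inv_def)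
  moreover have "rarr ?\<sigma>3 X (nval i \<sigma>) = expr_val (Fold r v e e') env h" using i g by (simp add: rstore_def)
  ultimately show ?case using exec.Seq[OF 1(1) exec.Seq[OF 2(1) 3]]
    unfolding compile_expr.simps expr_depth.simps by blast
qed

lemma compile_stmt_exec:
  assumes "stmt_ok S p" "0 \<in> S" "\<And>a. a \<in> S \<Longrightarrow> narr \<sigma> a 0 = env a" "agree {..<100} (rarr \<sigma>) h"
  shows "\<exists>t \<sigma>'. exec (compile_stmt p) \<sigma> t \<sigma>' \<and> t \<le> stmt_cost p * Suc (env 0) ^ stmt_depth p \<and>
    (\<forall>a\<in>S. narr \<sigma>' a 0 = env a) \<and> agree {..<100} (rarr \<sigma>') (run_stmt p env h)"
  using assms
proof (induction p arbitrary: S env h \<sigma>)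
  case (Tab X v e)
  let ?N = "Suc (env 0)" and ?i = "NLoad v (NConst 0)"
  have ok: "X < 100" "v \<notin> S" "expr_ok (insert v S) ({..<100} - {X}) e" "v \<noteq> 0"
    using Tab.prems(1,2) by (auto intro: Nat.gr0I)
  define Inv where "Inv k \<sigma>' \<longleftrightarrow> (\<forall>a\<in>S. narr \<sigma>' a 0 = env a) \<and>
     agree {..<100} (rarr \<sigma>') (h(X := (\<lambda>j. if j < k then expr_val e (env(v := j)) h else h X j)))" for k and \<sigma>' :: store
  have "\<exists>t \<sigma>'. exec (loop v (compile_expr e X ?i)) \<sigma> t \<sigma>' \<and> t \<le> (expr_cost e 2 * ?N ^ expr_depth e + 25) * ?N \<and> Inv ?N \<sigma>'"
  proof (rule loop_exec)
    show "v \<noteq> 0" by fact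
    show "narr \<sigma> 0 0 = env 0" if "Inv k \<sigma>" for k \<sigma> using that Tab.prems(2) by (auto simp: Inv_def)
    show "Inv k (nstore v 0 x \<sigma>)" if "Inv k \<sigma>" for k \<sigma> x
      using that ok(2) by (auto simp: Inv_def nstore_def)
    show "Inv 0 \<sigma>" using Tab.prems by (auto simp: Inv_def agree_def)
    show "\<exists>t \<sigma>'. exec (compile_expr e X ?i) \<sigma>2 t \<sigma>' \<and> t \<le> expr_cost e 2 * ?N ^ expr_depth e \<and> narr \<sigma>' v 0 = k \<and> Inv (Suc k) \<sigma>'"
      if "k \<le> env 0" "Inv k \<sigma>2" "narr \<sigma>2 v 0 = k" for k \<sigma>2
    proof -
      note vk = that(3)
      have "agree ({..<100} - {X}) (rarr \<sigma>2) h" using that(2) by (auto simp: Inv_def agree_def)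
      moreover have "\<And>a. a \<in> insert v S \<Longrightarrow> narr \<sigma>2 a 0 = (env(v := k)) a"
        using that(2,3) by (auto simp: Inv_def)
      ultimately obtain t \<sigma>' where 2: "exec (compile_expr e X ?i) \<sigma>2 t \<sigma>'" "t \<le> expr_cost e 2 * ?N ^ expr_depth e"
        "\<forall>a\<in>insert v S. narr \<sigma>' a 0 = (env(v := k)) a"
        "\<forall>a. a \<noteq> X \<and> a < 100 \<longrightarrow> rarr \<sigma>' a = rarr \<sigma>2 a"
        "rarr \<sigma>' X = (rarr \<sigma>2 X)(k := expr_val e (env(v := k)) h)"
        using compile_expr_exec[of "insert v S" "{..<100} - {X}" e ?i \<sigma>2 "env(v := k)" h X] ok Tab.prems(2) vk
        by (auto simp: numeral_2_eq_2)
      have "narr \<sigma>' a 0 = env a" if "a \<in> S" for a using 2(3) that ok(2) by force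
      then have "Inv (Suc k) \<sigma>'" using 2 that(2) ok(1)
        by (auto simp: Inv_def agree_def fun_eq_iff less_Suc_eq)
      with 2 show ?thesis by auto
    qed
  qed
  then obtain t \<sigma>' where 1: "exec (compile_stmt (Tab X v e)) \<sigma> t \<sigma>'" "t \<le> (expr_cost e 2 * ?N ^ expr_depth e + 25) * ?N" "Inv ?N \<sigma>'"
    by auto
  have "t \<le> stmt_cost (Tab X v e) * ?N ^ stmt_depth (Tab X v e)"
    using 1(2) pow_le[of 1 "stmt_depth (Tab X v e)" 25 "env 0"] by (simp add: algebra_simps)
  with 1 show ?case by (intro exI[of _ t] exI[of _ \<sigma>']) (simp add: Inv_def less_Suc_eq_le fun_upd_def)
next
  case (Sq p q)
  obtain t1 \<sigma>1 where 1: "exec (compile_stmt p) \<sigma> t1 \<sigma>1" "t1 \<le> stmt_cost p * Suc (env 0) ^ stmt_depth p"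
    "\<forall>a\<in>S. narr \<sigma>1 a 0 = env a" "agree {..<100} (rarr \<sigma>1) (run_stmt p env h)"
    using Sq.IH(1)[of S \<sigma> env h] Sq.prems by auto
  obtain t2 \<sigma>2 where 2: "exec (compile_stmt q) \<sigma>1 t2 \<sigma>2" "t2 \<le> stmt_cost q * Suc (env 0) ^ stmt_depth q"
    "\<forall>a\<in>S. narr \<sigma>2 a 0 = env a" "agree {..<100} (rarr \<sigma>2) (run_stmt q env (run_stmt p env h))"
    using Sq.IH(2)[of S \<sigma>1 env "run_stmt p env h"] Sq.prems 1 by auto
  let ?D = "max (stmt_depth p) (stmt_depth q)"
  have "t1 + t2 \<le> stmt_cost (Sq p q) * Suc (env 0) ^ ?D"
    using 1(2) 2(2) pow_le[of "stmt_depth p" ?D "stmt_cost p" "env 0"] pow_le[of "stmt_depth q" ?D "stmt_cost q" "env 0"]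
    unfolding stmt_cost.simps add_mult_distrib by linarith
  with exec.Seq[OF 1(1) 2(1)] 2 show ?case by (intro exI[of _ "t1 + t2"] exI[of _ \<sigma>2]) simp
next
  case (ForS v p)
  let ?N = "Suc (env 0)"
  have ok: "v \<notin> S" "stmt_ok (insert v S) p" "v \<noteq> 0"
    using ForS.prems(1,2) by (auto intro: Nat.gr0I)
  define g where "g k = fold (\<lambda>k. run_stmt p (env(v := k))) [0..<k] h" for k
  define Inv where "Inv k \<sigma>' \<longleftrightarrow> (\<forall>a\<in>S. narr \<sigma>' a 0 = env a) \<and> agree {..<100} (rarr \<sigma>') (g k)" for k and \<sigma>' :: store
  have "\<exists>t \<sigma>'. exec (loop v (compile_stmt p)) \<sigma> t \<sigma>' \<and> t \<le> (stmt_cost p * ?N ^ stmt_depth p + 25) * ?N \<and> Inv ?N \<sigma>'"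
  proof (rule loop_exec)
    show "v \<noteq> 0" by fact
    show "narr \<sigma> 0 0 = env 0" if "Inv k \<sigma>" for k \<sigma> using that ForS.prems(2) by (auto simp: Inv_def)
    show "Inv k (nstore v 0 x \<sigma>)" if "Inv k \<sigma>" for k \<sigma> x
      using that ok(1) by (auto simp: Inv_def nstore_def)
    show "Inv 0 \<sigma>" using ForS.prems by (auto simp: Inv_def agree_def g_def)
    show "\<exists>t \<sigma>'. exec (compile_stmt p) \<sigma>2 t \<sigma>' \<and> t \<le> stmt_cost p * ?N ^ stmt_depth p \<and> narr \<sigma>' v 0 = k \<and> Inv (Suc k) \<sigma>'"
      if "k \<le> env 0" "Inv k \<sigma>2" "narr \<sigma>2 v 0 = k" for k \<sigma>2
    proof -
      note I2 = that(2)
      have "\<And>a. a \<in> insert v S \<Longrightarrow> narr \<sigma>2 a 0 = (env(v := k)) a"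
        using that(2,3) by (auto simp: Inv_def)
      then obtain t \<sigma>' where 2: "exec (compile_stmt p) \<sigma>2 t \<sigma>'" "t \<le> stmt_cost p * ?N ^ stmt_depth p"
        "\<forall>a\<in>insert v S. narr \<sigma>' a 0 = (env(v := k)) a"
        "agree {..<100} (rarr \<sigma>') (run_stmt p (env(v := k)) (g k))"
        using ForS.IH[of "insert v S" \<sigma>2 "env(v := k)" "g k", OF ok(2)] ok(3) ForS.prems(2) I2
        by (auto simp: Inv_def simp del: fun_upd_apply)
      have "narr \<sigma>' a 0 = env a" if "a \<in> S" for a using 2(3) that ok(1) by force
      then have "Inv (Suc k) \<sigma>'" using 2 by (auto simp: Inv_def g_def)
      with 2 show ?thesis by auto
    qed
  qed
  then obtain t \<sigma>' where 1: "exec (compile_stmt (ForS v p)) \<sigma> t \<sigma>'" "t \<le> (stmt_cost p * ?N ^ stmt_depth p + 25) * ?N" "Inv ?N \<sigma>'"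
    by auto
  have "t \<le> stmt_cost (ForS v p) * ?N ^ stmt_depth (ForS v p)"
    using 1(2) pow_le[of 1 "stmt_depth (ForS v p)" 25 "env 0"] by (simp add: algebra_simps)
  with 1 show ?case by (intro exI[of _ t] exI[of _ \<sigma>']) (simp add: Inv_def g_def)
qed

section \<open>Minima of hinge functions\<close>

text \<open>A point is not a concave kink of \<open>f\<close> if \<open>f\<close> has a linear lower bound around it. Unlike
  concavity, this survives the jumps at which a vertex starts to send flow, and it is closed under sums.\<close>

definition nokink :: "(real \<Rightarrow> real) \<Rightarrow> real \<Rightarrow> bool" where
  "nokink f u \<longleftrightarrow> (\<exists>\<sigma> e. e > 0 \<and> (\<forall>h. \<bar>h\<bar> < e \<longrightarrow> f u + \<sigma> * h \<le> f (u + h)))"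

definition hinge :: "(nat \<Rightarrow> real) \<Rightarrow> (nat \<Rightarrow> real) \<Rightarrow> (nat \<Rightarrow> real) \<Rightarrow> nat \<Rightarrow> real \<Rightarrow> real" where
  "hinge z c t j u = t j + max 0 ((u - z j) * c j)"

definition hmin :: "nat \<Rightarrow> (nat \<Rightarrow> real) \<Rightarrow> (nat \<Rightarrow> real) \<Rightarrow> (nat \<Rightarrow> real) \<Rightarrow> real \<Rightarrow> real" where
  "hmin n z c t u = Min ((\<lambda>j. hinge z c t j u) ` {..n})"

definition flat_crossing :: "(nat \<Rightarrow> real) \<Rightarrow> (nat \<Rightarrow> real) \<Rightarrow> (nat \<Rightarrow> real) \<Rightarrow> nat \<Rightarrow> nat \<Rightarrow> real" where
  "flat_crossing z c t j m = z j + (t m - t j) / c j"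

definition line_crossing :: "(nat \<Rightarrow> real) \<Rightarrow> (nat \<Rightarrow> real) \<Rightarrow> (nat \<Rightarrow> real) \<Rightarrow> nat \<Rightarrow> nat \<Rightarrow> real" where
  "line_crossing z c t j m = (t m - t j + z j * c j - z m * c m) / (c j - c m)"

text \<open>Hinge \<open>m\<close> undercuts the rising line of \<open>j\<close> either with its
  flat part, if the height \<open>t m\<close> is reached before \<open>z m\<close>, or with its own
  rising part, which needs a strictly smaller slope.\<close>

definition crossings :: "nat \<Rightarrow> (nat \<Rightarrow> real) \<Rightarrow> (nat \<Rightarrow> real) \<Rightarrow> (nat \<Rightarrow> real) \<Rightarrow> nat \<Rightarrow> real set" where
  "crossings n z c t j =
     {flat_crossing z c t j m |m. m \<le> n \<and> j < m \<and> flat_crossing z c t j m < z m} \<union>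
     {line_crossing z c t j m |m. m \<le> n \<and> j < m \<and> \<not> flat_crossing z c t j m < z m \<and> c m < c j}"

text \<open>\<open>line_exit n z c t j\<close> is the point at which the rising part of hinge \<open>j\<close> ceases to be the minimum.
  Only hinges of larger index matter, since those of smaller index are steeper. If \<open>c j = 0\<close> then the
  value is junk.\<close>

definition line_exit :: "nat \<Rightarrow> (nat \<Rightarrow> real) \<Rightarrow> (nat \<Rightarrow> real) \<Rightarrow> (nat \<Rightarrow> real) \<Rightarrow> nat \<Rightarrow> real" where
  "line_exit n z c t j = Min (insert (flat_crossing z c t j n) (crossings n z c t j))"

section \<open>Concave kinks of a minimum of hinges\<close>

lemma hmin_le: "j \<le> n \<Longrightarrow> hmin n z c t u \<le> hinge z c t j u"
  by (simp add: hmin_def)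

lemma hmin_attained: "\<exists>j\<le>n. hmin n z c t u = hinge z c t j u"
proof -
  have "hmin n z c t u \<in> (\<lambda>j. hinge z c t j u) ` {..n}"
    unfolding hmin_def by (intro Min_in) auto
  then show ?thesis by auto
qed

lemma le_hmin_iff: "y \<le> hmin n z c t u \<longleftrightarrow> (\<forall>j\<le>n. y \<le> hinge z c t j u)"
  by (auto simp: hmin_def)

lemma finite_crossings: "finite (crossings n z c t j)"
  by (simp add: crossings_def)

text \<open>The order is outwards from a slot: a farther vertex leaves more weight \<open>t\<close>
  in between and has a smaller capacity \<open>c\<close>. Slope 0 marks padding, whose
  \<open>z\<close> is arbitrary, hence the restriction in \<open>z_mono\<close>. The last hinge is
  padding, so the minimum is bounded by \<open>t n\<close>.\<close>

locale hinges =
  fixes n :: nat and z c t :: "nat \<Rightarrow> real"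
  assumes t_mono: "\<And>j m. j \<le> m \<Longrightarrow> m \<le> n \<Longrightarrow> t j \<le> t m"
    and c_anti: "\<And>j m. j \<le> m \<Longrightarrow> m \<le> n \<Longrightarrow> c m \<le> c j"
    and c_nonneg: "\<And>j. j \<le> n \<Longrightarrow> 0 \<le> c j"
    and c_last: "c n = 0"
    and z_mono: "\<And>j m. j \<le> m \<Longrightarrow> m \<le> n \<Longrightarrow> c m > 0 \<Longrightarrow> z j \<le> z m"
begin

abbreviation "H \<equiv> hinge z c t"
abbreviation "A \<equiv> hmin n z c t"

lemma hinge_mono: "j \<le> n \<Longrightarrow> u \<le> v \<Longrightarrow> H j u \<le> H j v"
  using mult_right_mono[of "u - z j" "v - z j" "c j"] c_nonneg[of j] by (auto simp: hinge_def max_def)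

lemma hinge_flat: "j \<le> n \<Longrightarrow> c j = 0 \<or> u \<le> z j \<Longrightarrow> H j u = t j"
  using mult_nonpos_nonneg[of "u - z j" "c j"] c_nonneg[of j] by (auto simp: hinge_def)

lemma A_mono: "u \<le> v \<Longrightarrow> A u \<le> A v"
  by (meson hinge_mono hmin_le le_hmin_iff order_trans)

lemma hinge_line: "j \<le> n \<Longrightarrow> z j \<le> u \<Longrightarrow> H j u = t j + (u - z j) * c j"
  using c_nonneg[of j] by (simp add: hinge_def max_def)

lemma continuous_hinge: "isCont (H j) u"
  unfolding hinge_def by (intro continuous_intros)

lemma continuous_A: "isCont A u"
proof -
  have "isCont (\<lambda>u. Min ((\<lambda>j. H j u) ` {..k})) u" for k
  proof (induction k)
    case 0
    then show ?case by (simp add: continuous_hinge)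
  next
    case (Suc k)
    have "(\<lambda>u. Min ((\<lambda>j. H j u) ` {..Suc k})) = (\<lambda>u. min (H (Suc k) u) (Min ((\<lambda>j. H j u) ` {..k})))"
      by (auto simp: atMost_Suc)
    with Suc show ?case by (auto intro!: continuous_intros continuous_hinge)
  qed
  then show ?thesis unfolding hmin_def .
qed

text \<open>Up to its crossing with hinge \<open>m\<close> the line of \<open>j\<close> is the lower
  one. With equal slopes there is no crossing, but then the line is at most \<open>t m\<close> at
  \<open>z m\<close> and runs parallel below hinge \<open>m\<close> from there on.\<close>

lemma line_below:
  assumes "j < m" "m \<le> n" "c j > 0" "z j \<le> u" "u \<le> line_exit n z c t j"
  shows "H j u \<le> H m u"
proof -
  let ?Y = "flat_crossing z c t j m"
  have Hj: "H j u = t j + (u - z j) * c j" using assms hinge_line by simp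
  have le: "y \<in> crossings n z c t j \<Longrightarrow> u \<le> y" for y
    using assms(5) finite_crossings[of n z c t j] by (auto simp: line_exit_def)
  have Y: "u \<le> ?Y \<longleftrightarrow> t j + (u - z j) * c j \<le> t m"
    using assms(3) by (auto simp: flat_crossing_def field_simps)
  have flat: "H j u \<le> H m u" if "u \<le> ?Y"
    using that Y Hj by (auto simp: hinge_def)
  show ?thesis
  proof (cases "?Y < z m")
    case True
    then have "?Y \<in> crossings n z c t j" using assms by (auto simp: crossings_def)
    from flat[OF le[OF this]] show ?thesis .
  next
    case False
    show ?thesis
    proof (cases "u \<le> ?Y")
      case F2: False
      have *: "t j + (z m - z j) * c j \<le> t m" using False assms(3) by (auto simp: flat_crossing_def field_simps)
      have zm: "z m \<le> u" using False F2 by simp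
      have "t j + (u - z j) * c j \<le> t m + (u - z m) * c m"
      proof (cases "c m < c j")
        case True
        then have "line_crossing z c t j m \<in> crossings n z c t j" using assms False by (auto simp: crossings_def)
        from le[OF this] True show ?thesis by (auto simp: line_crossing_def field_simps)
      next
        case False
        then have "c m = c j" using c_anti[of j m] assms by simp
        with * show ?thesis by (simp add: algebra_simps)
      qed
      then show ?thesis using Hj by (simp add: hinge_def)
    qed (rule flat)
  qed
qed

text \<open>Behind a crossing with hinge \<open>m\<close>, the line of \<open>j\<close> is above
  hinge \<open>m\<close> and at least as steep, so it can never attain the minimum again. The
  padding hinge \<open>n\<close> supplies the bound by \<open>flat_crossing\<close>.\<close>

lemma le_line_exit:
  assumes "j \<le> n" "c j > 0" "z j \<le> u" "A u = H j u"
  shows "u \<le> line_exit n z c t j"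
proof -
  have Hj: "H j u = t j + (u - z j) * c j" using assms hinge_line by simp
  have le: "m \<le> n \<Longrightarrow> H j u \<le> H m u" for m using hmin_le[of m n z c t u] assms by simp
  have "H n u = t n" using c_last by (simp add: hinge_def)
  with le[of n] Hj have "u \<le> flat_crossing z c t j n" using assms(2) by (auto simp: flat_crossing_def field_simps)
  moreover have "u \<le> y" if "y \<in> crossings n z c t j" for y
  proof -
    from that consider m where "m \<le> n" "j < m" "y = flat_crossing z c t j m" "y < z m"
      | m where "m \<le> n" "j < m" "y = line_crossing z c t j m" "\<not> flat_crossing z c t j m < z m" "c m < c j"
      by (auto simp: crossings_def)
    then show ?thesis
    proof cases
      case 1
      show ?thesis
      proof (rule ccontr)
        assume *: "\<not> u \<le> y"
        have "t j + (y - z j) * c j = t m" using 1(3) assms(2) by (auto simp: flat_crossing_def)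
        have "H j u \<le> H m u" using le 1 by simp
        moreover have "t m < t j + (u - z j) * c j"
          using * 1(3) assms(2) by (auto simp: flat_crossing_def field_simps)
        ultimately have "H m u \<noteq> t m" using Hj by simp
        then have zm: "z m < u" "c m > 0" using hinge_flat[of m u] c_nonneg[of m] 1 by force+
        then have "t j + (u - z j) * c j \<le> t m + (u - z m) * c m"
          using \<open>H j u \<le> H m u\<close> Hj hinge_line[of m u] 1 by simp
        also have "\<dots> \<le> t m + (u - z m) * c j"
          using c_anti[of j m] 1 zm by (auto intro!: mult_left_mono)
        also have "\<dots> < t m + (u - y) * c j" using 1(4) assms(2) by simp
        also have "\<dots> = t j + (u - z j) * c j"
          using \<open>t j + (y - z j) * c j = t m\<close> by (simp add: algebra_simps)
        finally show False by simp
      qed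
    next
      case 2
      show ?thesis
      proof (cases "z m \<le> u")
        case True
        have "H m u = t m + (u - z m) * c m" using hinge_line 2 True by simp
        with le[of m] 2 Hj have "t j + (u - z j) * c j \<le> t m + (u - z m) * c m" by simp
        with 2(3,5) show ?thesis by (auto simp: line_crossing_def pos_le_divide_eq algebra_simps)
      next
        case False
        have "t j + (z m - z j) * c j \<le> t m" using 2(4) assms(2) by (auto simp: flat_crossing_def field_simps)
        then have "z m \<le> y" using 2(3,5) by (auto simp: line_crossing_def pos_le_divide_eq algebra_simps)
        with False show ?thesis by simp
      qed
    qed
  qed
  ultimately show ?thesis using finite_crossings by (simp add: line_exit_def)
qed

text \<open>A supporting line is found at \<open>u\<close>. Inactive hinges exceed
  \<open>A u\<close> and are continuous, so any slope suits them nearby. If no active hinge is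
  rising before \<open>u\<close>, slope 0 works. Otherwise the active rising hinge \<open>j\<close>
  of least index, hence the steepest, gives the slope: to the left the other active hinges fall more
  slowly, and to the right its own line stays lowest until its exit, which lies strictly behind
  \<open>u\<close>.\<close>

lemma nokink_A:
  assumes "\<And>j. j \<le> n \<Longrightarrow> c j > 0 \<Longrightarrow> u \<noteq> line_exit n z c t j"
  shows "nokink A u"
proof -
  let ?act = "\<lambda>j. j \<le> n \<and> H j u = A u"
  have near: "\<exists>e>0. \<forall>j\<le>n. \<not> ?act j \<longrightarrow> (\<forall>h. \<bar>h\<bar> < e \<longrightarrow> A u + \<sigma> * h \<le> H j (u + h))" for \<sigma>
  proof -
    have "eventually (\<lambda>h. \<forall>j\<in>{j. j \<le> n \<and> \<not> ?act j}. A u + \<sigma> * h \<le> H j (u + h)) (nhds 0)"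
    proof (rule eventually_ball_finite)
      show "\<forall>j\<in>{j. j \<le> n \<and> \<not> ?act j}. eventually (\<lambda>h. A u + \<sigma> * h \<le> H j (u + h)) (nhds 0)"
      proof
        fix j assume "j \<in> {j. j \<le> n \<and> \<not> ?act j}"
        then have "A u < H j u" using hmin_le[of j n z c t u] by auto
        have "isCont (\<lambda>h. H j (u + h) - (A u + \<sigma> * h)) 0"
          unfolding hinge_def by (intro continuous_intros)
        then have "((\<lambda>h. H j (u + h) - (A u + \<sigma> * h)) \<longlongrightarrow> H j u - A u) (nhds 0)"
          by (simp add: isCont_def tendsto_nhds_iff)
        moreover have "0 < H j u - A u" using \<open>A u < H j u\<close> by simp
        ultimately have "eventually (\<lambda>h. 0 < H j (u + h) - (A u + \<sigma> * h)) (nhds 0)"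
          by (rule order_tendstoD(1))
        then show "eventually (\<lambda>h. A u + \<sigma> * h \<le> H j (u + h)) (nhds 0)"
          by eventually_elim simp
      qed
    qed simp
    then obtain e where "e > 0" "\<And>h. dist h 0 < e \<Longrightarrow> \<forall>j\<in>{j. j \<le> n \<and> \<not> ?act j}. A u + \<sigma> * h \<le> H j (u + h)"
      unfolding eventually_nhds_metric by blast
    then show ?thesis by (intro exI[of _ e]) (auto simp: dist_real_def)
  qed
  show ?thesis
  proof (cases "\<exists>j. ?act j \<and> c j > 0 \<and> z j < u")
    case False
    obtain e where e: "e > 0" "\<And>j h. j \<le> n \<Longrightarrow> \<not> ?act j \<Longrightarrow> \<bar>h\<bar> < e \<Longrightarrow> A u + 0 * h \<le> H j (u + h)"
      using near[of 0] by blast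
    have "A u \<le> A (u + h)" if "\<bar>h\<bar> < e" for h
    proof (cases "h \<ge> 0")
      case True
      then show ?thesis using A_mono by simp
    next
      case neg: False
      have "A u \<le> H j (u + h)" if "j \<le> n" for j
      proof (cases "?act j")
        case True
        then have "c j = 0 \<or> u \<le> z j" using False c_nonneg[of j] by force
        then have "H j u = t j" using hinge_flat \<open>j \<le> n\<close> by simp
        with True show ?thesis by (auto simp: hinge_def)
      next
        case F: False
        show ?thesis using e(2)[OF \<open>j \<le> n\<close> F \<open>\<bar>h\<bar> < e\<close>] by simp
      qed
      then show ?thesis by (simp add: le_hmin_iff)
    qed
    with e(1) show ?thesis unfolding nokink_def by (intro exI[of _ 0] exI[of _ e]) auto
  next
    case True
    define j where "j = (LEAST j. ?act j \<and> c j > 0 \<and> z j < u)"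
    have j: "j \<le> n" "H j u = A u" "c j > 0" "z j < u"
      using LeastI_ex[OF True] unfolding j_def by auto
    have least: "\<not> (?act m \<and> c m > 0 \<and> z m < u)" if "m < j" for m
      using that unfolding j_def by (rule not_less_Least)
    have Hj: "H j v = t j + (v - z j) * c j" if "z j \<le> v" for v using hinge_line j that by simp
    have "u < line_exit n z c t j" using le_line_exit[of j u] assms[of j] j by simp
    obtain e where e: "e > 0" "\<And>k h. k \<le> n \<Longrightarrow> \<not> ?act k \<Longrightarrow> \<bar>h\<bar> < e \<Longrightarrow> A u + c j * h \<le> H k (u + h)"
      using near[of "c j"] by blast
    define d where "d = min e (line_exit n z c t j - u)"
    have d: "d > 0" using e \<open>u < line_exit n z c t j\<close> by (simp add: d_def)
    have "A u + c j * h \<le> H m (u + h)" if h: "\<bar>h\<bar> < d" and m: "m \<le> n" for h m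
    proof (cases "h \<ge> 0")
      case True
      have "A u + c j * h = H j (u + h)" using Hj[of u] Hj[of "u + h"] j True by (simp add: algebra_simps)
      also have "\<dots> \<le> H m (u + h)"
      proof (cases m j rule: linorder_cases)
        case less
        have "H j (u + h) = H j u + h * c j" using Hj[of u] Hj[of "u + h"] j True by (simp add: algebra_simps)
        also have "\<dots> \<le> H m u + h * c m"
          using hmin_le[OF m, of z c t u] j True c_anti[of m j] less
          by (intro add_mono mult_left_mono) auto
        also have "\<dots> = H m (u + h)"
        proof -
          have "z m \<le> u" using z_mono[of m j] less j by simp
          then show ?thesis using hinge_line[OF m, of u] hinge_line[OF m, of "u + h"] True
            by (simp add: algebra_simps)
        qed
        finally show ?thesis .
      next
        case greater
        then show ?thesis using line_below[of j m "u + h"] m j True h by (simp add: d_def)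
      qed simp
      finally show ?thesis .
    next
      case neg: False
      show ?thesis
      proof (cases "?act m")
        case True
        show ?thesis
        proof (cases "c m > 0 \<and> z m < u")
          case T: True
          then have "j \<le> m" using least[of m] True by (meson not_le)
          then have "c m \<le> c j" using c_anti m by simp
          then have "c j * h \<le> c m * h" using neg by (simp add: mult_right_mono_neg)
          moreover have "A u = t m + (u - z m) * c m" using True T hinge_line[OF m, of u] by simp
          ultimately have "A u + c j * h \<le> t m + (u + h - z m) * c m" by (simp add: algebra_simps)
          then show ?thesis by (simp add: hinge_def)
        next
          case False
          then have "c m = 0 \<or> u \<le> z m" using c_nonneg[OF m] by auto
          then have "H m u = t m" using hinge_flat[OF m] by simp
          with True have "A u \<le> H m (u + h)" by (auto simp: hinge_def)
          moreover have "c j * h \<le> 0" using neg j by (simp add: mult_nonneg_nonpos)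
          ultimately show ?thesis by simp
        qed
      next
        case False
        then show ?thesis using e(2)[OF m] h by (simp add: d_def)
      qed
    qed
    with d show ?thesis unfolding nokink_def le_hmin_iff[symmetric]
      by (intro exI[of _ "c j"] exI[of _ d]) (auto simp: le_hmin_iff)
  qed
qed

end

text \<open>The witness is the largest maximiser: a linear lower bound around it must have slope \<open>0\<close>, which
  yields a larger maximiser.\<close>

lemma max_at_kink:
  fixes f :: "real \<Rightarrow> real"
  assumes "a \<le> b" "continuous_on {a..b} f" "w \<in> {a..b}"
  shows "\<exists>u\<in>{a..b}. f w \<le> f u \<and> (u = a \<or> u = b \<or> \<not> nokink f u)"
proof -
  have "compact {a..b}" "{a..b} \<noteq> {}" using assms by auto
  then obtain m where m: "m \<in> {a..b}" "\<And>x. x \<in> {a..b} \<Longrightarrow> f x \<le> f m"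
    using continuous_attains_sup[of "{a..b}" f] assms(2) by blast
  let ?M = "{x\<in>{a..b}. f x = f m}"
  have "closed (f -` {f m} \<inter> {a..b})"
    using assms(2) continuous_on_closed_vimage[of "{a..b}" f] by auto
  then have "compact ({a..b} \<inter> (f -` {f m} \<inter> {a..b}))"
    by (intro compact_Int_closed) auto
  moreover have "{a..b} \<inter> (f -` {f m} \<inter> {a..b}) = ?M" by auto
  ultimately have "compact ?M" by simp
  moreover have "?M \<noteq> {}" using m by auto
  ultimately obtain u where u: "u \<in> ?M" "\<And>x. x \<in> ?M \<Longrightarrow> x \<le> u"
    by (meson compact_attains_sup)
  have "\<not> nokink f u" if "u \<noteq> a" "u \<noteq> b"
  proof
    assume "nokink f u"
    then obtain s e where e: "e > 0" "\<And>h. \<bar>h\<bar> < e \<Longrightarrow> f u + s * h \<le> f (u + h)"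
      unfolding nokink_def by blast
    define d where "d = min (e/2) (min (u - a) (b - u))"
    have d: "0 < d" "d < e" "d \<le> u - a" "d \<le> b - u" using e that u by (auto simp: d_def min_def)
    have in1: "u + d \<in> {a..b}" and in2: "u - d \<in> {a..b}" using d u by auto
    have "f u + s * d \<le> f (u + d)" using e(2)[of d] d by simp
    moreover have "f u - s * d \<le> f (u - d)" using e(2)[of "-d"] d by simp
    moreover have "f (u + d) \<le> f u" "f (u - d) \<le> f u" using m(2)[OF in1] m(2)[OF in2] u by auto
    ultimately have "s * d \<le> 0" "s * d \<ge> 0" by auto
    then have "f u \<le> f (u + d)" using \<open>f u + s * d \<le> f (u + d)\<close> by simp
    then have "u + d \<in> ?M" using \<open>f (u + d) \<le> f u\<close> in1 u by auto
    from u(2)[OF this] d show False by simp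
  qed
  then show ?thesis using u m(2)[OF assms(3)] by (intro bexI[of _ u]) auto
qed

section \<open>Kinks of combined functions, and candidates for maxima\<close>

lemma nokink_add: "nokink f u \<Longrightarrow> nokink g u \<Longrightarrow> nokink (\<lambda>x. f x + g x) u"
proof -
  assume "nokink f u" "nokink g u"
  then obtain s e s' e' where "e > 0" "e' > 0"
    "\<And>h. \<bar>h\<bar> < e \<Longrightarrow> f u + s * h \<le> f (u + h)" "\<And>h. \<bar>h\<bar> < e' \<Longrightarrow> g u + s' * h \<le> g (u + h)"
    unfolding nokink_def by blast
  then show ?thesis unfolding nokink_def
    by (intro exI[of _ "s + s'"] exI[of _ "min e e'"]) (force simp: distrib_right intro: add_mono)
qed

lemma nokink_affine: "nokink (\<lambda>x. a * x + b) u"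
  unfolding nokink_def by (intro exI[of _ a] exI[of _ 1]) (auto simp: algebra_simps)

lemma nokink_scale: "nokink f u \<Longrightarrow> 0 \<le> a \<Longrightarrow> nokink (\<lambda>x. a * f x) u"
proof -
  assume "nokink f u" and a: "0 \<le> a"
  then obtain s e where "e > 0" "\<And>h. \<bar>h\<bar> < e \<Longrightarrow> f u + s * h \<le> f (u + h)"
    unfolding nokink_def by blast
  moreover have "a * f u + a * s * h \<le> a * f (u + h)" if "f u + s * h \<le> f (u + h)" for h
    using mult_left_mono[OF that a] by (simp add: algebra_simps)
  ultimately show ?thesis unfolding nokink_def by (intro exI[of _ "a * s"] exI[of _ e]) auto
qed

lemma nokink_shift: "nokink f (u + a) \<Longrightarrow> nokink (\<lambda>x. f (x + a)) u"
  unfolding nokink_def by (simp add: algebra_simps)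

text \<open>Exits before the lower limit \<open>u\<close>, and the junk exits of hinges without
  slope, are replaced by \<open>u\<close>. So all candidates respect the limit, and the last hinge
  contributes the limit itself.\<close>

definition cand :: "nat \<Rightarrow> (nat \<Rightarrow> real) \<Rightarrow> (nat \<Rightarrow> real) \<Rightarrow> (nat \<Rightarrow> real) \<Rightarrow> real \<Rightarrow> nat \<Rightarrow> real" where
  "cand n z c t u a = (if 0 < c a \<and> u < line_exit n z c t a then line_exit n z c t a else u)"

lemma cand_ge: "u \<le> cand n z c t u a"
  by (simp add: cand_def)

context hinges
begin

lemma cand_last: "cand n z c t u n = u"
  by (simp add: cand_def c_last)

lemma A_le_last: "A u \<le> t n"
  using hmin_le[of n n z c t u] by (simp add: hinge_def c_last)

lemma kink_cand:
  assumes "\<not> nokink A u" "l \<le> u"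
  shows "\<exists>a\<le>n. u = cand n z c t l a"
proof -
  obtain j where "j \<le> n" "c j > 0" "u = line_exit n z c t j" using nokink_A[of u] assms(1) by blast
  with assms(2) show ?thesis by (intro exI[of _ j]) (auto simp: cand_def)
qed

lemma window_max:
  assumes "0 \<le> \<alpha>" "l \<le> a" "a \<le> w" "w \<le> b"
  shows "\<exists>u\<in>{a..b}. \<alpha> * A w - \<beta> * w \<le> \<alpha> * A u - \<beta> * u \<and>
    (u = a \<or> u = b \<or> (\<exists>j\<le>n. u = cand n z c t l j))"
proof -
  let ?f = "\<lambda>u. \<alpha> * A u - \<beta> * u"
  have "continuous_on {a..b} ?f"
    by (intro continuous_at_imp_continuous_on ballI continuous_intros continuous_A)
  moreover have "a \<le> b" "w \<in> {a..b}" using assms(3,4) by auto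
  ultimately have "\<exists>u\<in>{a..b}. ?f w \<le> ?f u \<and> (u = a \<or> u = b \<or> \<not> nokink ?f u)"
    by (intro max_at_kink)
  then obtain u where u: "u \<in> {a..b}" "?f w \<le> ?f u" "u = a \<or> u = b \<or> \<not> nokink ?f u"
    by (elim bexE conjE)
  have "nokink ?f u" if "nokink A u"
    using nokink_add[OF nokink_scale[OF that assms(1)] nokink_affine[of "-\<beta>" 0]] by simp
  then have "u = a \<or> u = b \<or> (\<exists>j\<le>n. u = cand n z c t l j)"
    using u(1,3) kink_cand[of u l] assms(2) by auto
  with u(1,2) show ?thesis by (intro bexI[of _ u] conjI)
qed

lemma ray_max:
  assumes "0 \<le> \<alpha>" "0 < \<beta>" "l \<le> w"
  shows "\<exists>j\<le>n. \<alpha> * A w - \<beta> * w \<le> \<alpha> * A (cand n z c t l j) - \<beta> * cand n z c t l j"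
proof -
  let ?f = "\<lambda>u. \<alpha> * A u - \<beta> * u"
  \<comment> \<open>\<open>A\<close> is bounded by \<open>t n\<close> while the linear term falls
    without limit; \<open>b\<close> is so far out that the objective is already below its value at
    \<open>w\<close>, which excludes \<open>b\<close> as a maximiser.\<close>
  define b where "b = max w ((\<alpha> * t n - ?f w + 1) / \<beta>)"
  have "\<alpha> * t n - ?f w + 1 \<le> \<beta> * b"
    using assms(2) by (simp add: b_def field_simps max_def split: if_splits)
  then have b: "?f b < ?f w" using mult_left_mono[OF A_le_last[of b] assms(1)] by linarith
  have "w \<le> b" by (simp add: b_def)
  from window_max[OF assms(1) order.refl assms(3) this, of \<beta>] obtain u
    where u: "?f w \<le> ?f u" "u = l \<or> u = b \<or> (\<exists>j\<le>n. u = cand n z c t l j)" by blast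
  moreover have "u \<noteq> b" using u(1) b by auto
  ultimately show ?thesis using cand_last[of l] by (metis order.refl)
qed

text \<open>Beyond \<open>l\<close> every hinge is affine, hence their minimum is concave, and
  moving from \<open>v\<close> towards a better point \<open>w\<close> cannot decrease the
  objective.\<close>

lemma concave:
  assumes "0 \<le> \<alpha>" "\<And>j. j \<le> n \<Longrightarrow> c j > 0 \<Longrightarrow> z j \<le> l" "l \<le> v" "l \<le> w" "0 \<le> k" "k \<le> 1"
    "\<alpha> * A v - \<beta> * v \<le> \<alpha> * A w - \<beta> * w" "x = (1 - k) * v + k * w"
  shows "\<alpha> * A v - \<beta> * v \<le> \<alpha> * A x - \<beta> * x"
proof -
  have x: "l \<le> x" unfolding assms(8) using convex_bound_le[of "-v" "-l" "-w" "1-k" k] assms by simp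
  obtain j where j: "j \<le> n" "A x = H j x" using hmin_attained by blast
  have aff: "H j y = t j + (y - z j) * c j" if "l \<le> y" for y
    using assms(2)[OF j(1)] that hinge_line[OF j(1), of y] hinge_flat[OF j(1), of y] c_nonneg[OF j(1)] by force
  have "A x = t j + (x - z j) * c j" using j(2) aff[OF x] by simp
  also have "\<dots> = (1 - k) * H j v + k * H j w"
    unfolding aff[OF assms(3)] aff[OF assms(4)] assms(8) by (simp add: algebra_simps)
  also have "\<dots> \<ge> (1 - k) * A v + k * A w"
    using assms hmin_le[OF j(1)] by (intro add_mono mult_left_mono) auto
  finally have "\<alpha> * ((1 - k) * A v + k * A w) \<le> \<alpha> * A x" using assms(1) by (simp add: mult_left_mono)
  moreover have "\<alpha> * ((1 - k) * A v + k * A w) - \<beta> * x =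
      (1 - k) * (\<alpha> * A v - \<beta> * v) + k * (\<alpha> * A w - \<beta> * w)"
    unfolding assms(8) by (simp add: algebra_simps)
  moreover have "k * (\<alpha> * A v - \<beta> * v) \<le> k * (\<alpha> * A w - \<beta> * w)"
    using assms by (intro mult_left_mono) auto
  ultimately show ?thesis by (simp add: algebra_simps)
qed

end

text \<open>\<open>l\<close> and \<open>l'\<close> are the least admissible \<open>u\<close> and
  \<open>v\<close>. Only the right function is required to have all its bends before its limit,
  which makes it concave where it matters.\<close>

locale two_hinges = L: hinges n z c t + R: hinges n z' c' t'
  for n z c t z' c' t' +
  fixes l l' :: real
  assumes right_linear: "\<And>j. j \<le> n \<Longrightarrow> c' j > 0 \<Longrightarrow> z' j \<le> l'"
begin

abbreviation "A \<equiv> hmin n z c t"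
abbreviation "B \<equiv> hmin n z' c' t'"
abbreviation "UC \<equiv> cand n z c t l"
abbreviation "VC \<equiv> cand n z' c' t' l'"

text \<open>Both arguments move with the time \<open>w\<close>, so a kink of the sum comes from a
  kink of \<open>A\<close> or of \<open>B\<close>. The least admissible time \<open>m\<close> clips
  the candidates of either side.\<close>

lemma vertex_max:
  assumes "0 \<le> \<alpha>" "l \<le> w - x" "l' \<le> w + x"
  defines "F \<equiv> \<lambda>w. \<alpha> * (A (w - x) + B (w + x)) - w"
    and "m \<equiv> max (l + x) (l' - x)"
  shows "\<exists>j\<le>n. F w \<le> F (max m (UC j + x)) \<or> F w \<le> F (max m (VC j - x))"
proof -
  define b where "b = max w (\<alpha> * (t n + t' n) - F w + 1)"
  have "\<alpha> * (A (b - x) + B (b + x)) \<le> \<alpha> * (t n + t' n)"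
    using assms(1) L.A_le_last R.A_le_last by (intro mult_left_mono add_mono)
  then have b: "F b < F w" unfolding F_def[of] b_def by linarith
  have F: "F = (\<lambda>w. (\<alpha> * A (w + - x) + \<alpha> * B (w + x)) + (- 1 * w + 0))"
    by (auto simp: F_def algebra_simps)
  have "isCont F y" for y
  proof -
    have "isCont (\<lambda>w. A (w + - x)) y"
      using isCont_o2[of y "\<lambda>w. w + - x" A] L.continuous_A by simp
    moreover have "isCont (\<lambda>w. B (w + x)) y"
      using isCont_o2[of y "\<lambda>w. w + x" B] R.continuous_A by simp
    ultimately show ?thesis unfolding F by simp
  qed
  then have "continuous_on {m..b} F" by (simp add: continuous_at_imp_continuous_on)
  moreover have "m \<le> w" "w \<le> b" using assms(2,3) by (auto simp: m_def b_def)
  then have "m \<le> b" "w \<in> {m..b}" by auto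
  ultimately have "\<exists>u\<in>{m..b}. F w \<le> F u \<and> (u = m \<or> u = b \<or> \<not> nokink F u)"
    by (intro max_at_kink)
  then obtain u where u: "u \<in> {m..b}" "F w \<le> F u" "u = m \<or> u = b \<or> \<not> nokink F u"
    by (elim bexE conjE)
  have "u \<noteq> b" using u(2) b by auto
  have "nokink F u" if "nokink A (u + - x)" "nokink B (u + x)"
    unfolding F using nokink_shift[OF that(1)] nokink_shift[OF that(2)] assms(1)
    by (intro nokink_add nokink_affine nokink_scale)
  with u \<open>u \<noteq> b\<close> consider "u = m" | "\<not> nokink A (u + -x)" | "\<not> nokink B (u + x)" by blast
  then show ?thesis
  proof cases
    case 1
    \<comment> \<open>The candidate of the last hinge is \<open>l\<close>, and
      \<open>l + x \<le> m\<close>, so clipping turns it into \<open>m\<close>.\<close>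
    then have "max m (UC n + x) = u" by (simp add: L.cand_last m_def)
    with u(2) show ?thesis by (metis order.refl)
  next
    case 2
    then obtain j where "j \<le> n" "u - x = UC j" using L.kink_cand[of "u - x" l] u(1) by (auto simp: m_def)
    then have "max m (UC j + x) = u" using u(1) by (auto simp: algebra_simps)
    with u(2) \<open>j \<le> n\<close> show ?thesis by metis
  next
    case 3
    then obtain j where "j \<le> n" "u + x = VC j" using R.kink_cand[of "u + x" l'] u(1) by (auto simp: m_def)
    then have "max m (VC j - x) = u" using u(1) by (auto simp: algebra_simps)
    with u(2) \<open>j \<le> n\<close> show ?thesis by metis
  qed
qed

text \<open>With \<open>u\<close> fixed, \<open>v\<close> moves to \<open>w\<close>, the best point
  \<open>v'\<close> clamped to what the edge allows; \<open>w\<close> lies between \<open>v\<close>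
  and \<open>v'\<close>, so concavity of \<open>B\<close> makes this harmless. If clamping was
  active, an end of the edge has been reached. Otherwise \<open>v = v'\<close> is kept and
  \<open>u\<close> is maximised over the window that the edge leaves for it.\<close>

lemma edge_max:
  assumes "0 \<le> \<alpha>" "l \<le> u" "l' \<le> v" "p \<le> v - u" "v - u \<le> q" "l' \<le> v'"
    and best: "\<And>v. l' \<le> v \<Longrightarrow> \<alpha> * B v - 1/2 * v \<le> \<alpha> * B v' - 1/2 * v'"
  defines "G \<equiv> \<lambda>u v. \<alpha> * (A u + B v) - (u + v) / 2"
  shows "(\<exists>j\<le>n. p \<le> v' - UC j \<and> v' - UC j \<le> q \<and> G u v \<le> G (UC j) v') \<or>
    (\<exists>a b. l \<le> a \<and> l' \<le> b \<and> (b - a = p \<or> b - a = q) \<and> G u v \<le> G a b)"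
proof -
  have split: "G a b = (\<alpha> * A a - 1/2 * a) + (\<alpha> * B b - 1/2 * b)" for a b
    by (simp add: G_def algebra_simps)
  define w where "w = (if v' < u + p then u + p else if u + q < v' then u + q else v')"
  have "\<exists>k. 0 \<le> k \<and> k \<le> 1 \<and> w = (1 - k) * v + k * v'"
  proof (cases "v = v'")
    case True
    then show ?thesis using assms(4,5) by (intro exI[of _ 0]) (auto simp: w_def)
  next
    case False
    define k where "k = (w - v) / (v' - v)"
    have "0 \<le> k" "k \<le> 1" using False assms(4,5) by (auto simp: k_def w_def divide_simps)
    moreover have "k * (v' - v) = w - v" using False by (simp add: k_def)
    then have "w = (1 - k) * v + k * v'" by (simp add: algebra_simps)
    ultimately show ?thesis by blast
  qed
  then obtain k where k: "0 \<le> k" "k \<le> 1" "w = (1 - k) * v + k * v'" by (elim exE conjE)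
  have "\<alpha> * B v - 1/2 * v \<le> \<alpha> * B w - 1/2 * w"
    by (rule R.concave[OF assms(1) _ assms(3,6) k(1,2) best[OF assms(3)] k(3)]) (rule right_linear)
  then have 1: "G u v \<le> G u w" by (simp add: split)
  have w: "l' \<le> w" "p \<le> w - u" "w - u \<le> q" using assms(3-6) by (auto simp: w_def)
  show ?thesis
  proof (cases "w = v'")
    case False
    then have "w - u = p \<or> w - u = q" by (auto simp: w_def split: if_splits)
    with 1 w assms(2) show ?thesis by blast
  next
    case True
    have "l \<le> max l (v' - q)" "max l (v' - q) \<le> u" "u \<le> v' - p" using w True assms(2) by auto
    from L.window_max[OF assms(1) this, of "1/2"]
    obtain u' where u': "u' \<in> {max l (v' - q)..v' - p}" "\<alpha> * A u - 1/2 * u \<le> \<alpha> * A u' - 1/2 * u'"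
      "u' = max l (v' - q) \<or> u' = v' - p \<or> (\<exists>j\<le>n. u' = UC j)"
      by (elim bexE conjE)
    have 2: "G u v \<le> G u' v'" using 1 u'(2) True by (simp add: split)
    show ?thesis
    proof (cases "v' - u' = p \<or> v' - u' = q")
      case True
      with 2 u'(1) assms(6) show ?thesis by (intro disjI2 exI[of _ u'] exI[of _ v']) auto
    next
      case False
      \<comment> \<open>The left end of the window is \<open>v' - q\<close>, which is an end of the
        edge and excluded here, or \<open>l\<close>, the candidate of the last hinge.\<close>
      then have "\<exists>j\<le>n. u' = UC j" using u'(3) L.cand_last[of l] by (auto simp: max_def split: if_splits)
      with 2 u'(1) show ?thesis by (intro disjI1) auto
    qed
  qed
qed

end

section \<open>Slots of the path\<close>

definition psum :: "(nat \<Rightarrow> real) \<Rightarrow> nat \<Rightarrow> real" where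
  "psum s m = (\<Sum>t<m. s t)"

lemma psum_0 [simp]: "psum s 0 = 0" and psum_Suc: "psum s (Suc m) = psum s m + s m"
  by (simp_all add: psum_def)

lemma psum_diff_mono:
  assumes "a \<le> b" "\<And>t. a \<le> t \<Longrightarrow> t < b \<Longrightarrow> s t \<le> s' t"
  shows "psum s b - psum s a \<le> psum s' b - psum s' a"
  using assms by (induction b rule: dec_induct) (force simp: psum_Suc)+

lemma psum_mono_idx:
  assumes "a \<le> b" "\<And>t. a \<le> t \<Longrightarrow> t < b \<Longrightarrow> 0 \<le> s t"
  shows "psum s a \<le> psum s b"
  using psum_diff_mono[of a b "\<lambda>_. 0" s] assms by (simp add: psum_def)

lemma psum_cong_diff:
  assumes "a \<le> b" "\<And>t. a \<le> t \<Longrightarrow> t < b \<Longrightarrow> s t = s' t"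
  shows "psum s b - psum s a = psum s' b - psum s' a"
  using assms by (intro antisym psum_diff_mono) auto

lemma weight_prefix: "weight s 0 k = psum s (Suc k)"
  by (simp add: weight_def psum_def atLeast0AtMost lessThan_Suc_atMost)

lemma weight_suffix: "l \<le> Suc n \<Longrightarrow> weight s l n = psum s (Suc n) - psum s l"
proof (induction l rule: inc_induct)
  case (step l)
  then have "weight s l n = s l + weight s (Suc l) n"
    by (simp add: weight_def sum.atLeast_Suc_atMost)
  with step show ?case by (simp add: psum_Suc)
qed (simp add: weight_def)

definition min_cap :: "path_instance \<Rightarrow> nat \<Rightarrow> nat \<Rightarrow> real" where
  "min_cap I a b = Min (cap I ` {a..<b})"

text \<open>The slot \<open>(f, Suc f)\<close> is the vertex \<open>f\<close>, the slot \<open>(f, f)\<close> the interior of the edge between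
  the vertices \<open>f - 1\<close> and \<open>f\<close>. From a sink in the slot \<open>(f, g)\<close>, the vertices \<open>k < f\<close> lie to the
  left and the vertices \<open>l \<ge> g\<close> to the right.\<close>

definition slot :: "path_instance \<Rightarrow> nat \<Rightarrow> nat \<Rightarrow> bool" where
  "slot I f g \<longleftrightarrow> f \<le> edges I \<and> (g = Suc f \<or> g = f \<and> 0 < f)"

definition box_top :: "path_instance \<Rightarrow> nat \<Rightarrow> nat \<Rightarrow> real" where
  "box_top I i t = (if t \<le> i then whi I t else wlo I t)"

text \<open>For a sink \<open>y\<close> and a time \<open>\<theta>\<close>, the conditions on the left side depend on \<open>u = \<theta> - y\<close> only, those on
  the right side on \<open>v = \<theta> + y\<close> only. Vertices beyond which \<open>i\<close> sends flow are constrained even if the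
  flow is \<open>0\<close>: this is the closure of the condition that vertex \<open>i\<close> has positive weight.\<close>

definition left_feasible :: "path_instance \<Rightarrow> nat \<Rightarrow> nat \<Rightarrow> scenario \<Rightarrow> real \<Rightarrow> bool" where
  "left_feasible I i f s u \<longleftrightarrow> - pos I f \<le> u \<and>
     (\<forall>k<f. i \<le> k \<or> 0 < psum s (Suc k) \<longrightarrow> - pos I k + psum s (Suc k) / min_cap I k f \<le> u)"

definition right_feasible :: "path_instance \<Rightarrow> nat \<Rightarrow> nat \<Rightarrow> scenario \<Rightarrow> real \<Rightarrow> bool" where
  "right_feasible I i g s v \<longleftrightarrow> pos I (g - 1) \<le> v \<and>
     (\<forall>l. g \<le> l \<and> l \<le> edges I \<and> (l \<le> i \<or> 0 < psum s (Suc (edges I)) - psum s l) \<longrightarrow>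
        pos I l + (psum s (Suc (edges I)) - psum s l) / min_cap I (g - 1) l \<le> v)"

definition in_box :: "path_instance \<Rightarrow> nat \<Rightarrow> scenario \<Rightarrow> bool" where
  "in_box I i s \<longleftrightarrow> (\<forall>t\<le>edges I. wlo I t \<le> s t \<and> s t \<le> box_top I i t)"

text \<open>Hinges of the two sides of a slot are indexed outwards: on the left, \<open>m\<close> stands for the vertex
  \<open>f - (m + 1)\<close>, on the right for \<open>g + m\<close>. Hinges with \<open>c m = 0\<close> are padding that carries the bound by
  the total weight of the side.\<close>

definition zL where "zL I f m = - pos I (f - (m + 1))"
definition cL where "cL I f m = (if m < f then min_cap I (f - (m + 1)) f else 0)"
definition lL where "lL I f m = psum (wlo I) (f - m)"
definition tL where "tL I i f m = psum (box_top I i) f - psum (box_top I i) (f - m)"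
text \<open>The least \<open>u\<close> that is left feasible for the minimal weights.\<close>

definition umin where
  "umin I i f = Max (insert (- pos I f)
     ((\<lambda>m. zL I f m + lL I f m / cL I f m) ` {m. m \<le> edges I \<and> m < f \<and> (i + m < f \<or> 0 < lL I f m)}))"

definition zR where "zR I g m = pos I (g + m)"
text \<open>Vertices beyond \<open>i\<close> keep their minimal weight, so their constraints amount
  to \<open>vmin \<le> v\<close> and their hinges become padding in \<open>cR\<close>.
  \<open>vmin\<close> itself needs the true capacity, hence the separate \<open>cF\<close>.\<close>

definition cF where "cF I g m = min_cap I (g - 1) (g + m)"
definition cR where "cR I i g m = (if g + m \<le> i then cF I g m else 0)"
definition lR where "lR I g m = psum (wlo I) (Suc (edges I)) - psum (wlo I) (g + m)"
definition tR where
  "tR I i g m = psum (box_top I i) (if g + m \<le> i then g + m else Suc (edges I)) - psum (box_top I i) g"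
definition vmin where
  "vmin I i g = Max (insert (pos I (g - 1))
     ((\<lambda>m. zR I g m + lR I g m / cF I g m) `
       {m. m \<le> edges I \<and> g + m \<le> edges I \<and> (g + m \<le> i \<or> 0 < lR I g m)}))"

definition left_max where "left_max I i f = hmin (edges I) (zL I f) (cL I f) (tL I i f)"
definition right_max where "right_max I i g = hmin (edges I) (zR I g) (cR I i g) (tR I i g)"

section \<open>Evacuation times expressed by slots\<close>

locale path =
  fixes I :: path_instance
  assumes valid: "valid_instance I"
begin

abbreviation "n \<equiv> edges I"
abbreviation "x \<equiv> pos I"
abbreviation "lo \<equiv> wlo I"
abbreviation "up \<equiv> whi I"

lemma x0: "x 0 = 0" using valid by (simp add: valid_instance_def)

lemma lo_nonneg: "t \<le> n \<Longrightarrow> 0 \<le> lo t" and lo_up: "t \<le> n \<Longrightarrow> lo t \<le> up t"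
  using valid by (auto simp: valid_instance_def)

lemma lo_box_top: "t \<le> n \<Longrightarrow> lo t \<le> box_top I i t" and box_top_nonneg: "t \<le> n \<Longrightarrow> 0 \<le> box_top I i t"
  using lo_up[of t] lo_nonneg[of t] by (auto simp: box_top_def)

lemma x_less: "i < j \<Longrightarrow> j \<le> n \<Longrightarrow> x i < x j"
proof (induction j)
  case (Suc j)
  then have "x j < x (Suc j)" using valid by (simp add: valid_instance_def)
  with Suc show ?case by (cases "i = j") auto
qed simp

lemma x_le: "i \<le> j \<Longrightarrow> j \<le> n \<Longrightarrow> x i \<le> x j"
  using x_less[of i j] by (cases "i = j") auto

lemma x_le_iff: "i \<le> n \<Longrightarrow> j \<le> n \<Longrightarrow> x i \<le> x j \<longleftrightarrow> i \<le> j"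
  using x_less[of j i] x_le[of i j] by force

lemma min_cap_pos: "a < b \<Longrightarrow> b \<le> n \<Longrightarrow> 0 < min_cap I a b"
  using valid by (auto simp: min_cap_def valid_instance_def)

lemma min_cap_anti: "a' \<le> a \<Longrightarrow> a < b \<Longrightarrow> b \<le> b' \<Longrightarrow> min_cap I a' b' \<le> min_cap I a b"
  unfolding min_cap_def by (rule Min_antimono) auto

definition at_slot :: "nat \<Rightarrow> nat \<Rightarrow> real \<Rightarrow> bool" where
  "at_slot f g y \<longleftrightarrow> f \<le> n \<and> (g = Suc f \<and> y = x f \<or> g = f \<and> 0 < f \<and> x (f - 1) < y \<and> y < x f)"

lemma sink_slot:
  assumes "y \<in> sinks I"
  obtains f g where "at_slot f g y"
proof -
  define f where "f = (LEAST f. y \<le> x f)"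
  have y: "y \<le> x n" "x 0 \<le> y" using assms by (auto simp: sinks_def)
  have f: "y \<le> x f" unfolding f_def using y(1) by (rule LeastI)
  have fn: "f \<le> n" unfolding f_def using y(1) by (rule Least_le)
  show ?thesis
  proof (cases "y = x f")
    case True
    with fn that[of f "Suc f"] show ?thesis by (simp add: at_slot_def)
  next
    case False
    with f have "y < x f" by simp
    then have "0 < f" using y(2) by (cases f) auto
    then have "\<not> y \<le> x (f - 1)" unfolding f_def by (intro not_less_Least) (simp add: f_def)
    with \<open>0 < f\<close> \<open>y < x f\<close> fn that[of f f] show ?thesis by (simp add: at_slot_def)
  qed
qed

lemma at_slot_slot: "at_slot f g y \<Longrightarrow> slot I f g"
  by (auto simp: at_slot_def slot_def)

lemma at_slot_bounds: "at_slot f g y \<Longrightarrow> x (g - 1) \<le> y \<and> y \<le> x f"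
  by (auto simp: at_slot_def)

lemma left_iff:
  assumes "at_slot f g y" "k \<le> n"
  shows "x k < y \<longleftrightarrow> k < f"
proof
  assume "k < f"
  then have "k \<le> f - 1" "f - 1 \<le> n \<or> \<not> at_slot f g y" by (auto simp: at_slot_def)
  with \<open>k < f\<close> show "x k < y" using assms x_less[of k f] x_le[of k "f - 1"] by (auto simp: at_slot_def)
next
  assume "x k < y"
  then show "k < f" using assms x_le[of f k] by (force simp: at_slot_def)
qed

lemma right_iff:
  assumes "at_slot f g y" "l \<le> n"
  shows "y < x l \<longleftrightarrow> g \<le> l"
proof
  assume "g \<le> l"
  then show "y < x l" using assms x_less[of f l] x_le[of f l] by (auto simp: at_slot_def)
next
  assume "y < x l"
  then show "g \<le> l" using assms x_le[of l f] x_le[of l "f - 1"] by (force simp: at_slot_def)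
qed

lemma Max_atMost: "Max {..k::nat} = k" and Min_atLeastAtMost: "l \<le> m \<Longrightarrow> Min {l..m::nat} = l"
  by (auto intro: Max_eqI Min_eqI)

lemma path_cap_left: "at_slot f g y \<Longrightarrow> k < f \<Longrightarrow> path_cap I (x k) y = min_cap I k f"
proof -
  assume s: "at_slot f g y" and k: "k < f"
  then have f: "f \<le> n" by (simp add: at_slot_def)
  have "{i'. i' \<le> n \<and> x i' \<le> x k} = {..k}" using x_le_iff k f by auto
  moreover have "{j'. j' \<le> n \<and> y \<le> x j'} = {f..n}" using left_iff[OF s] by force
  ultimately show ?thesis using f by (simp add: path_cap_def min_cap_def Max_atMost Min_atLeastAtMost)
qed

lemma path_cap_right: "at_slot f g y \<Longrightarrow> g \<le> l \<Longrightarrow> l \<le> n \<Longrightarrow> path_cap I y (x l) = min_cap I (g - 1) l"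
proof -
  assume s: "at_slot f g y" and l: "g \<le> l" "l \<le> n"
  have "0 < g" using s by (auto simp: at_slot_def)
  have "{i'. i' \<le> n \<and> x i' \<le> y} = {..g - 1}"
    using right_iff[OF s] l \<open>0 < g\<close> by (force simp: not_less[symmetric])
  moreover have "{j'. j' \<le> n \<and> x l \<le> x j'} = {l..n}" using x_le_iff l by auto
  ultimately show ?thesis using l by (simp add: path_cap_def min_cap_def Max_atMost Min_atLeastAtMost)
qed

text \<open>Evacuation times are handled through their upper bounds \<theta>. In this form
  \<open>path_cap\<close> has become a constant of the slot, and \<open>y\<close> enters
  linearly.\<close>

lemma evac_left_le_iff:
  assumes "at_slot f g y"
  shows "evac_left I y s \<le> \<theta> \<longleftrightarrow> 0 \<le> \<theta> \<and>
    (\<forall>k<f. 0 < psum s (Suc k) \<longrightarrow> y - x k + psum s (Suc k) / min_cap I k f \<le> \<theta>)"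
proof -
  have L: "{i. i \<le> n \<and> x i < y} = {..<f}"
    using left_iff[OF assms] assms by (auto simp: at_slot_def)
  have l: "left_time I s k y \<le> \<theta> \<longleftrightarrow> (0 < psum s (Suc k) \<longrightarrow> y - x k + psum s (Suc k) / min_cap I k f \<le> \<theta>)"
    if "k < f" "0 \<le> \<theta>" for k
    using that path_cap_left[OF assms] by (simp add: left_time_def weight_prefix)
  show ?thesis unfolding evac_left_def L using l by auto
qed

lemma evac_right_le_iff:
  assumes "at_slot f g y"
  shows "evac_right I y s \<le> \<theta> \<longleftrightarrow> 0 \<le> \<theta> \<and>
    (\<forall>l. g \<le> l \<and> l \<le> n \<and> 0 < psum s (Suc n) - psum s l \<longrightarrow>
       x l - y + (psum s (Suc n) - psum s l) / min_cap I (g - 1) l \<le> \<theta>)"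
proof -
  have R: "{i. i \<le> n \<and> y < x i} = {g..n}"
    using right_iff[OF assms] assms by (auto simp: at_slot_def)
  have r: "right_time I s l y \<le> \<theta> \<longleftrightarrow> (0 < psum s (Suc n) - psum s l \<longrightarrow>
       x l - y + (psum s (Suc n) - psum s l) / min_cap I (g - 1) l \<le> \<theta>)"
    if "g \<le> l" "l \<le> n" "0 \<le> \<theta>" for l
    using that path_cap_right[OF assms] by (simp add: right_time_def weight_suffix)
  show ?thesis unfolding evac_right_def R using r by auto
qed

lemma evac_le_iff:
  assumes "at_slot f g y"
  shows "evac_time I y s \<le> \<theta> \<longleftrightarrow> 0 \<le> \<theta> \<and>
    (\<forall>k<f. 0 < psum s (Suc k) \<longrightarrow> y - x k + psum s (Suc k) / min_cap I k f \<le> \<theta>) \<and>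
    (\<forall>l. g \<le> l \<and> l \<le> n \<and> 0 < psum s (Suc n) - psum s l \<longrightarrow>
       x l - y + (psum s (Suc n) - psum s l) / min_cap I (g - 1) l \<le> \<theta>)"
  unfolding evac_time_def max.bounded_iff evac_left_le_iff[OF assms] evac_right_le_iff[OF assms] by blast

lemma evac_nonneg: "y \<in> sinks I \<Longrightarrow> 0 \<le> evac_time I y s"
  by (metis evac_le_iff order.refl sink_slot)

lemma opt_le: "y \<in> sinks I \<Longrightarrow> opt_evac_time I s \<le> evac_time I y s"
  unfolding opt_evac_time_def by (intro cINF_lower bdd_belowI2[where m = 0]) (auto simp: evac_nonneg)

lemma sinks_nonempty: "sinks I \<noteq> {}"
  using x_le[of 0 n] by (auto simp: sinks_def)

lemma le_opt: "(\<And>y. y \<in> sinks I \<Longrightarrow> b \<le> evac_time I y s) \<Longrightarrow> b \<le> opt_evac_time I s"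
  unfolding opt_evac_time_def using sinks_nonempty by (intro cINF_greatest)

text \<open>At the ends of its edge, an edge slot only overestimates the evacuation times.\<close>

lemma evac_le_closed:
  assumes "slot I f g" "x (g - 1) \<le> y" "y \<le> x f" "0 \<le> \<theta>"
    and L: "\<And>k. k < f \<Longrightarrow> 0 < psum s (Suc k) \<Longrightarrow> y - x k + psum s (Suc k) / min_cap I k f \<le> \<theta>"
    and R: "\<And>l. g \<le> l \<Longrightarrow> l \<le> n \<Longrightarrow> 0 < psum s (Suc n) - psum s l \<Longrightarrow>
       x l - y + (psum s (Suc n) - psum s l) / min_cap I (g - 1) l \<le> \<theta>"
  shows "evac_time I y s \<le> \<theta>"
proof -
  have fn: "f \<le> n" using assms(1) by (simp add: slot_def)
  consider "g = Suc f" "y = x f" | "g = f" "0 < f" "y = x f" | "g = f" "0 < f" "y = x (f - 1)"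
    | "g = f" "0 < f" "x (f - 1) < y" "y < x f"
    using assms(1-3) by (force simp: slot_def)
  then show ?thesis
  proof cases
    case 1
    then have "at_slot f g y" using fn by (simp add: at_slot_def)
    from evac_le_iff[OF this] assms show ?thesis by auto
  next
    case 2
    then have "at_slot f (Suc f) y" using fn by (simp add: at_slot_def)
    moreover have "x l - y + (psum s (Suc n) - psum s l) / min_cap I f l \<le> \<theta>"
      if "Suc f \<le> l" "l \<le> n" "0 < psum s (Suc n) - psum s l" for l
    proof -
      have "(psum s (Suc n) - psum s l) / min_cap I f l \<le> (psum s (Suc n) - psum s l) / min_cap I (f - 1) l"
        using that min_cap_anti[of "f - 1" f l l] min_cap_pos[of "f - 1" l] 2 by (intro divide_left_mono) (auto simp: min_cap_pos)
      with R[of l] that 2 show ?thesis by simp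
    qed
    ultimately show ?thesis using evac_le_iff[of f "Suc f" y s \<theta>] assms(4) L by auto
  next
    case 3
    then have "at_slot (f - 1) f y" using fn by (simp add: at_slot_def)
    moreover have "y - x k + psum s (Suc k) / min_cap I k (f - 1) \<le> \<theta>"
      if "k < f - 1" "0 < psum s (Suc k)" for k
    proof -
      have "psum s (Suc k) / min_cap I k (f - 1) \<le> psum s (Suc k) / min_cap I k f"
        using that min_cap_anti[of k k "f - 1" f] min_cap_pos[of k f] fn 3 by (intro divide_left_mono) (auto simp: min_cap_pos)
      moreover have "k < f" using that by simp
      ultimately show ?thesis using L[of k] that(2) by linarith
    qed
    ultimately show ?thesis using evac_le_iff[of "f - 1" f y s \<theta>] assms(4) R 3 by auto
  next
    case 4
    then have "at_slot f g y" using fn by (simp add: at_slot_def)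
    from evac_le_iff[OF this] assms show ?thesis by auto
  qed
qed

section \<open>The two sides of a slot as hinge families\<close>

lemma hingesL: "f \<le> n \<Longrightarrow> hinges n (zL I f) (cL I f) (tL I i f)"
proof
  assume f: "f \<le> n"
  show "tL I i f j \<le> tL I i f m" if "j \<le> m" "m \<le> n" for j m
    using that f by (auto simp: tL_def box_top_nonneg intro!: psum_mono_idx)
  show "cL I f m \<le> cL I f j" if "j \<le> m" "m \<le> n" for j m
    using that f by (auto simp: cL_def intro!: min_cap_anti less_imp_le[OF min_cap_pos])
  show "0 \<le> cL I f j" for j
    using f by (auto simp: cL_def intro!: less_imp_le[OF min_cap_pos])
  show "cL I f n = 0" using f by (simp add: cL_def)
  show "zL I f j \<le> zL I f m" if "j \<le> m" "m \<le> n" for j m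
    using that f by (auto simp: zL_def intro!: x_le)
qed

lemma hingesR: "0 < g \<Longrightarrow> i \<le> n \<Longrightarrow> hinges n (zR I g) (cR I i g) (tR I i g)"
proof
  assume g: "0 < g" "i \<le> n"
  show "tR I i g j \<le> tR I i g m" if "j \<le> m" "m \<le> n" for j m
    using that g by (auto simp: tR_def box_top_nonneg intro!: psum_mono_idx)
  show "cR I i g m \<le> cR I i g j" if "j \<le> m" "m \<le> n" for j m
    using that g by (auto simp: cR_def cF_def intro!: min_cap_anti less_imp_le[OF min_cap_pos])
  show "0 \<le> cR I i g j" for j
    using g by (auto simp: cR_def cF_def intro!: less_imp_le[OF min_cap_pos])
  show "cR I i g n = 0" using g by (simp add: cR_def)
  show "zR I g j \<le> zR I g m" if "j \<le> m" "cR I i g m > 0" for j m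
    using that g by (auto simp: zR_def cR_def intro!: x_le split: if_splits)
qed

lemma umin_ge: "- x f \<le> umin I i f"
  and umin_ge': "k < f \<Longrightarrow> f \<le> n \<Longrightarrow> i \<le> k \<or> 0 < psum lo (Suc k) \<Longrightarrow>
    - x k + psum lo (Suc k) / min_cap I k f \<le> umin I i f"
proof -
  show "- x f \<le> umin I i f" unfolding umin_def by (intro Max_ge) auto
  assume k: "k < f" "f \<le> n" "i \<le> k \<or> 0 < psum lo (Suc k)"
  define m where "m = f - Suc k"
  have m: "f - (m + 1) = k" "f - m = Suc k" "m < f" using k by (auto simp: m_def)
  have "zL I f m + lL I f m / cL I f m \<le> umin I i f"
    unfolding umin_def using k m by (intro Max_ge insertI2 image_eqI[of _ _ m]) (auto simp: lL_def)
  with m show "- x k + psum lo (Suc k) / min_cap I k f \<le> umin I i f"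
    by (simp add: zL_def lL_def cL_def)
qed

lemma umin_le_iff: "f \<le> n \<Longrightarrow> umin I i f \<le> u \<longleftrightarrow> - x f \<le> u \<and>
    (\<forall>k<f. i \<le> k \<or> 0 < psum lo (Suc k) \<longrightarrow> - x k + psum lo (Suc k) / min_cap I k f \<le> u)"
proof
  assume f: "f \<le> n" and "umin I i f \<le> u"
  then show "- x f \<le> u \<and> (\<forall>k<f. i \<le> k \<or> 0 < psum lo (Suc k) \<longrightarrow> - x k + psum lo (Suc k) / min_cap I k f \<le> u)"
    using umin_ge umin_ge' order_trans by blast
next
  assume f: "f \<le> n" and *: "- x f \<le> u \<and>
    (\<forall>k<f. i \<le> k \<or> 0 < psum lo (Suc k) \<longrightarrow> - x k + psum lo (Suc k) / min_cap I k f \<le> u)"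
  have "zL I f m + lL I f m / cL I f m \<le> u" if "m < f" "i + m < f \<or> 0 < lL I f m" for m
  proof -
    have "Suc (f - (m + 1)) = f - m" "i + m < f \<Longrightarrow> i \<le> f - (m + 1)" using that by auto
    with *[THEN conjunct2, rule_format, of "f - (m + 1)"] that show ?thesis
      by (auto simp: zL_def lL_def cL_def)
  qed
  with * show "umin I i f \<le> u" unfolding umin_def by (subst Max_le_iff) auto
qed

lemma vmin_le_iff: "0 < g \<Longrightarrow> vmin I i g \<le> v \<longleftrightarrow> x (g - 1) \<le> v \<and>
    (\<forall>l. g \<le> l \<and> l \<le> n \<and> (l \<le> i \<or> 0 < psum lo (Suc n) - psum lo l) \<longrightarrow>
       x l + (psum lo (Suc n) - psum lo l) / min_cap I (g - 1) l \<le> v)"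
proof -
  assume g: "0 < g"
  have "(\<forall>m. m \<le> n \<and> g + m \<le> n \<and> (g + m \<le> i \<or> 0 < lR I g m) \<longrightarrow> zR I g m + lR I g m / cF I g m \<le> v)
    \<longleftrightarrow> (\<forall>l. g \<le> l \<and> l \<le> n \<and> (l \<le> i \<or> 0 < psum lo (Suc n) - psum lo l) \<longrightarrow>
       x l + (psum lo (Suc n) - psum lo l) / min_cap I (g - 1) l \<le> v)" (is "?l \<longleftrightarrow> ?r")
  proof
    assume l: ?l
    show ?r
    proof (intro allI impI)
      fix l assume l': "g \<le> l \<and> l \<le> n \<and> (l \<le> i \<or> 0 < psum lo (Suc n) - psum lo l)"
      then have "l - g \<le> n" by linarith
      with l' show "x l + (psum lo (Suc n) - psum lo l) / min_cap I (g - 1) l \<le> v"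
        using l[rule_format, of "l - g"] by (simp add: zR_def lR_def cF_def)
    qed
  qed (auto simp: zR_def lR_def cF_def)
  then show ?thesis unfolding vmin_def by (subst Max_le_iff) auto
qed

lemma psum_lo_nonneg: "m \<le> Suc n \<Longrightarrow> 0 \<le> psum lo m"
  using psum_mono_idx[of 0 m lo] lo_nonneg by simp

lemma lR_nonneg: "m \<le> Suc n \<Longrightarrow> 0 \<le> psum lo (Suc n) - psum lo m"
  using psum_mono_idx[of m "Suc n" lo] lo_nonneg by simp

text \<open>A right hinge of positive slope belongs to a vertex up to \<open>i\<close>, and
  \<open>vmin\<close> respects the constraint of such a vertex even without flow. So its bend lies
  at or before \<open>vmin\<close>. The left side has no such property, because vertices before
  \<open>i\<close> are constrained only when they send flow.\<close>

lemma two_hinges: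
  assumes "slot I f g" "i \<le> n"
  shows "two_hinges n (zL I f) (cL I f) (tL I i f) (zR I g) (cR I i g) (tR I i g) (vmin I i g)"
proof -
  have g: "0 < g" "f \<le> n" using assms by (auto simp: slot_def)
  have "zR I g j \<le> vmin I i g" if "cR I i g j > 0" for j
  proof -
    have l: "g + j \<le> i" using that by (auto simp: cR_def split: if_splits)
    have "x (g + j) + (psum lo (Suc n) - psum lo (g + j)) / min_cap I (g - 1) (g + j) \<le> vmin I i g"
      using vmin_le_iff[OF g(1), of i "vmin I i g"] l assms(2) by auto
    moreover have "0 \<le> (psum lo (Suc n) - psum lo (g + j)) / min_cap I (g - 1) (g + j)"
      using lR_nonneg[of "g + j"] min_cap_pos[of "g - 1" "g + j"] l assms(2) g by (intro divide_nonneg_pos) auto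
    ultimately show ?thesis by (simp add: zR_def)
  qed
  with hingesL[OF g(2)] hingesR[OF g(1) assms(2)] show ?thesis
    by (auto simp: two_hinges_def two_hinges_axioms_def)
qed

end

text \<open>The value of the point \<open>(u, v)\<close> of a slot for the vertex \<open>i\<close> and a capacity \<open>C\<close>:
  the sink is \<open>(v - u) / 2\<close> and its evacuation time is \<open>(u + v) / 2\<close>.\<close>

definition mid where "mid I i f g = psum (box_top I i) g - psum (box_top I i) f"
definition rest where "rest I i = psum (wlo I) (Suc (edges I)) - psum (wlo I) (Suc i)"
definition point_value where
  "point_value I i C f g u v = (left_max I i f u + right_max I i g v + mid I i f g - rest I i) / C - (u + v) / 2"

definition admissible :: "path_instance \<Rightarrow> nat \<Rightarrow> nat \<Rightarrow> nat \<Rightarrow> real \<Rightarrow> real \<Rightarrow> bool" where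
  "admissible I i f g u v \<longleftrightarrow> slot I f g \<and> umin I i f \<le> u \<and> vmin I i g \<le> v \<and>
     2 * pos I (g - 1) \<le> v - u \<and> v - u \<le> 2 * pos I f"

lemma psum_cong: "(\<And>t. t < m \<Longrightarrow> s t = s' t) \<Longrightarrow> psum s m = psum s' m"
  by (simp add: psum_def)

context path
begin

lemma min_cap_pos_right: "0 < g \<Longrightarrow> g \<le> l \<Longrightarrow> l \<le> n \<Longrightarrow> 0 < min_cap I (g - 1) l"
  by (rule min_cap_pos) auto

section \<open>The largest weight compatible with a point \<open>(u, v)\<close>\<close>

lemma psum_ge_lo:
  assumes "in_box I i s" "a \<le> b" "b \<le> Suc n"
  shows "psum lo b - psum lo a \<le> psum s b - psum s a" "psum s b - psum s a \<le> psum (box_top I i) b - psum (box_top I i) a"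
  using assms by (auto intro!: psum_diff_mono simp: in_box_def)

text \<open>Each vertex \<open>k\<close> splits the weight of the side: the vertices up to
  \<open>k\<close> send at most what the capacity towards the slot lets through in time, and the
  vertices between \<open>k\<close> and the slot carry at most their upper weights. The two summands
  make up a hinge.\<close>

lemma left_bound:
  assumes "in_box I i s" "left_feasible I i f s u" "f \<le> n"
  shows "umin I i f \<le> u" "psum s f \<le> left_max I i f u"
proof -
  have P: "psum lo (Suc k) \<le> psum s (Suc k)" if "k < f" for k
    using psum_ge_lo(1)[OF assms(1), of 0 "Suc k"] that assms(3) by simp
  show "umin I i f \<le> u" unfolding umin_le_iff[OF assms(3)]
  proof (intro conjI allI impI)
    show "- x f \<le> u" using assms(2) by (simp add: left_feasible_def)
    fix k assume k: "k < f" "i \<le> k \<or> 0 < psum lo (Suc k)"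
    have "psum lo (Suc k) / min_cap I k f \<le> psum s (Suc k) / min_cap I k f"
      using P[OF k(1)] min_cap_pos[of k f] k assms(3) by (intro divide_right_mono) auto
    moreover have "- x k + psum s (Suc k) / min_cap I k f \<le> u"
      using assms(2) k P[OF k(1)] by (auto simp: left_feasible_def)
    ultimately show "- x k + psum lo (Suc k) / min_cap I k f \<le> u" by simp
  qed
  have "psum s f \<le> hinge (zL I f) (cL I f) (tL I i f) j u" if "j \<le> n" for j
  proof (cases "j < f")
    case True
    define k where "k = f - Suc j"
    have k: "k < f" "f - j = Suc k" using True by (auto simp: k_def)
    have "psum s (Suc k) \<le> max 0 ((u + x k) * min_cap I k f)"
    proof (cases "0 < psum s (Suc k)")
      case pos: True
      then have "psum s (Suc k) / min_cap I k f \<le> u + x k" using assms(2) k(1) by (force simp: left_feasible_def)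
      then have "psum s (Suc k) \<le> (u + x k) * min_cap I k f"
        using min_cap_pos[of k f] k(1) assms(3) by (simp add: pos_divide_le_eq)
      then show ?thesis by simp
    qed simp
    moreover have "psum s f - psum s (Suc k) \<le> tL I i f j"
      using psum_ge_lo(2)[OF assms(1), of "Suc k" f] k assms(3) by (simp add: tL_def)
    ultimately show ?thesis using True by (simp add: hinge_def zL_def cL_def k_def)
  next
    case False
    then show ?thesis using psum_ge_lo(2)[OF assms(1), of 0 f] assms(3)
      by (simp add: hinge_def cL_def tL_def)
  qed
  then show "psum s f \<le> left_max I i f u" by (simp add: left_max_def le_hmin_iff)
qed

lemma right_bound:
  assumes "in_box I i s" "right_feasible I i g s v" "0 < g" "g \<le> Suc n" "i \<le> n"
  shows "vmin I i g \<le> v" "psum s (Suc n) - psum s g \<le> right_max I i g v"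
proof -
  let ?Q = "\<lambda>s l. psum s (Suc n) - psum s l"
  have Q: "?Q lo l \<le> ?Q s l" if "l \<le> n" for l
    using psum_ge_lo(1)[OF assms(1), of l "Suc n"] that by simp
  show "vmin I i g \<le> v" unfolding vmin_le_iff[OF assms(3)]
  proof (intro conjI allI impI)
    show "x (g - 1) \<le> v" using assms(2) by (simp add: right_feasible_def)
    fix l assume l: "g \<le> l \<and> l \<le> n \<and> (l \<le> i \<or> 0 < ?Q lo l)"
    have "?Q lo l / min_cap I (g - 1) l \<le> ?Q s l / min_cap I (g - 1) l"
      using Q[of l] min_cap_pos_right[OF assms(3), of l] l by (intro divide_right_mono) auto
    moreover have "x l + ?Q s l / min_cap I (g - 1) l \<le> v"
      using assms(2) l Q[of l] by (auto simp: right_feasible_def)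
    ultimately show "x l + ?Q lo l / min_cap I (g - 1) l \<le> v" by simp
  qed
  have "?Q s g \<le> hinge (zR I g) (cR I i g) (tR I i g) j v" if "j \<le> n" for j
  proof (cases "g + j \<le> i")
    case True
    have l: "g + j \<le> n" using True assms(5) by simp
    have "x (g + j) + ?Q s (g + j) / min_cap I (g - 1) (g + j) \<le> v"
      using assms(2) True l by (force simp: right_feasible_def)
    then have "?Q s (g + j) / min_cap I (g - 1) (g + j) \<le> v - x (g + j)" by simp
    then have "?Q s (g + j) \<le> (v - x (g + j)) * min_cap I (g - 1) (g + j)"
      using min_cap_pos_right[of g "g + j"] l assms(3) by (simp add: pos_divide_le_eq)
    moreover have "psum s (g + j) - psum s g \<le> tR I i g j"
      using psum_ge_lo(2)[OF assms(1), of g "g + j"] l True by (simp add: tR_def)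
    ultimately show ?thesis using True by (simp add: hinge_def zR_def cR_def cF_def)
  next
    case False
    then show ?thesis using psum_ge_lo(2)[OF assms(1), of g "Suc n"] assms(4)
      by (simp add: hinge_def cR_def tR_def)
  qed
  then show "?Q s g \<le> right_max I i g v" by (simp add: right_max_def le_hmin_iff)
qed

text \<open>Keeps the greedy scenarios inside the box: their partial sums are maxima of two
  sequences, and the increments of both lie between the same bounds.\<close>

lemma max_increment:
  fixes a b a' b' :: real
  assumes "l \<le> a' - a" "a' - a \<le> h" "l \<le> b' - b" "b' - b \<le> h"
  shows "l \<le> max a' b' - max a b" "max a' b' - max a b \<le> h"
  using assms by (auto simp: max_def)

text \<open>Filling the vertices nearest to the slot first keeps all other prefix sums minimal.\<close>

lemma left_realize:
  assumes "f \<le> n" "umin I i f \<le> u"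
  obtains s where "\<And>t. t < f \<Longrightarrow> lo t \<le> s t \<and> s t \<le> box_top I i t" "psum s f = left_max I i f u" "left_feasible I i f s u"
proof -
  let ?w = "psum (box_top I i)" and ?q = "left_max I i f u"
  \<comment> \<open>The prefix sums of the greedy filling: the total \<open>?q\<close> minus all
    that fits between \<open>m\<close> and the slot, unless that falls below the minimal prefix
    sum.\<close>
  define F where "F m = max (psum lo m) (?q - (?w f - ?w m))" for m
  define s where "s t = F (Suc t) - F t" for t
  have um: "- x k + psum lo (Suc k) / min_cap I k f \<le> u" if "k < f" "i \<le> k \<or> 0 < psum lo (Suc k)" for k
    using assms umin_le_iff[OF assms(1)] that by blast
  have H: "?q \<le> ?w f - ?w (Suc k) + max 0 ((u + x k) * min_cap I k f)" if "k < f" for k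
  proof -
    have "f - Suc k \<le> n" "f - (f - Suc k) = Suc k" "f - Suc k < f" "f - Suc (f - Suc k) = k"
      using that assms(1) by auto
    then show ?thesis using hmin_le[of "f - Suc k" n "zL I f" "cL I f" "tL I i f" u]
      by (simp add: left_max_def hinge_def tL_def zL_def cL_def)
  qed
  have top: "?q \<le> ?w f"
    using hmin_le[of n n "zL I f" "cL I f" "tL I i f" u] assms(1)
    by (simp add: left_max_def hinge_def tL_def cL_def)
  have PH: "psum lo (Suc k) \<le> max 0 ((u + x k) * min_cap I k f)" if "k < f" for k
  proof (cases "0 < psum lo (Suc k)")
    case True
    then have "psum lo (Suc k) / min_cap I k f \<le> u + x k" using um[OF that] by simp
    then have "psum lo (Suc k) \<le> (u + x k) * min_cap I k f"
      using min_cap_pos[of k f] that assms(1) by (simp add: pos_divide_le_eq)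
    then show ?thesis by simp
  qed simp
  have lo_w: "psum lo f - psum lo m \<le> ?w f - ?w m" if "m \<le> f" for m
    using that assms(1) by (intro psum_diff_mono) (auto intro: lo_box_top)
  have q_ge: "psum lo f \<le> ?q"
  proof -
    have "psum lo f \<le> hinge (zL I f) (cL I f) (tL I i f) j u" if "j \<le> n" for j
    proof (cases "j < f")
      case True
      define k where "k = f - Suc j"
      have k: "k < f" "f - j = Suc k" "Suc k \<le> f" using True by (auto simp: k_def)
      then show ?thesis using PH[OF k(1)] lo_w[OF k(3)] True
        by (simp add: hinge_def zL_def cL_def tL_def k_def)
    next
      case False
      then show ?thesis using lo_w[of 0] by (simp add: hinge_def cL_def tL_def)
    qed
    then show ?thesis by (simp add: left_max_def le_hmin_iff)
  qed
  have F0: "F 0 = 0" using top by (simp add: F_def)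
  have ps: "psum s m = F m" for m
    by (induction m) (simp_all add: psum_Suc s_def F0)
  have 1: "lo t \<le> s t \<and> s t \<le> box_top I i t" if "t < f" for t
  proof -
    have "lo t \<le> box_top I i t" using lo_box_top that assms(1) by simp
    then show ?thesis unfolding s_def F_def
      using max_increment[of "lo t" "psum lo (Suc t)" "psum lo t" "box_top I i t"
          "?q - (?w f - ?w (Suc t))" "?q - (?w f - ?w t)"] by (simp add: psum_Suc)
  qed
  have 2: "psum s f = ?q" using q_ge by (simp add: ps F_def)
  have 3: "left_feasible I i f s u" unfolding left_feasible_def
  proof (intro conjI allI impI)
    show "- x f \<le> u" using assms umin_le_iff by blast
    fix k assume k: "k < f" "i \<le> k \<or> 0 < psum s (Suc k)"
    have c: "0 < min_cap I k f" using k assms(1) min_cap_pos by simp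
    have P: "psum s (Suc k) \<le> max 0 ((u + x k) * min_cap I k f)"
      using PH[OF k(1)] H[OF k(1)] by (simp add: ps F_def)
    have "psum s (Suc k) \<le> (u + x k) * min_cap I k f"
    \<comment> \<open>The hinge must be on its linear part. For \<open>i \<le> k\<close> this is
      what \<open>umin\<close> enforces even without flow; for \<open>k < i\<close> it follows from
      the positive flow.\<close>
    proof (cases "i \<le> k")
      case True
      have "0 \<le> psum lo (Suc k) / min_cap I k f"
        using c psum_lo_nonneg[of "Suc k"] k assms(1) by (intro divide_nonneg_pos) auto
      with um[OF k(1)] True have "0 \<le> u + x k" by simp
      with P c show ?thesis by (simp add: max_absorb2)
    next
      case False
      with k P show ?thesis by (auto simp: max_def split: if_splits)
    qed
    with c show "- x k + psum s (Suc k) / min_cap I k f \<le> u" by (simp add: pos_divide_le_eq)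
        (simp add: field_simps)
  qed
  from that[OF 1 2 3] show ?thesis by blast
qed

lemma right_realize:
  assumes "0 < g" "g \<le> Suc n" "i \<le> n" "vmin I i g \<le> v"
  obtains s where "\<And>t. g \<le> t \<Longrightarrow> t \<le> n \<Longrightarrow> lo t \<le> s t \<and> s t \<le> box_top I i t"
    "psum s (Suc n) - psum s g = right_max I i g v" "right_feasible I i g s v"
proof -
  let ?w = "psum (box_top I i)" and ?r = "right_max I i g v" and ?Q = "\<lambda>s l. psum s (Suc n) - psum s l"
  \<comment> \<open>Here \<open>F m\<close> is the sum from vertex \<open>m\<close> to the end, so
    the weights are decrements of \<open>F\<close>.\<close>
  define F where "F m = max (?Q lo m) (?r - (?w m - ?w g))" for m
  define s where "s t = F t - F (Suc t)" for t
  have vm: "x l + ?Q lo l / min_cap I (g - 1) l \<le> v" if "g \<le> l" "l \<le> n" "l \<le> i \<or> 0 < ?Q lo l" for l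
    using assms vmin_le_iff[OF assms(1)] that by blast
  have line: "?Q lo l \<le> (v - x l) * min_cap I (g - 1) l \<and> 0 \<le> (v - x l) * min_cap I (g - 1) l"
    if "g \<le> l" "l \<le> i" for l
  proof -
    have c: "0 < min_cap I (g - 1) l" using min_cap_pos_right[of g l] that assms(1,3) by simp
    have "?Q lo l / min_cap I (g - 1) l \<le> v - x l" using vm[of l] that assms by simp
    then have "?Q lo l \<le> (v - x l) * min_cap I (g - 1) l" using c by (simp add: pos_divide_le_eq)
    then show ?thesis using lR_nonneg[of l] that assms by force
  qed
  have H: "?r \<le> ?w l - ?w g + (v - x l) * min_cap I (g - 1) l" if "g \<le> l" "l \<le> i" for l
  proof -
    have "l - g \<le> n" using that assms by simp
    then show ?thesis using hmin_le[of "l - g" n "zR I g" "cR I i g" "tR I i g" v] line[OF that] that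
      by (simp add: right_max_def hinge_def tR_def zR_def cR_def cF_def max_absorb2)
  qed
  have top: "?r \<le> ?w (Suc n) - ?w g"
    using hmin_le[of n n "zR I g" "cR I i g" "tR I i g" v] assms
    by (simp add: right_max_def hinge_def tR_def cR_def)
  have lo_w: "psum lo b - psum lo g \<le> ?w b - ?w g" if "g \<le> b" "b \<le> Suc n" for b
    using that by (intro psum_diff_mono) (auto intro: lo_box_top)
  have r_ge: "?Q lo g \<le> ?r"
  proof -
    have "?Q lo g \<le> hinge (zR I g) (cR I i g) (tR I i g) j v" if "j \<le> n" for j
    proof (cases "g + j \<le> i")
      case True
      then show ?thesis using line[of "g + j"] lo_w[of "g + j"] assms
        by (simp add: hinge_def zR_def cR_def cF_def tR_def max_absorb2)
    next
      case False
      then show ?thesis using lo_w[of "Suc n"] assms by (simp add: hinge_def cR_def tR_def)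
    qed
    then show ?thesis by (simp add: right_max_def le_hmin_iff)
  qed
  have Fn: "F (Suc n) = 0" using top by (simp add: F_def)
  have ps: "psum s m = F 0 - F m" for m
    by (induction m) (simp_all add: psum_Suc s_def)
  have Q: "?Q s m = F m" for m by (simp add: ps Fn)
  have 1: "lo t \<le> s t \<and> s t \<le> box_top I i t" if "g \<le> t" "t \<le> n" for t
  proof -
    have "lo t \<le> box_top I i t" using lo_box_top that by simp
    then show ?thesis unfolding s_def F_def
      using max_increment[of "lo t" "?Q lo t" "?Q lo (Suc t)" "box_top I i t"
          "?r - (?w t - ?w g)" "?r - (?w (Suc t) - ?w g)"] by (simp add: psum_Suc)
  qed
  have 2: "?Q s g = ?r" using r_ge by (simp add: Q F_def)
  have 3: "right_feasible I i g s v" unfolding right_feasible_def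
  proof (intro conjI allI impI)
    show "x (g - 1) \<le> v" using assms vmin_le_iff by blast
    fix l assume l: "g \<le> l \<and> l \<le> n \<and> (l \<le> i \<or> 0 < ?Q s l)"
    have c: "0 < min_cap I (g - 1) l" using l assms(1) min_cap_pos_right by blast
    show "x l + ?Q s l / min_cap I (g - 1) l \<le> v"
    proof (cases "l \<le> i")
      case True
      have "?Q s l \<le> (v - x l) * min_cap I (g - 1) l"
        using line[of l] H[of l] l True by (simp add: Q F_def)
      with c have "?Q s l / min_cap I (g - 1) l \<le> v - x l" by (simp add: pos_divide_le_eq)
      then show ?thesis by simp
    next
      case False
      \<comment> \<open>Beyond \<open>i\<close> the upper and lower weights of the box coincide, so
        the sum is minimal and \<open>vmin\<close> already accounts for the vertex.\<close>
      have "?Q s l \<le> ?Q lo l"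
      proof -
        have "?Q s l \<le> ?Q (box_top I i) l"
          using 1 l by (intro psum_diff_mono) auto
        also have "\<dots> = ?Q lo l" using False l by (intro psum_cong_diff) (auto simp: box_top_def)
        finally show ?thesis .
      qed
      then have "?Q s l / min_cap I (g - 1) l \<le> ?Q lo l / min_cap I (g - 1) l" "0 < ?Q lo l"
        using c l False by (auto intro!: divide_right_mono)
      then show ?thesis using vm[of l] l by simp
    qed
  qed
  from that[OF 1 2 3] show ?thesis by blast
qed

lemma left_feasible_cong: "(\<And>t. t < f \<Longrightarrow> s t = s' t) \<Longrightarrow> left_feasible I i f s u \<longleftrightarrow> left_feasible I i f s' u"
proof -
  assume *: "\<And>t. t < f \<Longrightarrow> s t = s' t"
  have "k < f \<Longrightarrow> psum s (Suc k) = psum s' (Suc k)" for k using * by (intro psum_cong) simp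
  then show ?thesis unfolding left_feasible_def by auto
qed

lemma right_feasible_cong: "(\<And>t. g \<le> t \<Longrightarrow> t \<le> n \<Longrightarrow> s t = s' t) \<Longrightarrow> right_feasible I i g s v \<longleftrightarrow> right_feasible I i g s' v"
proof -
  assume *: "\<And>t. g \<le> t \<Longrightarrow> t \<le> n \<Longrightarrow> s t = s' t"
  have "g \<le> l \<Longrightarrow> l \<le> n \<Longrightarrow> psum s (Suc n) - psum s l = psum s' (Suc n) - psum s' l" for l
    using * by (intro psum_cong_diff) auto
  then show ?thesis unfolding right_feasible_def by (auto simp del: diff_gt_0_iff_gt)
qed

lemma realize:
  assumes "slot I f g" "i \<le> n" "umin I i f \<le> u" "vmin I i g \<le> v"
  obtains s where "in_box I i s" "left_feasible I i f s u" "right_feasible I i g s v"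
    "psum s (Suc n) = left_max I i f u + right_max I i g v + mid I i f g"
proof -
  have fg: "f \<le> n" "0 < g" "g \<le> Suc n" "f \<le> g" using assms(1) by (auto simp: slot_def)
  obtain p where p: "\<And>t. t < f \<Longrightarrow> lo t \<le> p t \<and> p t \<le> box_top I i t" "psum p f = left_max I i f u" "left_feasible I i f p u"
    using left_realize[OF fg(1) assms(3)] by blast
  obtain r where r: "\<And>t. g \<le> t \<Longrightarrow> t \<le> n \<Longrightarrow> lo t \<le> r t \<and> r t \<le> box_top I i t"
    "psum r (Suc n) - psum r g = right_max I i g v" "right_feasible I i g r v"
    using right_realize[OF fg(2,3) assms(2,4)] by blast
  define s where "s t = (if t < f then p t else if t < g then box_top I i t else r t)" for t
  have "in_box I i s" using p(1) r(1) lo_box_top by (auto simp: in_box_def s_def)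
  moreover have "left_feasible I i f s u" using p(3) left_feasible_cong[of f s p] by (simp add: s_def)
  moreover have "right_feasible I i g s v" using r(3) right_feasible_cong[of g s r] fg by (simp add: s_def)
  moreover have "psum s f = psum p f" by (intro psum_cong) (simp add: s_def)
  moreover have "psum s g - psum s f = mid I i f g"
    unfolding mid_def using fg by (intro psum_cong_diff) (auto simp: s_def)
  moreover have "psum s (Suc n) - psum s g = psum r (Suc n) - psum r g"
    using fg by (intro psum_cong_diff) (auto simp: s_def)
  ultimately show ?thesis using that[of s] p(2) r(2) by simp
qed

lemma bound:
  assumes "slot I f g" "i \<le> n" "in_box I i s" "left_feasible I i f s u" "right_feasible I i g s v"
  shows "umin I i f \<le> u" "vmin I i g \<le> v" "psum s (Suc n) \<le> left_max I i f u + right_max I i g v + mid I i f g"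
proof -
  have fg: "f \<le> n" "0 < g" "g \<le> Suc n" "f \<le> g" using assms(1) by (auto simp: slot_def)
  show "umin I i f \<le> u" "vmin I i g \<le> v"
    using left_bound(1)[OF assms(3,4) fg(1)] right_bound(1)[OF assms(3,5) fg(2,3) assms(2)] by auto
  show "psum s (Suc n) \<le> left_max I i f u + right_max I i g v + mid I i f g"
    using left_bound(2)[OF assms(3,4) fg(1)] right_bound(2)[OF assms(3,5) fg(2,3) assms(2)]
      psum_ge_lo(2)[OF assms(3), of f g] fg by (simp add: mid_def)
qed

text \<open>The weights after \<open>i\<close> are pinned, so maximising the prefix up to
  \<open>i\<close> is maximising the total. This spares a case distinction on which side of the slot
  \<open>i\<close> lies.\<close>

lemma in_box_total: "in_box I i s \<Longrightarrow> i \<le> n \<Longrightarrow> psum s (Suc n) - rest I i = psum s (Suc i)"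
proof -
  assume s: "in_box I i s" "i \<le> n"
  then have "psum s (Suc n) - psum s (Suc i) = rest I i"
    unfolding rest_def
  proof (intro psum_cong_diff)
    fix t assume "Suc i \<le> t" "t < Suc n"
    then show "s t = lo t" using s(1)[unfolded in_box_def, rule_format, of t] by (simp add: box_top_def)
  qed simp
  then show ?thesis by simp
qed

text \<open>On the boundary of an edge slot the sink is a vertex, whose own slot is at least as good.\<close>

lemma boundary:
  assumes "admissible I i f f u v" "i \<le> n" "v - u = 2 * x (f - 1) \<or> v - u = 2 * x f" "0 < C"
  shows "\<exists>f'. admissible I i f' (Suc f') u v \<and> point_value I i C f f u v \<le> point_value I i C f' (Suc f') u v"
proof -
  have f: "0 < f" "f \<le> n" "slot I f f" using assms(1) by (auto simp: admissible_def slot_def)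
  \<comment> \<open>A scenario realising the value of the edge slot. It remains feasible at the end
    vertex, where fewer constraints apply and capacities are no smaller, so the maximum of the
    vertex slot is at least its total weight.\<close>
  obtain s where s: "in_box I i s" "left_feasible I i f s u" "right_feasible I i f s v"
    "psum s (Suc n) = left_max I i f u + right_max I i f v + mid I i f f"
    using realize[OF f(3) assms(2), of u v] assms(1) by (auto simp: admissible_def)
  have P: "0 \<le> psum s b - psum s a" if "a \<le> b" "b \<le> Suc n" for a b
  proof -
    have "0 \<le> s t" if "t \<le> n" for t using s(1) lo_nonneg[OF that] that by (force simp: in_box_def)
    with psum_mono_idx[of a b s] that show ?thesis by simp
  qed
  define f' where "f' = (if v - u = 2 * x f then f else f - 1)"
  have eq: "v - u = 2 * x f'" and f': "f' \<le> n" "Suc f' = f \<or> f' = f" "f' \<le> f"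
    using assms(3) f by (auto simp: f'_def)
  have sl: "slot I f' (Suc f')" using f' by (simp add: slot_def)
  have "left_feasible I i f' s u" unfolding left_feasible_def
  proof (intro conjI allI impI)
    have "x (f - 1) \<le> v" "- x f \<le> u" using s(2,3) by (auto simp: left_feasible_def right_feasible_def)
    then show "- x f' \<le> u" using eq f' by auto
    fix k assume k: "k < f'" "i \<le> k \<or> 0 < psum s (Suc k)"
    then have "- x k + psum s (Suc k) / min_cap I k f \<le> u" using s(2) f' by (auto simp: left_feasible_def)
    moreover have "psum s (Suc k) / min_cap I k f' \<le> psum s (Suc k) / min_cap I k f"
      using P[of 0 "Suc k"] k f f' min_cap_anti[of k k f' f] min_cap_pos[of k f] min_cap_pos[of k f']
      by (intro divide_left_mono) auto
    ultimately show "- x k + psum s (Suc k) / min_cap I k f' \<le> u" by simp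
  qed
  moreover have "right_feasible I i (Suc f') s v" unfolding right_feasible_def
  proof (intro conjI allI impI)
    have "x (f - 1) \<le> v" "- x f \<le> u" using s(2,3) by (auto simp: left_feasible_def right_feasible_def)
    then show "x (Suc f' - 1) \<le> v" using eq f' by auto
    let ?Q = "\<lambda>l. psum s (Suc n) - psum s l"
    fix l assume l: "Suc f' \<le> l \<and> l \<le> n \<and> (l \<le> i \<or> 0 < ?Q l)"
    then have "x l + ?Q l / min_cap I (f - 1) l \<le> v" using s(3) f' by (auto simp: right_feasible_def)
    moreover have "?Q l / min_cap I f' l \<le> ?Q l / min_cap I (f - 1) l"
      using P[of l "Suc n"] l f f' min_cap_anti[of "f - 1" f' l l] min_cap_pos[of "f - 1" l] min_cap_pos[of f' l]
      by (intro divide_left_mono) auto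
    ultimately show "x l + ?Q l / min_cap I (Suc f' - 1) l \<le> v" by simp
  qed
  ultimately have b: "umin I i f' \<le> u" "vmin I i (Suc f') \<le> v"
    "psum s (Suc n) \<le> left_max I i f' u + right_max I i (Suc f') v + mid I i f' (Suc f')"
    using bound[OF sl assms(2) s(1)] by auto
  have "admissible I i f' (Suc f') u v" using sl b eq by (simp add: admissible_def)
  moreover have "point_value I i C f f u v \<le> point_value I i C f' (Suc f') u v"
    unfolding point_value_def using b(3) s(4) assms(4) by (intro diff_right_mono divide_right_mono) auto
  ultimately show ?thesis by blast
qed

end

section \<open>Candidate points, and their correspondence with regrets\<close>

definition lcand where "lcand I i f = cand (edges I) (zL I f) (cL I f) (tL I i f) (umin I i f)"
definition rcand where "rcand I i g = cand (edges I) (zR I g) (cR I i g) (tR I i g) (vmin I i g)"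

definition thmin where "thmin I i f = max (umin I i f + pos I f) (vmin I i (Suc f) - pos I f)"

definition vertex_val where "vertex_val I i C f \<theta> = point_value I i C f (Suc f) (\<theta> - pos I f) (\<theta> + pos I f)"

definition right_value where "right_value I i C g v = right_max I i g v / C - v / 2"

lemma point_value_edge: "point_value I i C f f u v = (left_max I i f u - rest I i) / C - u / 2 + right_value I i C f v"
  by (simp add: point_value_def right_value_def mid_def diff_divide_distrib add_divide_distrib)

context path
begin

lemma vertex_cands:
  assumes "admissible I i f (Suc f) u v" "i \<le> n" "0 < C"
  shows "\<exists>j\<le>n. point_value I i C f (Suc f) u v \<le> vertex_val I i C f (max (thmin I i f) (lcand I i f j + x f)) \<or>
    point_value I i C f (Suc f) u v \<le> vertex_val I i C f (max (thmin I i f) (rcand I i (Suc f) j - x f))"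
proof -
  interpret two_hinges n "zL I f" "cL I f" "tL I i f" "zR I (Suc f)" "cR I i (Suc f)" "tR I i (Suc f)"
    "umin I i f" "vmin I i (Suc f)"
    using two_hinges[of f "Suc f" i] assms by (simp add: admissible_def)
  let ?K = "(mid I i f (Suc f) - rest I i) / C"
  have val: "vertex_val I i C f w = (1 / C * (left_max I i f (w - x f) + right_max I i (Suc f) (w + x f)) - w) + ?K" for w
    using assms(3) by (simp add: vertex_val_def point_value_def field_simps)
  define w where "w = (u + v) / 2"
  have w: "u = w - x f" "v = w + x f" using assms(1) by (auto simp: w_def admissible_def field_simps)
  have *: "0 \<le> 1 / C" "umin I i f \<le> w - x f" "vmin I i (Suc f) \<le> w + x f"
    using assms w by (auto simp: admissible_def)
  show ?thesis
    using vertex_max[OF *] unfolding val w vertex_val_def[symmetric] lcand_def rcand_def thmin_def left_max_def right_max_def by auto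
qed

lemma best_right:
  assumes "0 < g" "i \<le> n" "0 < C" "vmin I i g \<le> v"
  shows "\<exists>j\<le>n. right_value I i C g v \<le> right_value I i C g (rcand I i g j)"
proof -
  interpret hinges n "zR I g" "cR I i g" "tR I i g" using hingesR assms by simp
  show ?thesis using ray_max[of "1/C" "1/2" "vmin I i g" v] assms
    by (simp add: right_value_def rcand_def right_max_def)
qed

text \<open>On an edge the right side is concave, since \<open>i\<close> has positive weight, whereas the left side need
  not be. So the unconstrained optimum of the right side may be combined with all left candidates.\<close>

lemma edge_cands:
  assumes "admissible I i f f u v" "i \<le> n" "0 < C" "vmin I i f \<le> v'"
    and best: "\<And>j. j \<le> n \<Longrightarrow> right_value I i C f (rcand I i f j) \<le> right_value I i C f v'"
  shows "(\<exists>j\<le>n. 2 * x (f - 1) \<le> v' - lcand I i f j \<and> v' - lcand I i f j \<le> 2 * x f \<and>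
      point_value I i C f f u v \<le> point_value I i C f f (lcand I i f j) v') \<or>
    (\<exists>f' a b. admissible I i f' (Suc f') a b \<and> point_value I i C f f u v \<le> point_value I i C f' (Suc f') a b)"
proof -
  have f: "0 < f" "slot I f f" using assms(1) by (auto simp: admissible_def slot_def)
  interpret two_hinges n "zL I f" "cL I f" "tL I i f" "zR I f" "cR I i f" "tR I i f"
    "umin I i f" "vmin I i f"
    using two_hinges[OF f(2) assms(2)] .
  let ?K = "(mid I i f f - rest I i) / C"
  have val: "point_value I i C f f a b = (1 / C * (left_max I i f a + right_max I i f b) - (a + b) / 2) + ?K" for a b
    by (simp add: point_value_def add_divide_distrib diff_divide_distrib)
  have *: "0 \<le> 1 / C" "umin I i f \<le> u" "vmin I i f \<le> v" "2 * x (f - 1) \<le> v - u" "v - u \<le> 2 * x f"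
    using assms by (auto simp: admissible_def)
  have b: "1 / C * hmin n (zR I f) (cR I i f) (tR I i f) w - 1/2 * w \<le>
     1 / C * hmin n (zR I f) (cR I i f) (tR I i f) v' - 1/2 * v'" if w: "vmin I i f \<le> w" for w
  proof -
    obtain j where "j \<le> n" "right_value I i C f w \<le> right_value I i C f (rcand I i f j)"
      using best_right[OF f(1) assms(2,3) w] by blast
    with best[of j] show ?thesis by (simp add: right_value_def right_max_def)
  qed
  from edge_max[OF * assms(4) b]
  consider j where "j \<le> n" "2 * x (f - 1) \<le> v' - lcand I i f j" "v' - lcand I i f j \<le> 2 * x f"
      "point_value I i C f f u v \<le> point_value I i C f f (lcand I i f j) v'"
    | a b where "umin I i f \<le> a" "vmin I i f \<le> b" "b - a = 2 * x (f - 1) \<or> b - a = 2 * x f"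
      "point_value I i C f f u v \<le> point_value I i C f f a b"
    unfolding val lcand_def left_max_def right_max_def by auto
  then show ?thesis
  proof cases
    case 2
    have "x (f - 1) \<le> x f" using f by (intro x_le) (auto simp: slot_def)
    with 2 f have "admissible I i f f a b" by (auto simp: admissible_def)
    from boundary[OF this assms(2) 2(3) assms(3)] 2(4) show ?thesis by (meson order_trans)
  qed blast
qed

text \<open>The scenario realising a point may have no weight at \<open>i\<close>, and then
  \<open>i\<close> does not count. Raising its weight to a small \<open>d\<close> makes
  \<open>i\<close> send flow. Vertices that start to send flow thereby have been constrained all
  along, as feasibility is closed, so the time grows only by \<open>d\<close> over a capacity, at
  most \<open>e\<close>.\<close>

lemma sound:
  assumes "admissible I i f g u w" "i < v" "v \<le> n" "0 < up i" "0 < e"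
  obtains s where "s \<in> scenarios I" "0 < s i"
    "point_value I i (min_cap I i v) f g u w - e \<le> psum s (Suc i) / min_cap I i v - opt_evac_time I s"
proof -
  let ?C = "min_cap I i v"
  have i: "i \<le> n" "i < n" using assms by auto
  have C: "0 < ?C" using assms min_cap_pos by simp
  have sl: "slot I f g" and fg: "f \<le> n" "0 < g" "g \<le> Suc n" "f \<le> g" "g \<le> Suc f"
    using assms(1) by (auto simp: admissible_def slot_def)
  obtain s where s: "in_box I i s" "left_feasible I i f s u" "right_feasible I i g s w"
    "psum s (Suc n) = left_max I i f u + right_max I i g w + mid I i f g"
    using realize[OF sl i(1), of u w] assms(1) by (auto simp: admissible_def)
  have pv: "point_value I i ?C f g u w = psum s (Suc i) / ?C - (u + w) / 2"
    using in_box_total[OF s(1) i(1)] s(4) by (simp add: point_value_def)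
  define m where "m = Min (cap I ` {..<n})"
  have m: "0 < m" using i valid by (subst m_def, subst Min_gr_iff) (auto simp: valid_instance_def)
  have cm_m: "m \<le> min_cap I a b" if "a < b" "b \<le> n" for a b
    unfolding m_def min_cap_def using that by (intro Min_antimono) auto
  \<comment> \<open>Small enough that \<open>d\<close> over any capacity of the path is at most
    \<open>e\<close>, and allowed by the upper weight of \<open>i\<close>.\<close>
  define d where "d = min (e * m) (up i)"
  have d: "0 < d" "d \<le> up i" "d / m \<le> e" using assms(4,5) m by (auto simp: d_def pos_divide_le_eq)
  define s' where "s' = (\<lambda>t\<in>{..n}. if t = i then max (s i) d else s t)"
  have s_lo: "lo t \<le> s t" "s t \<le> box_top I i t" if "t \<le> n" for t using s(1) that by (auto simp: in_box_def)
  have "box_top I i t \<le> up t" if "t \<le> n" for t using lo_up[OF that] by (simp add: box_top_def)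
  then have s'_box: "lo t \<le> s' t \<and> s' t \<le> up t" if "t \<le> n" for t
    using s_lo[OF that] d that by (force simp: s'_def)
  have sc: "s' \<in> scenarios I" unfolding scenarios_def
  proof (rule PiE_I)
    show "s' t \<in> {lo t..up t}" if "t \<in> {..n}" for t using s'_box that by simp
    show "s' t = undefined" if "t \<notin> {..n}" for t using that by (simp add: s'_def)
  qed
  have "0 < s' i" using d i by (simp add: s'_def)
  have s0: "0 \<le> s t" if "t \<le> n" for t using s_lo(1)[OF that] lo_nonneg[OF that] by simp
  have s': "s t \<le> s' t" "s' t \<le> s t + (if t = i then d else 0)" if "t \<le> n" for t
    using that d s0[of i] i by (auto simp: s'_def)
  have psd: "psum (\<lambda>t. s t + (if t = i then d else 0)) k = psum s k + (if i < k then d else 0)" for k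
    by (induction k) (auto simp: psum_Suc)
  have inc: "psum s' b - psum s' a \<le> psum s b - psum s a + d" if "a \<le> b" "b \<le> Suc n" for a b
  proof -
    have "psum s' b - psum s' a \<le> psum (\<lambda>t. s t + (if t = i then d else 0)) b - psum (\<lambda>t. s t + (if t = i then d else 0)) a"
      using s' that by (intro psum_diff_mono) auto
    then show ?thesis using d that by (auto simp: psd split: if_splits)
  qed
  define y \<theta> where "y = (w - u) / 2" and "\<theta> = (u + w) / 2"
  have uv: "u = \<theta> - y" "w = \<theta> + y" by (auto simp: y_def \<theta>_def field_simps)
  have y: "x (g - 1) \<le> y" "y \<le> x f" using assms(1) by (auto simp: admissible_def y_def)
  have "x 0 \<le> x (g - 1)" "x f \<le> x n" using fg by (auto intro!: x_le)
  with y have yS: "y \<in> sinks I" by (simp add: sinks_def)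
  have Q0: "0 \<le> (psum s b - psum s a) / min_cap I k l" if "a \<le> b" "b \<le> Suc n" "k < l" "l \<le> n" for a b k l
    using psum_mono_idx[of a b s] s0 that min_cap_pos[of k l] by (intro divide_nonneg_pos) auto
  \<comment> \<open>If \<open>i\<close> lies on one side of the slot, its constraint makes the time
    at least its distance to \<open>y\<close>. Otherwise the slot is the vertex \<open>i\<close>,
    and the bound \<open>- x f \<le> u\<close> does it.\<close>
  have th: "0 \<le> \<theta>"
  proof -
    have "g = Suc f \<and> y = x f" if "\<not> i < f" "\<not> g \<le> i"
    proof -
      have "g = Suc f" using that fg by linarith
      with y show ?thesis by simp
    qed
    then consider "i < f" | "g \<le> i" | "g = Suc f" "y = x f" by blast
    then show ?thesis
    proof cases
      case 1
      then have "- x i + psum s (Suc i) / min_cap I i f \<le> u" using s(2) by (simp add: left_feasible_def)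
      moreover have "x i \<le> x (g - 1)" using 1 fg by (intro x_le) auto
      ultimately show ?thesis using Q0[of 0 "Suc i" i f] 1 fg i y uv by simp
    next
      case 2
      then have "x i + (psum s (Suc n) - psum s i) / min_cap I (g - 1) i \<le> w" using s(3) i by (simp add: right_feasible_def)
      moreover have "x f \<le> x i" using 2 fg i by (intro x_le) auto
      moreover have "g - 1 < i" using 2 fg by simp
      ultimately show ?thesis using Q0[of i "Suc n" "g - 1" i] i y uv by simp
    next
      case 3
      then show ?thesis using s(2) uv by (auto simp: left_feasible_def)
    qed
  qed
  have quot: "q' / min_cap I a b \<le> q / min_cap I a b + e" if "q' \<le> q + d" "a < b" "b \<le> n" for q q' a b
  proof -
    have c: "0 < min_cap I a b" using that min_cap_pos by simp
    have "q' / min_cap I a b \<le> q / min_cap I a b + d / min_cap I a b"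
      using that(1) c by (simp add: divide_right_mono flip: add_divide_distrib)
    moreover have "d / min_cap I a b \<le> d / m" using cm_m[of a b] that m d c by (intro divide_left_mono) auto
    ultimately show ?thesis using d by simp
  qed
  have "evac_time I y s' \<le> \<theta> + e"
  proof (rule evac_le_closed[OF sl y])
    show "0 \<le> \<theta> + e" using th assms(5) by simp
  next
    fix k assume k: "k < f" "0 < psum s' (Suc k)"
    have "i \<le> k \<or> 0 < psum s (Suc k)"
    proof (rule disjCI)
      assume "\<not> 0 < psum s (Suc k)"
      with k have "psum s (Suc k) \<noteq> psum s' (Suc k)" by simp
      then have "\<not> k < i" using psum_cong[of "Suc k" s s'] k fg by (auto simp: s'_def)
      then show "i \<le> k" by simp
    qed
    then have "- x k + psum s (Suc k) / min_cap I k f \<le> u" using s(2) k by (auto simp: left_feasible_def)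
    moreover have "psum s' (Suc k) / min_cap I k f \<le> psum s (Suc k) / min_cap I k f + e"
      using quot[of "psum s' (Suc k)" "psum s (Suc k)" k f] inc[of 0 "Suc k"] k fg by simp
    ultimately show "y - x k + psum s' (Suc k) / min_cap I k f \<le> \<theta> + e" using uv by simp
  next
    let ?Q = "\<lambda>s l. psum s (Suc n) - psum s l"
    fix l assume l: "g \<le> l" "l \<le> n" "0 < ?Q s' l"
    have "l \<le> i \<or> 0 < ?Q s l"
    proof (rule disjCI)
      assume "\<not> 0 < ?Q s l"
      with l have "?Q s l \<noteq> ?Q s' l" by simp
      then have "\<not> i < l" using psum_cong_diff[of l "Suc n" s s'] l by (auto simp: s'_def)
      then show "l \<le> i" by simp
    qed
    then have "x l + ?Q s l / min_cap I (g - 1) l \<le> w" using s(3) l by (auto simp: right_feasible_def)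
    moreover have "g - 1 < l" using l fg by simp
    then have "?Q s' l / min_cap I (g - 1) l \<le> ?Q s l / min_cap I (g - 1) l + e"
      using quot[of "?Q s' l" "?Q s l" "g - 1" l] inc[of l "Suc n"] l by simp
    ultimately show "x l - y + ?Q s' l / min_cap I (g - 1) l \<le> \<theta> + e" using uv by simp
  qed
  with opt_le[OF yS, of s'] have "opt_evac_time I s' \<le> \<theta> + e" by simp
  moreover have "psum s (Suc i) \<le> psum s' (Suc i)"
    using psum_diff_mono[of 0 "Suc i" s s'] s'(1) i by simp
  then have "psum s (Suc i) / ?C \<le> psum s' (Suc i) / ?C" using C by (simp add: divide_right_mono)
  ultimately have "point_value I i ?C f g u w - e \<le> psum s' (Suc i) / ?C - opt_evac_time I s'"
    unfolding pv \<theta>_def by simp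
  with that[OF sc \<open>0 < s' i\<close>] show ?thesis .
qed

text \<open>Lowering the weights after \<open>i\<close> preserves the prefix up to \<open>i\<close>
  and does not increase any flow. The additional constraints of the closure hold because vertices
  beyond which \<open>i\<close> sends have positive flow under \<open>s\<close>.\<close>

lemma complete:
  assumes "s \<in> scenarios I" "0 < s i" "i \<le> n" "y \<in> sinks I" "0 < C"
  shows "\<exists>f g u w. admissible I i f g u w \<and> psum s (Suc i) / C - evac_time I y s \<le> point_value I i C f g u w"
proof -
  obtain f g where at: "at_slot f g y" using sink_slot assms(4) by blast
  note sl = at_slot_slot[OF at]
  have fg: "f \<le> n" "0 < g" "f \<le> g" using sl by (auto simp: slot_def)
  have box: "lo t \<le> s t" "s t \<le> up t" if "t \<le> n" for t
    using assms(1) that by (auto simp: scenarios_def PiE_def Pi_def)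
  define s' where "s' t = (if t \<le> i then s t else lo t)" for t
  have s'box: "in_box I i s'" using box lo_up by (auto simp: in_box_def s'_def box_top_def)
  have s': "s' t \<le> s t" "0 \<le> s' t" if "t \<le> n" for t
    using box(1)[OF that] lo_nonneg[OF that] by (auto simp: s'_def)
  define \<theta> where "\<theta> = evac_time I y s"
  have expr_val: "0 \<le> \<theta>" "\<And>k. k < f \<Longrightarrow> 0 < psum s (Suc k) \<Longrightarrow> y - x k + psum s (Suc k) / min_cap I k f \<le> \<theta>"
    "\<And>l. g \<le> l \<Longrightarrow> l \<le> n \<Longrightarrow> 0 < psum s (Suc n) - psum s l \<Longrightarrow>
       x l - y + (psum s (Suc n) - psum s l) / min_cap I (g - 1) l \<le> \<theta>"
    using evac_le_iff[OF at, of s \<theta>] by (auto simp: \<theta>_def)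
  have y: "x (g - 1) \<le> y" "y \<le> x f" using at_slot_bounds[OF at] by auto
  have s0: "0 \<le> s t" if "t \<le> n" for t using box(1)[OF that] lo_nonneg[OF that] by simp
  have pos: "0 < psum s b - psum s a" if "a \<le> i" "i < b" "b \<le> Suc n" for a b
  proof -
    have "psum s a \<le> psum s i" "psum s (Suc i) \<le> psum s b"
      using that assms(3) s0 by (auto intro!: psum_mono_idx)
    with assms(2) show ?thesis by (simp add: psum_Suc)
  qed
  have P: "psum s' b - psum s' a \<le> psum s b - psum s a" if "a \<le> b" "b \<le> Suc n" for a b
    using that s'(1) by (intro psum_diff_mono) auto
  have L: "left_feasible I i f s' (\<theta> - y)" unfolding left_feasible_def
  proof (intro conjI allI impI)
    show "- x f \<le> \<theta> - y" using expr_val(1) y by simp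
    fix k assume k: "k < f" "i \<le> k \<or> 0 < psum s' (Suc k)"
    then have "0 < psum s (Suc k)" using pos[of 0 "Suc k"] P[of 0 "Suc k"] fg by auto
    from expr_val(2)[OF k(1) this] have "y - x k + psum s (Suc k) / min_cap I k f \<le> \<theta>" .
    moreover have "psum s' (Suc k) / min_cap I k f \<le> psum s (Suc k) / min_cap I k f"
      using P[of 0 "Suc k"] k min_cap_pos[of k f] fg by (intro divide_right_mono) auto
    ultimately show "- x k + psum s' (Suc k) / min_cap I k f \<le> \<theta> - y" by simp
  qed
  have R: "right_feasible I i g s' (\<theta> + y)" unfolding right_feasible_def
  proof (intro conjI allI impI)
    show "x (g - 1) \<le> \<theta> + y" using expr_val(1) y by simp
    let ?Q = "\<lambda>s l. psum s (Suc n) - psum s l"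
    fix l assume l: "g \<le> l \<and> l \<le> n \<and> (l \<le> i \<or> 0 < ?Q s' l)"
    then have "0 < ?Q s l" using pos[of l "Suc n"] P[of l "Suc n"] assms(3) by auto
    then have "x l - y + ?Q s l / min_cap I (g - 1) l \<le> \<theta>" using expr_val(3) l by blast
    moreover have "?Q s' l / min_cap I (g - 1) l \<le> ?Q s l / min_cap I (g - 1) l"
      using P[of l "Suc n"] l min_cap_pos_right[OF fg(2), of l] by (intro divide_right_mono) auto
    ultimately show "x l + ?Q s' l / min_cap I (g - 1) l \<le> \<theta> + y" by simp
  qed
  note b = bound[OF sl assms(3) s'box L R]
  have "admissible I i f g (\<theta> - y) (\<theta> + y)" using sl b y by (simp add: admissible_def)
  moreover have "psum s (Suc i) = psum s' (Suc i)" by (intro psum_cong) (simp add: s'_def)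
  then have "psum s (Suc i) / C - \<theta> \<le> point_value I i C f g (\<theta> - y) (\<theta> + y)"
    using in_box_total[OF s'box assms(3)] b(3) assms(5)
    by (auto simp: point_value_def intro!: divide_right_mono)
  ultimately show ?thesis unfolding \<theta>_def by blast
qed

end

section \<open>The program\<close>

abbreviation V :: "nat \<Rightarrow> nexp" where "V a \<equiv> NLoad a (NConst 0)"
abbreviation acc :: rexp where "acc \<equiv> RLoad 100 (NConst 0)"
abbreviation Two :: rexp where "Two \<equiv> RAdd ROne ROne"
abbreviation Or :: "bexp \<Rightarrow> bexp \<Rightarrow> bexp" where "Or a b \<equiv> Not (And (Not a) (Not b))"
abbreviation NLeq :: "nexp \<Rightarrow> nexp \<Rightarrow> bexp" where "NLeq a b \<equiv> Not (NLess b a)"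
abbreviation RLeq :: "rexp \<Rightarrow> rexp \<Rightarrow> bexp" where "RLeq a b \<equiv> Not (RLess b a)"
abbreviation seq_notation (infixr ";;" 60) where "p ;; q \<equiv> Sq p q"

text \<open>All folds share counter 4 and accumulator 100, so none contains another. A table with a
  fold thus has nesting depth two, which leaves two outer loops.\<close>

definition fsum :: "bexp \<Rightarrow> rexp \<Rightarrow> expr" where
  "fsum g e = Fold 100 4 (Pure RZero) (IfE g (Pure (RAdd acc e)) (Pure acc))"
definition fmax :: "rexp \<Rightarrow> bexp \<Rightarrow> rexp \<Rightarrow> expr" where
  "fmax e0 g e = Fold 100 4 (Pure e0) (IfE (And g (RLess acc e)) (Pure e) (Pure acc))"
definition fmin :: "rexp \<Rightarrow> bexp \<Rightarrow> rexp \<Rightarrow> expr" where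
  "fmin e0 g e = Fold 100 4 (Pure e0) (IfE (And g (RLess e acc)) (Pure e) (Pure acc))"
definition fmin2 :: "rexp \<Rightarrow> bexp \<Rightarrow> rexp \<Rightarrow> bexp \<Rightarrow> rexp \<Rightarrow> expr" where
  "fmin2 e0 g e g' e' = Fold 100 4 (Pure e0) (IfE (And g (RLess e acc)) (Pure e)
     (IfE (And g' (RLess e' acc)) (Pure e') (Pure acc)))"
text \<open>Recovers a point at which a maximum computed before is attained: the guard selects the
  maximisers, any of which will do.\<close>

definition flast :: "bexp \<Rightarrow> rexp \<Rightarrow> expr" where
  "flast g e = Fold 100 4 (Pure RZero) (IfE g (Pure e) (Pure acc))"
definition emax :: "rexp \<Rightarrow> rexp \<Rightarrow> expr" where
  "emax a b = IfE (RLess a b) (Pure b) (Pure a)"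

section \<open>Meaning of the folds\<close>

lemma store_of_simps [simp]: "narr (store_of env h) a i = env a" "rarr (store_of env h) = h"
  by (simp_all add: store_of_def)

lemma tab_val: "k \<le> env 0 \<Longrightarrow> run_stmt (Tab X v e) env h X k = expr_val e (env(v := k)) h"
  and tab_other: "b \<noteq> X \<Longrightarrow> run_stmt (Tab X v e) env h b = h b"
  by simp_all

lemma rval_acc: "rexp_ok UNIV {..<100} e \<Longrightarrow> rval e (store_of env (h(100 := y))) = rval e (store_of env h)"
  by (rule rexp_ok_cong[of UNIV "{..<100}"]) (auto simp: agree_def)

lemma bval_acc: "bexp_ok UNIV {..<100} e \<Longrightarrow> bval e (store_of env (h(100 := y))) = bval e (store_of env h)"
  by (rule bexp_ok_cong[of UNIV "{..<100}"]) (auto simp: agree_def)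

lemma Collect_less_Suc: "{k. k < Suc m \<and> P k} = (if P m then insert m {k. k < m \<and> P k} else {k. k < m \<and> P k})"
  by (auto simp: less_Suc_eq)

lemma fold_max:
  fixes e :: "nat \<Rightarrow> real"
  shows "fold (\<lambda>k y. if P k \<and> y < e k then e k else y) [0..<m] y0 = Max (insert y0 (e ` {k. k < m \<and> P k}))"
proof (induction m)
  case (Suc m)
  let ?S = "e ` {k. k < m \<and> P k}"
  define M where "M = Max (insert y0 ?S)"
  have "Max (insert y0 (insert (e m) ?S)) = max (e m) M"
    unfolding M_def by (subst insert_commute, subst Max_insert) auto
  moreover have "fold (\<lambda>k y. if P k \<and> y < e k then e k else y) [0..<Suc m] y0 = (if P m then max (e m) M else M)"
    using Suc.IH by (simp add: M_def[symmetric] max_def)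
  ultimately show ?case unfolding Collect_less_Suc by (simp add: M_def[symmetric])
qed simp

text \<open>Since the guards exclude each other, the nested conditional never has to choose between
  two updates in one round.\<close>

lemma fold_min2:
  fixes e :: "nat \<Rightarrow> real"
  assumes "\<And>k. \<not> (P k \<and> P' k)"
  shows "fold (\<lambda>k y. if P k \<and> e k < y then e k else if P' k \<and> e' k < y then e' k else y) [0..<m] y0 =
    Min (insert y0 (e ` {k. k < m \<and> P k} \<union> e' ` {k. k < m \<and> P' k}))"
proof (induction m)
  case (Suc m)
  let ?S = "e ` {k. k < m \<and> P k} \<union> e' ` {k. k < m \<and> P' k}"
  define M where "M = Min (insert y0 ?S)"
  have *: "Min (insert y0 (insert x ?S)) = min x M" for x
    unfolding M_def by (subst insert_commute, subst Min_insert) auto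
  have "fold (\<lambda>k y. if P k \<and> e k < y then e k else if P' k \<and> e' k < y then e' k else y) [0..<Suc m] y0 =
      (if P m then min (e m) M else if P' m then min (e' m) M else M)"
    using assms[of m] Suc.IH by (auto simp: M_def[symmetric] min_def)
  also have "\<dots> = Min (insert y0 (e ` {k. k < Suc m \<and> P k} \<union> e' ` {k. k < Suc m \<and> P' k}))"
  proof -
    consider "P m" "\<not> P' m" | "\<not> P m" "P' m" | "\<not> P m" "\<not> P' m" using assms[of m] by blast
    then show ?thesis unfolding Collect_less_Suc by cases (simp_all add: * M_def[symmetric])
  qed
  finally show ?case .
qed simp

lemma fold_min:
  fixes e :: "nat \<Rightarrow> real"
  shows "fold (\<lambda>k y. if P k \<and> e k < y then e k else y) [0..<m] y0 = Min (insert y0 (e ` {k. k < m \<and> P k}))"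
proof -
  have "(\<lambda>k y. if P k \<and> e k < y then e k else y) =
    (\<lambda>k y. if P k \<and> e k < y then e k else if False \<and> e k < y then e k else y)" by (auto simp: fun_eq_iff)
  then show ?thesis using fold_min2[of P "\<lambda>_. False" e e m y0] by simp
qed

lemma fold_sum:
  fixes e :: "nat \<Rightarrow> real"
  shows "fold (\<lambda>k y. if P k then y + e k else y) [0..<m] y0 = y0 + (\<Sum>k\<in>{k. k < m \<and> P k}. e k)"
proof (induction m)
  case (Suc m)
  have "{k. k < Suc m \<and> P k} = (if P m then insert m {k. k < m \<and> P k} else {k. k < m \<and> P k})"
    by (auto simp: less_Suc_eq)
  with Suc show ?case by simp
qed simp

lemma fold_last:
  fixes e :: "nat \<Rightarrow> real"
  assumes "\<exists>k<m. P k"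
  shows "\<exists>k<m. P k \<and> fold (\<lambda>k y. if P k then e k else y) [0..<m] y0 = e k"
  using assms
proof (induction m)
  case (Suc m)
  show ?case
  proof (cases "P m")
    case False
    then have "\<exists>k<m. P k" using Suc.prems by (auto simp: less_Suc_eq)
    with Suc.IH False show ?thesis by (auto simp: less_Suc_eq)
  qed auto
qed simp

abbreviation rexp_plain :: "rexp \<Rightarrow> bool" where "rexp_plain \<equiv> rexp_ok UNIV {..<100}"
abbreviation bexp_plain :: "bexp \<Rightarrow> bool" where "bexp_plain \<equiv> bexp_ok UNIV {..<100}"

lemma expr_val_fmax: "rexp_plain e \<Longrightarrow> bexp_plain g \<Longrightarrow> expr_val (fmax e0 g e) env h =
    Max (insert (rval e0 (store_of env h)) ((\<lambda>k. rval e (store_of (env(4 := k)) h)) ` {k. k \<le> env 0 \<and> bval g (store_of (env(4 := k)) h)}))"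
  by (simp add: fmax_def rval_acc bval_acc fold_max less_Suc_eq_le del: upt_Suc cong: if_cong)

lemma expr_val_fmin: "rexp_plain e \<Longrightarrow> bexp_plain g \<Longrightarrow> expr_val (fmin e0 g e) env h =
    Min (insert (rval e0 (store_of env h)) ((\<lambda>k. rval e (store_of (env(4 := k)) h)) ` {k. k \<le> env 0 \<and> bval g (store_of (env(4 := k)) h)}))"
  by (simp add: fmin_def rval_acc bval_acc fold_min less_Suc_eq_le del: upt_Suc cong: if_cong)

lemma expr_val_fmin2: "rexp_plain e \<Longrightarrow> bexp_plain g \<Longrightarrow> rexp_plain e' \<Longrightarrow> bexp_plain g' \<Longrightarrow>
    (\<And>k. \<not> (bval g (store_of (env(4 := k)) h) \<and> bval g' (store_of (env(4 := k)) h))) \<Longrightarrow>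
    expr_val (fmin2 e0 g e g' e') env h =
    Min (insert (rval e0 (store_of env h))
      ((\<lambda>k. rval e (store_of (env(4 := k)) h)) ` {k. k \<le> env 0 \<and> bval g (store_of (env(4 := k)) h)} \<union>
       (\<lambda>k. rval e' (store_of (env(4 := k)) h)) ` {k. k \<le> env 0 \<and> bval g' (store_of (env(4 := k)) h)}))"
  by (simp add: fmin2_def rval_acc bval_acc fold_min2 less_Suc_eq_le del: upt_Suc cong: if_cong)

lemma expr_val_fsum: "rexp_plain e \<Longrightarrow> bexp_plain g \<Longrightarrow> expr_val (fsum g e) env h =
    (\<Sum>k\<in>{k. k \<le> env 0 \<and> bval g (store_of (env(4 := k)) h)}. rval e (store_of (env(4 := k)) h))"
  by (simp add: fsum_def rval_acc bval_acc fold_sum less_Suc_eq_le del: upt_Suc cong: if_cong)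

lemma expr_val_flast: "rexp_plain e \<Longrightarrow> bexp_plain g \<Longrightarrow> \<exists>k\<le>env 0. bval g (store_of (env(4 := k)) h) \<Longrightarrow>
    \<exists>k\<le>env 0. bval g (store_of (env(4 := k)) h) \<and> expr_val (flast g e) env h = rval e (store_of (env(4 := k)) h)"
  using fold_last[of "Suc (env 0)" "\<lambda>k. bval g (store_of (env(4 := k)) h)" "\<lambda>k. rval e (store_of (env(4 := k)) h)" 0]
  by (simp add: flast_def rval_acc bval_acc less_Suc_eq_le del: upt_Suc cong: if_cong)

lemma expr_val_emax: "expr_val (emax a b) env h = max (rval a (store_of env h)) (rval b (store_of env h))"
  by (simp add: emax_def)

lemma ForS_rule:
  assumes "P 0 h" "\<And>k h. k \<le> env 0 \<Longrightarrow> P k h \<Longrightarrow> P (Suc k) (run_stmt p (env(v := k)) h)"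
  shows "P (Suc (env 0)) (run_stmt (ForS v p) env h)"
proof -
  have "k \<le> Suc (env 0) \<Longrightarrow> P k (fold (\<lambda>k. run_stmt p (env(v := k))) [0..<k] h)" for k
    using assms by (induction k) auto
  from this[of "Suc (env 0)"] show ?thesis by simp
qed

text \<open>Real arrays \<open>11\<close> to \<open>13\<close> depend on the vertex \<open>i\<close>, arrays \<open>20\<close> to \<open>27\<close> on the left side of a slot,
  arrays \<open>30\<close> to \<open>38\<close> on its right side. A scalar is stored in all cells of an array.

  Counters: \<open>1\<close> is the vertex \<open>i\<close>, \<open>2\<close> the slot index \<open>f\<close>, \<open>3\<close> the index of a table and \<open>4\<close>
  that of a fold.\<close>

definition p_cands :: "nat \<Rightarrow> nat \<Rightarrow> nat \<Rightarrow> nat \<Rightarrow> nat \<Rightarrow> nat \<Rightarrow> stmt" where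
  "p_cands Z C T U HI K =
    (let flat = (\<lambda>m. RAdd (RLoad Z (V 3)) (RDiv (RSub (RLoad T m) (RLoad T (V 3))) (RLoad C (V 3))));
         line = RDiv (RSub (RAdd (RSub (RLoad T (V 4)) (RLoad T (V 3))) (RMul (RLoad Z (V 3)) (RLoad C (V 3))))
                 (RMul (RLoad Z (V 4)) (RLoad C (V 4)))) (RSub (RLoad C (V 3)) (RLoad C (V 4)))
     in Tab HI 3 (fmin2 (flat (V 0))
           (And (NLess (V 3) (V 4)) (RLess (flat (V 4)) (RLoad Z (V 4)))) (flat (V 4))
           (And (NLess (V 3) (V 4)) (And (RLeq (RLoad Z (V 4)) (flat (V 4))) (RLess (RLoad C (V 4)) (RLoad C (V 3))))) line) ;;
        Tab K 3 (IfE (And (RLess RZero (RLoad C (V 3))) (RLess (RLoad U (V 3)) (RLoad HI (V 3))))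
           (Pure (RLoad HI (V 3))) (Pure (RLoad U (V 3)))))"

text \<open>The maximum inside a hinge becomes a distinction by the sign of the rising term. The
  start value is hinge \<open>n\<close>, which is constant because its slope is 0.\<close>

definition p_hmin :: "nat \<Rightarrow> nat \<Rightarrow> nat \<Rightarrow> rexp \<Rightarrow> nat \<Rightarrow> stmt" where
  "p_hmin Z C T u A =
    (let d = RMul (RSub u (RLoad Z (V 4))) (RLoad C (V 4))
     in Tab A 3 (fmin2 (RLoad T (V 0)) (RLess RZero d) (RAdd (RLoad T (V 4)) d)
          (RLeq d RZero) (RLoad T (V 4))))"

definition p_left :: "nat \<Rightarrow> nat \<Rightarrow> nat \<Rightarrow> stmt" where
  "p_left X Cp Lo =
    (let k = NSub (V 2) (NAdd (V 3) (NConst 1))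
     in Tab 20 3 (Pure (RSub RZero (RLoad X k))) ;;
        Tab 21 3 (IfE (NLess (V 3) (V 2))
          (fmin (RLoad Cp (NSub (V 2) (NConst 1))) (And (NLeq k (V 4)) (NLess (V 4) (V 2))) (RLoad Cp (V 4)))
          (Pure RZero)) ;;
        Tab 22 3 (fsum (And (NLeq (NSub (V 2) (V 3)) (V 4)) (NLess (V 4) (V 2))) (RLoad 11 (V 4))) ;;
        Tab 23 3 (fsum (NLess (V 4) (NSub (V 2) (V 3))) (RLoad Lo (V 4))) ;;
        Tab 24 3 (fmax (RSub RZero (RLoad X (V 2)))
          (And (NLess (V 4) (V 2)) (Or (NLess (NAdd (V 1) (V 4)) (V 2)) (RLess RZero (RLoad 23 (V 4)))))
          (RAdd (RLoad 20 (V 4)) (RDiv (RLoad 23 (V 4)) (RLoad 21 (V 4))))) ;;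
        p_cands 20 21 22 24 25 26 ;;
        p_hmin 20 21 22 (RLoad 26 (V 3)) 27)"

definition p_right :: "nat \<Rightarrow> nat \<Rightarrow> nat \<Rightarrow> nexp \<Rightarrow> stmt" where
  "p_right X Cp Lo g =
    (let l = NAdd g (V 3); l' = NAdd g (V 4)
     in Tab 30 3 (Pure (RLoad X l)) ;;
        Tab 31 3 (fmin (RLoad Cp (NSub g (NConst 1))) (And (NLeq (NSub g (NConst 1)) (V 4)) (NLess (V 4) l)) (RLoad Cp (V 4))) ;;
        Tab 32 3 (IfE (NLess (V 1) l) (Pure RZero) (Pure (RLoad 31 (V 3)))) ;;
        Tab 33 3 (fsum (And (NLeq g (V 4)) (Or (NLess (V 4) l) (NLess (V 1) l))) (RLoad 11 (V 4))) ;;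
        Tab 34 3 (fsum (NLeq l (V 4)) (RLoad Lo (V 4))) ;;
        Tab 35 3 (fmax (RLoad X (NSub g (NConst 1)))
          (And (NLeq l' (V 0)) (Or (NLeq l' (V 1)) (RLess RZero (RLoad 34 (V 4)))))
          (RAdd (RLoad 30 (V 4)) (RDiv (RLoad 34 (V 4)) (RLoad 31 (V 4))))) ;;
        p_cands 30 32 33 35 36 37 ;;
        p_hmin 30 32 33 (RLoad 37 (V 3)) 38)"

text \<open>The table index is the vertex \<open>v\<close> that fixes
  \<open>C = min_cap I i v\<close>, the fold index a left candidate. For each \<open>v\<close>,
  array 40 holds the best right value and 41 a point attaining it. The new result passes through 42
  because a table may not read itself. The guard excludes \<open>f = 0\<close>, where no edge slot
  exists.\<close>

definition p_edge :: "nat \<Rightarrow> nat \<Rightarrow> nat \<Rightarrow> stmt" where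
  "p_edge X Hi RES =
    (let val = (\<lambda>m. RSub (RDiv (RLoad 38 m) (RLoad 12 (V 3))) (RDiv (RLoad 37 m) Two));
         d = RSub (RLoad 41 (V 3)) (RLoad 26 (V 4))
     in Tab 40 3 (fmax (val (NConst 0)) (NLess (NConst 0) (NConst 1)) (val (V 4))) ;;
        Tab 41 3 (flast (RLeq (RLoad 40 (V 3)) (val (V 4))) (RLoad 37 (V 4))) ;;
        Tab 42 3 (fmax (RLoad RES (V 3))
          (And (NLess (V 1) (V 3)) (And (RLess RZero (RLoad Hi (V 1))) (And (NLess (NConst 0) (V 2))
            (And (RLeq (RMul Two (RLoad X (NSub (V 2) (NConst 1)))) d) (RLeq d (RMul Two (RLoad X (V 2))))))))
          (RSub (RAdd (RSub (RDiv (RSub (RLoad 27 (V 4)) (RLoad 13 (NConst 0))) (RLoad 12 (V 3))) (RDiv (RLoad 26 (V 4)) Two))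
             (RLoad 40 (V 3))) (RLoad X (V 1)))) ;;
        Tab RES 3 (Pure (RLoad 42 (V 3))))"

definition p_update :: "nat \<Rightarrow> nat \<Rightarrow> nat \<Rightarrow> rexp \<Rightarrow> stmt" where
  "p_update X Hi RES th =
     Tab 44 3 (emax (RLoad 43 (V 3)) th) ;;
     p_hmin 20 21 22 (RSub (RLoad 44 (V 3)) (RLoad X (V 2))) 45 ;;
     p_hmin 30 32 33 (RAdd (RLoad 44 (V 3)) (RLoad X (V 2))) 46 ;;
     Tab 42 3 (fmax (RLoad RES (V 3)) (And (NLess (V 1) (V 3)) (RLess RZero (RLoad Hi (V 1))))
       (RSub (RSub (RDiv (RSub (RAdd (RAdd (RLoad 45 (V 4)) (RLoad 46 (V 4))) (RLoad 11 (V 2))) (RLoad 13 (NConst 0)))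
          (RLoad 12 (V 3))) (RLoad 44 (V 4))) (RLoad X (V 1)))) ;;
     Tab RES 3 (Pure (RLoad 42 (V 3)))"

definition p_vertex :: "nat \<Rightarrow> nat \<Rightarrow> nat \<Rightarrow> stmt" where
  "p_vertex X Hi RES =
     Tab 43 3 (emax (RAdd (RLoad 24 (V 3)) (RLoad X (V 2))) (RSub (RLoad 35 (V 3)) (RLoad X (V 2)))) ;;
     p_update X Hi RES (RAdd (RLoad 26 (V 3)) (RLoad X (V 2))) ;;
     p_update X Hi RES (RSub (RLoad 37 (V 3)) (RLoad X (V 2)))"

definition p_tabs :: "nat \<Rightarrow> nat \<Rightarrow> nat \<Rightarrow> stmt" where
  "p_tabs Cp Lo Hi =
     Tab 11 3 (IfE (NLess (V 1) (V 3)) (Pure (RLoad Lo (V 3))) (Pure (RLoad Hi (V 3)))) ;;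
     Tab 12 3 (fmin (RLoad Cp (V 1)) (And (NLeq (V 1) (V 4)) (NLess (V 4) (V 3))) (RLoad Cp (V 4))) ;;
     Tab 13 3 (fsum (NLess (V 1) (V 4)) (RLoad Lo (V 4)))"

text \<open>The edge slot \<open>(f, f)\<close> and the vertex slot \<open>(f, Suc f)\<close> have
  the same left vertices, so the left tables serve both; the right tables are rebuilt in
  between.\<close>

definition p_slot :: "nat \<Rightarrow> nat \<Rightarrow> nat \<Rightarrow> nat \<Rightarrow> nat \<Rightarrow> stmt" where
  "p_slot X Cp Lo Hi RES =
     p_left X Cp Lo ;;
     p_right X Cp Lo (V 2) ;; p_edge X Hi RES ;;
     p_right X Cp Lo (NAdd (V 2) (NConst 1)) ;; p_vertex X Hi RES"

text \<open>The start value is neutral: a sink \<open>y\<close> whose left vertices are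
  \<open>{..<v}\<close> satisfies \<open>y \<le> x v\<close>, so with \<open>R v = - x v\<close> the
  regret \<open>max 0 (y + R v)\<close> is 0.\<close>

definition p_side :: "nat \<Rightarrow> nat \<Rightarrow> nat \<Rightarrow> nat \<Rightarrow> nat \<Rightarrow> stmt" where
  "p_side X Cp Lo Hi RES =
     Tab RES 3 (Pure (RSub RZero (RLoad X (V 3)))) ;;
     ForS 1 (p_tabs Cp Lo Hi ;; ForS 2 (p_slot X Cp Lo Hi RES))"

section \<open>Verification of the blocks of the program\<close>

lemma cands_block:
  fixes z c t :: "nat \<Rightarrow> real"
  assumes "env 0 = n" "\<And>m. m \<le> n \<Longrightarrow> h Z m = z m" "\<And>m. m \<le> n \<Longrightarrow> h C m = c m" "\<And>m. m \<le> n \<Longrightarrow> h T m = t m"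
    "\<And>m. m \<le> n \<Longrightarrow> h U m = u"
    and ids: "Z < 100" "C < 100" "T < 100" "HI < 100" "HI \<noteq> Z" "HI \<noteq> C" "HI \<noteq> U" "K \<noteq> HI"
  defines "h' \<equiv> run_stmt (p_cands Z C T U HI K) env h"
  shows "m \<le> n \<Longrightarrow> h' K m = cand n z c t u m" "b \<noteq> HI \<Longrightarrow> b \<noteq> K \<Longrightarrow> h' b = h b"
proof -
  define h1 where "h1 = run_stmt (Tab HI 3 (fmin2 (RAdd (RLoad Z (V 3)) (RDiv (RSub (RLoad T (V 0)) (RLoad T (V 3))) (RLoad C (V 3))))
      (And (NLess (V 3) (V 4)) (RLess (RAdd (RLoad Z (V 3)) (RDiv (RSub (RLoad T (V 4)) (RLoad T (V 3))) (RLoad C (V 3)))) (RLoad Z (V 4))))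
      (RAdd (RLoad Z (V 3)) (RDiv (RSub (RLoad T (V 4)) (RLoad T (V 3))) (RLoad C (V 3))))
      (And (NLess (V 3) (V 4)) (And (RLeq (RLoad Z (V 4)) (RAdd (RLoad Z (V 3)) (RDiv (RSub (RLoad T (V 4)) (RLoad T (V 3))) (RLoad C (V 3)))))
         (RLess (RLoad C (V 4)) (RLoad C (V 3)))))
      (RDiv (RSub (RAdd (RSub (RLoad T (V 4)) (RLoad T (V 3))) (RMul (RLoad Z (V 3)) (RLoad C (V 3))))
                 (RMul (RLoad Z (V 4)) (RLoad C (V 4)))) (RSub (RLoad C (V 3)) (RLoad C (V 4)))))) env h"
  have h1: "h1 HI a = line_exit n z c t a" if a: "a \<le> n" for a
  proof -
    let ?h = "h1 HI a"
    have "?h = Min (insert (z a + (t n - t a) / c a)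
      ((\<lambda>m. z a + (t m - t a) / c a) ` {m. m \<le> n \<and> a < m \<and> z a + (t m - t a) / c a < z m} \<union>
       (\<lambda>m. (t m - t a + z a * c a - z m * c m) / (c a - c m)) `
         {m. m \<le> n \<and> a < m \<and> \<not> z a + (t m - t a) / c a < z m \<and> c m < c a}))"
      unfolding h1_def using a assms(1) ids
      by (subst tab_val, simp, subst expr_val_fmin2; simp)
        (intro arg_cong[where f = Min] arg_cong2[where f = insert] arg_cong2[where f = "(\<union>)"] image_cong,
          auto simp: assms(2-4))
    also have "\<dots> = line_exit n z c t a"
      unfolding line_exit_def crossings_def flat_crossing_def line_crossing_def by (simp add: setcompr_eq_image)
    finally show ?thesis .
  qed
  have o: "h1 b = h b" if "b \<noteq> HI" for b using that by (simp add: h1_def)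
  have e: "h' = run_stmt (Tab K 3 (IfE (And (RLess RZero (RLoad C (V 3))) (RLess (RLoad U (V 3)) (RLoad HI (V 3))))
           (Pure (RLoad HI (V 3))) (Pure (RLoad U (V 3))))) env h1"
    unfolding h'_def h1_def p_cands_def Let_def by simp
  show "m \<le> n \<Longrightarrow> h' K m = cand n z c t u m"
    unfolding e using assms(1) ids by (simp add: h1 o assms(3,5) cand_def)
  show "b \<noteq> HI \<Longrightarrow> b \<noteq> K \<Longrightarrow> h' b = h b" unfolding e by (simp add: o)
qed

lemma hmin_block:
  fixes z c t :: "nat \<Rightarrow> real" and A :: nat
  assumes "env 0 = n" "\<And>m. m \<le> n \<Longrightarrow> h Z m = z m" "\<And>m. m \<le> n \<Longrightarrow> h C m = c m" "\<And>m. m \<le> n \<Longrightarrow> h T m = t m"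
    "\<And>a m. a \<le> n \<Longrightarrow> rval e (store_of (env(3 := a, 4 := m)) h) = u a" "c n = 0"
    and ids: "Z < 100" "C < 100" "T < 100" "rexp_plain e"
  defines "h' \<equiv> run_stmt (p_hmin Z C T e A) env h"
  shows "a \<le> n \<Longrightarrow> h' A a = hmin n z c t (u a)" "b \<noteq> A \<Longrightarrow> h' b = h b"
proof -
  assume a: "a \<le> n"
  have "h' A a = Min (insert (t n)
      ((\<lambda>m. t m + (u a - z m) * c m) ` {m. m \<le> n \<and> 0 < (u a - z m) * c m} \<union>
       t ` {m. m \<le> n \<and> \<not> 0 < (u a - z m) * c m}))"
    unfolding h'_def p_hmin_def Let_def using a assms(1) ids
    by (subst tab_val, simp, subst expr_val_fmin2; simp add: assms(5))
      (intro arg_cong[where f = Min] arg_cong2[where f = insert] arg_cong2[where f = "(\<union>)"] image_cong,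
        auto simp: assms(2-4))
  also have "insert (t n) ((\<lambda>m. t m + (u a - z m) * c m) ` {m. m \<le> n \<and> 0 < (u a - z m) * c m} \<union>
       t ` {m. m \<le> n \<and> \<not> 0 < (u a - z m) * c m}) = (\<lambda>j. hinge z c t j (u a)) ` {..n}" (is "?L = ?R")
  proof
    show "?L \<subseteq> ?R"
    proof
      fix y assume "y \<in> ?L"
      then consider "y = t n" | m where "m \<le> n" "0 < (u a - z m) * c m" "y = t m + (u a - z m) * c m"
        | m where "m \<le> n" "\<not> 0 < (u a - z m) * c m" "y = t m" by auto
      then show "y \<in> ?R"
        by cases (rule image_eqI[of _ _ n] image_eqI, auto simp: hinge_def assms(6))+
    qed
    show "?R \<subseteq> ?L"
    proof
      fix y assume "y \<in> ?R"
      then obtain m where m: "m \<le> n" "y = hinge z c t m (u a)" by auto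
      show "y \<in> ?L"
      proof (cases "0 < (u a - z m) * c m")
        case True
        then have "y = t m + (u a - z m) * c m" using m by (simp add: hinge_def)
        with True m(1) show ?thesis by blast
      next
        case False
        then have "y = t m" using m by (simp add: hinge_def)
        with False m(1) show ?thesis by blast
      qed
    qed
  qed
  finally show "h' A a = hmin n z c t (u a)" by (simp add: hmin_def)
next
  show "b \<noteq> A \<Longrightarrow> h' b = h b" unfolding h'_def p_hmin_def Let_def by simp
qed

lemma sum_range:
  assumes "a \<le> b" "b \<le> Suc n"
  shows "(\<Sum>k\<in>{k. k \<le> n \<and> a \<le> k \<and> k < b}. s k) = psum s b - psum s a"
proof -
  have "{k. k \<le> n \<and> a \<le> k \<and> k < b} = {a..<b}" using assms by auto
  moreover have "(\<Sum>k\<in>{a..<b}. s k) = psum s b - psum s a"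
    using assms(1) by (induction b rule: dec_induct) (simp_all add: psum_Suc)
  ultimately show ?thesis by simp
qed

lemma sum_cong_eq:
  assumes "\<And>k. k \<le> n \<Longrightarrow> P k \<longleftrightarrow> a \<le> k \<and> k < b" "\<And>k. k \<le> n \<Longrightarrow> P k \<Longrightarrow> f k = s k" "a \<le> b" "b \<le> Suc n"
  shows "(\<Sum>k\<in>{k. k \<le> n \<and> P k}. f k) = psum s b - psum s a"
proof -
  have "{k. k \<le> n \<and> P k} = {k. k \<le> n \<and> a \<le> k \<and> k < b}" using assms(1) by auto
  then have "(\<Sum>k\<in>{k. k \<le> n \<and> P k}. f k) = (\<Sum>k\<in>{k. k \<le> n \<and> a \<le> k \<and> k < b}. s k)"
    using assms(2) by (intro sum.cong) auto
  with sum_range[OF assms(3,4)] show ?thesis by simp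
qed

text \<open>The program starts its fold with the capacity of an edge \<open>c0\<close> in the range,
  which leaves the minimum unchanged.\<close>

lemma Min_cap_image:
  assumes "\<And>k. k \<le> n \<Longrightarrow> P k \<longleftrightarrow> a \<le> k \<and> k < b" "a < b" "b \<le> Suc n" "a \<le> c0" "c0 < b"
  shows "Min (insert (cap I c0) (cap I ` {k. k \<le> n \<and> P k})) = min_cap I a b"
proof -
  have "{k. k \<le> n \<and> P k} = {a..<b}" using assms by auto
  then show ?thesis unfolding min_cap_def using assms(4,5) by (simp add: insert_absorb)
qed

context path
begin

lemma left_block:
  assumes env: "env 0 = n" "env 1 = i" "env 2 = f" "i \<le> n" "f \<le> n"
    and inp: "X < 11" "Cp < 11" "Lo < 11" "h X = pos I" "h Cp = cap I" "h Lo = wlo I"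
    and box_top: "\<And>t. t \<le> n \<Longrightarrow> h 11 t = box_top I i t"
  defines "h' \<equiv> run_stmt (p_left X Cp Lo) env h"
  shows "m \<le> n \<Longrightarrow> h' 20 m = zL I f m" "m \<le> n \<Longrightarrow> h' 21 m = cL I f m" "m \<le> n \<Longrightarrow> h' 22 m = tL I i f m"
    "m \<le> n \<Longrightarrow> h' 24 m = umin I i f" "m \<le> n \<Longrightarrow> h' 26 m = lcand I i f m"
    "m \<le> n \<Longrightarrow> h' 27 m = left_max I i f (lcand I i f m)"
    "b \<notin> {20..27} \<Longrightarrow> h' b = h b"
proof -
  let ?k = "NSub (V 2) (NAdd (V 3) (NConst 1))"
  have env1: "env (Suc 0) = i" using env by simp
  define h0 where "h0 = run_stmt (Tab 20 3 (Pure (RSub RZero (RLoad X ?k)))) env h"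
  define h1 where "h1 = run_stmt (Tab 21 3 (IfE (NLess (V 3) (V 2))
          (fmin (RLoad Cp (NSub (V 2) (NConst 1))) (And (NLeq ?k (V 4)) (NLess (V 4) (V 2))) (RLoad Cp (V 4)))
          (Pure RZero))) env h0"
  define h2 where "h2 = run_stmt (Tab 22 3 (fsum (And (NLeq (NSub (V 2) (V 3)) (V 4)) (NLess (V 4) (V 2))) (RLoad 11 (V 4)))) env h1"
  define h3 where "h3 = run_stmt (Tab 23 3 (fsum (NLess (V 4) (NSub (V 2) (V 3))) (RLoad Lo (V 4)))) env h2"
  define h4 where "h4 = run_stmt (Tab 24 3 (fmax (RSub RZero (RLoad X (V 2)))
          (And (NLess (V 4) (V 2)) (Or (NLess (NAdd (V 1) (V 4)) (V 2)) (RLess RZero (RLoad 23 (V 4)))))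
          (RAdd (RLoad 20 (V 4)) (RDiv (RLoad 23 (V 4)) (RLoad 21 (V 4)))))) env h3"
  define h5 where "h5 = run_stmt (p_cands 20 21 22 24 25 26) env h4"
  have h': "h' = run_stmt (p_hmin 20 21 22 (RLoad 26 (V 3)) 27) env h5"
    unfolding h'_def p_left_def Let_def h5_def h4_def h3_def h2_def h1_def h0_def by (simp only: run_stmt.simps)
  have o0: "b \<noteq> 20 \<Longrightarrow> h0 b = h b" for b unfolding h0_def by (rule tab_other)
  have o1: "b \<noteq> 21 \<Longrightarrow> h1 b = h0 b" for b unfolding h1_def by (rule tab_other)
  have o2: "b \<noteq> 22 \<Longrightarrow> h2 b = h1 b" for b unfolding h2_def by (rule tab_other)
  have o3: "b \<noteq> 23 \<Longrightarrow> h3 b = h2 b" for b unfolding h3_def by (rule tab_other)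
  have o4: "b \<noteq> 24 \<Longrightarrow> h4 b = h3 b" for b unfolding h4_def by (rule tab_other)
  note o = o0 o1 o2 o3 o4
  have z: "h0 20 m = zL I f m" if "m \<le> n" for m
    unfolding h0_def using that env inp by (subst tab_val) (simp_all add: zL_def)
  have c: "h1 21 m = cL I f m" if "m \<le> n" for m
  proof (cases "m < f")
    case True
    have "h1 21 m = Min (insert (cap I (f - 1)) (cap I ` {k. k \<le> n \<and> \<not> k < f - Suc m \<and> k < f}))"
      unfolding h1_def using that True env env1 inp by (subst tab_val, simp) (simp add: expr_val_fmin o)
    also have "\<dots> = min_cap I (f - (m + 1)) f"
      using True env by (intro Min_cap_image) auto
    finally show ?thesis using True by (simp add: cL_def)
  next
    case False
    then show ?thesis unfolding h1_def using that env env1 inp by (subst tab_val) (simp_all add: cL_def)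
  qed
  have t: "h2 22 m = tL I i f m" if "m \<le> n" for m
  proof -
    have "h2 22 m = (\<Sum>k\<in>{k. k \<le> n \<and> (\<not> k < f - m \<and> k < f)}. h1 11 k)"
      unfolding h2_def using that env inp by (subst tab_val, simp) (simp add: expr_val_fsum)
    also have "\<dots> = tL I i f m" unfolding tL_def
      using env by (intro sum_cong_eq) (auto simp: o box_top)
    finally show ?thesis .
  qed
  have l: "h3 23 m = lL I f m" if "m \<le> n" for m
  proof -
    have "h3 23 m = (\<Sum>k\<in>{k. k \<le> n \<and> k < f - m}. h2 Lo k)"
      unfolding h3_def using that env inp by (subst tab_val, simp) (simp add: expr_val_fsum)
    also have "\<dots> = psum lo (f - m) - psum lo 0"
      using env inp by (intro sum_cong_eq) (auto simp: o)
    finally show ?thesis by (simp add: lL_def)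
  qed
  have u: "h4 24 m = umin I i f" if "m \<le> n" for m
  proof -
    have "h4 24 m = Max (insert (- pos I f) ((\<lambda>k. h3 20 k + h3 23 k / h3 21 k) `
        {k. k \<le> n \<and> k < f \<and> (i + k < f \<or> 0 < h3 23 k)}))"
      unfolding h4_def using that env env1 inp by (subst tab_val, simp) (simp add: expr_val_fmax o disj_imp)
    also have "(\<lambda>k. h3 20 k + h3 23 k / h3 21 k) ` {k. k \<le> n \<and> k < f \<and> (i + k < f \<or> 0 < h3 23 k)} =
       (\<lambda>m. zL I f m + lL I f m / cL I f m) ` {m. m \<le> n \<and> m < f \<and> (i + m < f \<or> 0 < lL I f m)}"
      by (intro image_cong) (auto simp: o z c l)
    finally show ?thesis by (simp add: umin_def)
  qed
  have 4: "m \<le> n \<Longrightarrow> h4 20 m = zL I f m" "m \<le> n \<Longrightarrow> h4 21 m = cL I f m" "m \<le> n \<Longrightarrow> h4 22 m = tL I i f m"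
    "m \<le> n \<Longrightarrow> h4 24 m = umin I i f" for m by (simp_all add: o z c t u)
  have k: "h5 26 m = lcand I i f m" if "m \<le> n" for m
    unfolding h5_def lcand_def
    by (rule cands_block(1)[where Z = 20 and C = 21 and T = 22 and U = 24 and HI = 25 and K = 26 and env = env and n = n and h = h4
      and z = "zL I f" and c = "cL I f" and t = "tL I i f" and u = "umin I i f", OF env(1) 4]) (use that in simp_all)
  have o5: "h5 b = h4 b" if "b \<noteq> 25" "b \<noteq> 26" for b
    unfolding h5_def
    by (rule cands_block(2)[where Z = 20 and C = 21 and T = 22 and U = 24 and HI = 25 and K = 26 and env = env and n = n and h = h4
      and z = "zL I f" and c = "cL I f" and t = "tL I i f" and u = "umin I i f", OF env(1) 4]) (use that in simp_all)
  have 5: "m \<le> n \<Longrightarrow> h5 20 m = zL I f m" "m \<le> n \<Longrightarrow> h5 21 m = cL I f m" "m \<le> n \<Longrightarrow> h5 22 m = tL I i f m"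
    "m \<le> n \<Longrightarrow> h5 24 m = umin I i f" for m by (simp_all add: o5 4)
  have a: "h' 27 m = left_max I i f (lcand I i f m)" if "m \<le> n" for m
    unfolding h' left_max_def
    by (rule hmin_block(1)[where Z = 20 and C = 21 and T = 22 and e = "RLoad 26 (V 3)" and u = "lcand I i f" and A = 27 and env = env and n = n and h = h5
      and z = "zL I f" and c = "cL I f" and t = "tL I i f", OF env(1) 5(1-3)]) (use that k env in \<open>simp_all add: cL_def\<close>)
  have o6: "h' b = h5 b" if "b \<noteq> 27" for b
    unfolding h'
    by (rule hmin_block(2)[where Z = 20 and C = 21 and T = 22 and e = "RLoad 26 (V 3)" and u = "lcand I i f" and A = 27 and env = env and n = n and h = h5
      and z = "zL I f" and c = "cL I f" and t = "tL I i f", OF env(1) 5(1-3)]) (use that k env in \<open>simp_all add: cL_def\<close>)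
  show "m \<le> n \<Longrightarrow> h' 20 m = zL I f m" "m \<le> n \<Longrightarrow> h' 21 m = cL I f m" "m \<le> n \<Longrightarrow> h' 22 m = tL I i f m"
    "m \<le> n \<Longrightarrow> h' 24 m = umin I i f" "m \<le> n \<Longrightarrow> h' 26 m = lcand I i f m"
    by (simp_all add: o6 5 k)
  show "m \<le> n \<Longrightarrow> h' 27 m = left_max I i f (lcand I i f m)" by (rule a)
  show "b \<notin> {20..27} \<Longrightarrow> h' b = h b" by (auto simp: o o5 o6)
qed

lemma right_block:
  assumes env: "env 0 = n" "env 1 = i" "i \<le> n"
    and g: "nval ge (store_of env h) = g" "nexp_ok {0, 1, 2} ge" "0 < g" "g \<le> Suc n"
    and inp: "X < 11" "Cp < 11" "Lo < 11" "h X = pos I" "h Cp = cap I" "h Lo = wlo I"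
    and box_top: "\<And>t. t \<le> n \<Longrightarrow> h 11 t = box_top I i t"
  defines "h' \<equiv> run_stmt (p_right X Cp Lo ge) env h"
  shows "m \<le> n \<Longrightarrow> h' 30 m = zR I g m" "m \<le> n \<Longrightarrow> h' 32 m = cR I i g m" "m \<le> n \<Longrightarrow> h' 33 m = tR I i g m"
    "m \<le> n \<Longrightarrow> h' 35 m = vmin I i g" "m \<le> n \<Longrightarrow> h' 37 m = rcand I i g m"
    "m \<le> n \<Longrightarrow> h' 38 m = right_max I i g (rcand I i g m)"
    "b \<notin> {30..38} \<Longrightarrow> h' b = h b"
proof -
  let ?l = "NAdd ge (V 3)" and ?l' = "NAdd ge (V 4)"
  have env1: "env (Suc 0) = i" using env by simp
  have gv: "nval ge (store_of (env(3 := a)) h'') = g" "nval ge (store_of (env(3 := a, 4 := b)) h'') = g" for a b h''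
    unfolding g(1)[symmetric] by (rule nexp_ok_cong[OF g(2)]; auto)+
  have gn: "nexp_ok UNIV ge" using g(2) by (induction ge) auto
  define h0 where "h0 = run_stmt (Tab 30 3 (Pure (RLoad X ?l))) env h"
  define h1 where "h1 = run_stmt (Tab 31 3 (fmin (RLoad Cp (NSub ge (NConst 1))) (And (NLeq (NSub ge (NConst 1)) (V 4)) (NLess (V 4) ?l)) (RLoad Cp (V 4)))) env h0"
  define h2 where "h2 = run_stmt (Tab 32 3 (IfE (NLess (V 1) ?l) (Pure RZero) (Pure (RLoad 31 (V 3))))) env h1"
  define h3 where "h3 = run_stmt (Tab 33 3 (fsum (And (NLeq ge (V 4)) (Or (NLess (V 4) ?l) (NLess (V 1) ?l))) (RLoad 11 (V 4)))) env h2"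
  define h4 where "h4 = run_stmt (Tab 34 3 (fsum (NLeq ?l (V 4)) (RLoad Lo (V 4)))) env h3"
  define h5 where "h5 = run_stmt (Tab 35 3 (fmax (RLoad X (NSub ge (NConst 1)))
          (And (NLeq ?l' (V 0)) (Or (NLeq ?l' (V 1)) (RLess RZero (RLoad 34 (V 4)))))
          (RAdd (RLoad 30 (V 4)) (RDiv (RLoad 34 (V 4)) (RLoad 31 (V 4)))))) env h4"
  define h6 where "h6 = run_stmt (p_cands 30 32 33 35 36 37) env h5"
  have h': "h' = run_stmt (p_hmin 30 32 33 (RLoad 37 (V 3)) 38) env h6"
    unfolding h'_def p_right_def Let_def h6_def h5_def h4_def h3_def h2_def h1_def h0_def by (simp only: run_stmt.simps)
  have o0: "b \<noteq> 30 \<Longrightarrow> h0 b = h b" for b unfolding h0_def by (rule tab_other)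
  have o1: "b \<noteq> 31 \<Longrightarrow> h1 b = h0 b" for b unfolding h1_def by (rule tab_other)
  have o2: "b \<noteq> 32 \<Longrightarrow> h2 b = h1 b" for b unfolding h2_def by (rule tab_other)
  have o3: "b \<noteq> 33 \<Longrightarrow> h3 b = h2 b" for b unfolding h3_def by (rule tab_other)
  have o4: "b \<noteq> 34 \<Longrightarrow> h4 b = h3 b" for b unfolding h4_def by (rule tab_other)
  have o5: "b \<noteq> 35 \<Longrightarrow> h5 b = h4 b" for b unfolding h5_def by (rule tab_other)
  note o = o0 o1 o2 o3 o4 o5
  have z: "h0 30 m = zR I g m" if "m \<le> n" for m
    unfolding h0_def using that env inp by (subst tab_val) (simp_all add: zR_def gv)
  \<comment> \<open>Entries beyond the last vertex are meaningless. They are masked in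
    \<open>cR\<close> by \<open>g + m \<le> i\<close> and in \<open>vmin\<close> by
    \<open>g + m \<le> n\<close>.\<close>
  have c: "h1 31 m = cF I g m" if "m \<le> n" "g + m \<le> Suc n" for m
  proof -
    have "h1 31 m = Min (insert (cap I (g - 1)) (cap I ` {k. k \<le> n \<and> \<not> k < g - Suc 0 \<and> k < g + m}))"
      unfolding h1_def using that env inp gn by (subst tab_val, simp) (simp add: expr_val_fmin o gv)
    also have "\<dots> = min_cap I (g - 1) (g + m)"
      using that g by (intro Min_cap_image) auto
    finally show ?thesis by (simp add: cF_def)
  qed
  have cr: "h2 32 m = cR I i g m" if "m \<le> n" for m
    unfolding h2_def using that env env1 inp c[of m] by (subst tab_val) (simp_all add: cR_def gv)
  have t: "h3 33 m = tR I i g m" if "m \<le> n" for m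
  proof -
    have "h3 33 m = (\<Sum>k\<in>{k. k \<le> n \<and> (g \<le> k \<and> (k < g + m \<or> i < g + m))}. h2 11 k)"
      unfolding h3_def using that env env1 inp gn
      by (subst tab_val, simp) (simp add: expr_val_fsum gv disj_imp not_less not_le)
    also have "\<dots> = tR I i g m" unfolding tR_def
      using env g by (intro sum_cong_eq) (auto simp: o box_top)
    finally show ?thesis .
  qed
  have l: "h4 34 m = lR I g m" if "m \<le> n" "g + m \<le> n" for m
  proof -
    have "h4 34 m = (\<Sum>k\<in>{k. k \<le> n \<and> g + m \<le> k}. h3 Lo k)"
      unfolding h4_def using that env inp gn by (subst tab_val, simp) (simp add: expr_val_fsum gv not_less)
    also have "\<dots> = psum lo (Suc n) - psum lo (g + m)"
      using that inp by (intro sum_cong_eq) (auto simp: o)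
    finally show ?thesis by (simp add: lR_def)
  qed
  have v: "h5 35 m = vmin I i g" if "m \<le> n" for m
  proof -
    have "h5 35 m = Max (insert (pos I (g - 1)) ((\<lambda>k. h4 30 k + h4 34 k / h4 31 k) `
        {k. k \<le> n \<and> g + k \<le> n \<and> (g + k \<le> i \<or> 0 < h4 34 k)}))"
      unfolding h5_def using that env env1 inp gn
      by (subst tab_val, simp) (simp add: expr_val_fmax o gv disj_imp not_less not_le)
    also have "(\<lambda>k. h4 30 k + h4 34 k / h4 31 k) ` {k. k \<le> n \<and> g + k \<le> n \<and> (g + k \<le> i \<or> 0 < h4 34 k)} =
       (\<lambda>m. zR I g m + lR I g m / cF I g m) ` {m. m \<le> n \<and> g + m \<le> n \<and> (g + m \<le> i \<or> 0 < lR I g m)}"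
      by (intro image_cong) (auto simp: o z c l)
    finally show ?thesis by (simp add: vmin_def)
  qed
  have 5: "m \<le> n \<Longrightarrow> h5 30 m = zR I g m" "m \<le> n \<Longrightarrow> h5 32 m = cR I i g m" "m \<le> n \<Longrightarrow> h5 33 m = tR I i g m"
    "m \<le> n \<Longrightarrow> h5 35 m = vmin I i g" for m by (simp_all add: o z cr t v)
  have k: "h6 37 m = rcand I i g m" if "m \<le> n" for m
    unfolding h6_def rcand_def
    by (rule cands_block(1)[where Z = 30 and C = 32 and T = 33 and U = 35 and HI = 36 and K = 37 and env = env and n = n and h = h5
      and z = "zR I g" and c = "cR I i g" and t = "tR I i g" and u = "vmin I i g", OF env(1) 5]) (use that in simp_all)
  have o6: "h6 b = h5 b" if "b \<noteq> 36" "b \<noteq> 37" for b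
    unfolding h6_def
    by (rule cands_block(2)[where Z = 30 and C = 32 and T = 33 and U = 35 and HI = 36 and K = 37 and env = env and n = n and h = h5
      and z = "zR I g" and c = "cR I i g" and t = "tR I i g" and u = "vmin I i g", OF env(1) 5]) (use that in simp_all)
  have 6: "m \<le> n \<Longrightarrow> h6 30 m = zR I g m" "m \<le> n \<Longrightarrow> h6 32 m = cR I i g m" "m \<le> n \<Longrightarrow> h6 33 m = tR I i g m"
    "m \<le> n \<Longrightarrow> h6 35 m = vmin I i g" for m by (simp_all add: o6 5)
  have a: "h' 38 m = right_max I i g (rcand I i g m)" if "m \<le> n" for m
    unfolding h' right_max_def
    by (rule hmin_block(1)[where Z = 30 and C = 32 and T = 33 and e = "RLoad 37 (V 3)" and u = "rcand I i g" and A = 38 and env = env and n = n and h = h6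
      and z = "zR I g" and c = "cR I i g" and t = "tR I i g", OF env(1) 6(1-3)]) (use that k env g in \<open>simp_all add: cR_def\<close>)
  have o7: "h' b = h6 b" if "b \<noteq> 38" for b
    unfolding h'
    by (rule hmin_block(2)[where Z = 30 and C = 32 and T = 33 and e = "RLoad 37 (V 3)" and u = "rcand I i g" and A = 38 and env = env and n = n and h = h6
      and z = "zR I g" and c = "cR I i g" and t = "tR I i g", OF env(1) 6(1-3)]) (use that k env g in \<open>simp_all add: cR_def\<close>)
  show "m \<le> n \<Longrightarrow> h' 30 m = zR I g m" "m \<le> n \<Longrightarrow> h' 32 m = cR I i g m" "m \<le> n \<Longrightarrow> h' 33 m = tR I i g m"
    "m \<le> n \<Longrightarrow> h' 35 m = vmin I i g" "m \<le> n \<Longrightarrow> h' 37 m = rcand I i g m"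
    by (simp_all add: o7 6 k)
  show "m \<le> n \<Longrightarrow> h' 38 m = right_max I i g (rcand I i g m)" by (rule a)
  show "b \<notin> {30..38} \<Longrightarrow> h' b = h b" by (auto simp: o o6 o7)
qed

end

primrec writes :: "stmt \<Rightarrow> nat set" where
  "writes (Tab X v e) = {X}"
| "writes (Sq p q) = writes p \<union> writes q"
| "writes (ForS v p) = writes p"

lemma run_stmt_frame: "b \<notin> writes p \<Longrightarrow> run_stmt p env h b = h b"
proof (induction p arbitrary: env h)
  case (ForS v p)
  have "fold (\<lambda>k. run_stmt p (env(v := k))) ks h b = h b" for ks h
    using ForS by (induction ks arbitrary: h) auto
  then show ?case by (simp del: upt_Suc)
qed auto

lemmas writes_defs = p_left_def p_right_def p_cands_def p_hmin_def p_edge_def p_update_def p_vertex_def Let_def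

context path
begin

text \<open>Which maximiser \<open>j\<close> the program picked is left open;
  \<open>edge_cands\<close> accepts any. The right tables are assumed only for \<open>0 < f\<close>,
  and otherwise the result cell stays as it is.\<close>

lemma edge_block:
  assumes env: "env 0 = n" "env 1 = i" "env 2 = f" "i \<le> n" "f \<le> n"
    and inp: "X < 11" "Hi < 11" "RES < 11" "RES \<noteq> X" "RES \<noteq> Hi" "h X = pos I" "h Hi = whi I"
    and tabs: "\<And>v. i < v \<Longrightarrow> v \<le> n \<Longrightarrow> h 12 v = min_cap I i v" "h 13 0 = rest I i"
      "\<And>m. m \<le> n \<Longrightarrow> h 26 m = lcand I i f m" "\<And>m. m \<le> n \<Longrightarrow> h 27 m = left_max I i f (lcand I i f m)"
      "\<And>m. 0 < f \<Longrightarrow> m \<le> n \<Longrightarrow> h 37 m = rcand I i f m" "\<And>m. 0 < f \<Longrightarrow> m \<le> n \<Longrightarrow> h 38 m = right_max I i f (rcand I i f m)"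
    and v: "v \<le> n"
  defines "h' \<equiv> run_stmt (p_edge X Hi RES) env h"
  shows "\<not> (i < v \<and> 0 < up i \<and> 0 < f) \<Longrightarrow> h' RES v = h RES v"
    "i < v \<Longrightarrow> 0 < up i \<Longrightarrow> 0 < f \<Longrightarrow> \<exists>j\<le>n. (\<forall>j'\<le>n. right_value I i (min_cap I i v) f (rcand I i f j') \<le> right_value I i (min_cap I i v) f (rcand I i f j)) \<and>
      h' RES v = Max (insert (h RES v) ((\<lambda>m. point_value I i (min_cap I i v) f f (lcand I i f m) (rcand I i f j) - x i) `
        {m. m \<le> n \<and> 2 * x (f - 1) \<le> rcand I i f j - lcand I i f m \<and> rcand I i f j - lcand I i f m \<le> 2 * x f}))"
proof -
  let ?val = "\<lambda>m. RSub (RDiv (RLoad 38 m) (RLoad 12 (V 3))) (RDiv (RLoad 37 m) Two)"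
  let ?d = "RSub (RLoad 41 (V 3)) (RLoad 26 (V 4))"
  have env1: "env (Suc 0) = i" using env by simp
  define h0 where "h0 = run_stmt (Tab 40 3 (fmax (?val (NConst 0)) (NLess (NConst 0) (NConst 1)) (?val (V 4)))) env h"
  define h1 where "h1 = run_stmt (Tab 41 3 (flast (RLeq (RLoad 40 (V 3)) (?val (V 4))) (RLoad 37 (V 4)))) env h0"
  define h2 where "h2 = run_stmt (Tab 42 3 (fmax (RLoad RES (V 3))
          (And (NLess (V 1) (V 3)) (And (RLess RZero (RLoad Hi (V 1))) (And (NLess (NConst 0) (V 2))
            (And (RLeq (RMul Two (RLoad X (NSub (V 2) (NConst 1)))) ?d) (RLeq ?d (RMul Two (RLoad X (V 2))))))))
          (RSub (RAdd (RSub (RDiv (RSub (RLoad 27 (V 4)) (RLoad 13 (NConst 0))) (RLoad 12 (V 3))) (RDiv (RLoad 26 (V 4)) Two))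
             (RLoad 40 (V 3))) (RLoad X (V 1))))) env h1"
  have h': "h' = run_stmt (Tab RES 3 (Pure (RLoad 42 (V 3)))) env h2"
    unfolding h'_def p_edge_def Let_def h2_def h1_def h0_def by (simp only: run_stmt.simps)
  have o0: "b \<noteq> 40 \<Longrightarrow> h0 b = h b" for b unfolding h0_def by (rule tab_other)
  have o1: "b \<noteq> 41 \<Longrightarrow> h1 b = h0 b" for b unfolding h1_def by (rule tab_other)
  note o = o0 o1
  have res: "h' RES v = h2 42 v" unfolding h' using v env by (subst tab_val) simp_all
  have h2: "h2 42 v = Max (insert (h RES v) ((\<lambda>m. (h 27 m - h 13 0) / h 12 v - h 26 m / 2 + h1 40 v - x i) `
      {m. m \<le> n \<and> i < v \<and> 0 < up i \<and> 0 < f \<and> 2 * x (f - 1) \<le> h1 41 v - h 26 m \<and> h1 41 v - h 26 m \<le> 2 * x f}))"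
    unfolding h2_def using v env env1 inp by (subst tab_val, simp) (simp add: expr_val_fmax o not_less)
  show "\<not> (i < v \<and> 0 < up i \<and> 0 < f) \<Longrightarrow> h' RES v = h RES v" unfolding res h2 by auto
  assume iv: "i < v" "0 < up i" "0 < f"
  let ?r = "\<lambda>m. right_value I i (min_cap I i v) f (rcand I i f m)"
  have val: "h 38 m / h 12 v - h 37 m / 2 = ?r m" if "m \<le> n" for m
    using tabs(1)[OF iv(1) v] tabs(5,6)[OF iv(3) that] by (simp add: right_value_def)
  have "h0 40 v = Max (insert (h 38 0 / h 12 v - h 37 0 / 2) ((\<lambda>m. h 38 m / h 12 v - h 37 m / 2) ` {m. m \<le> n}))"
    unfolding h0_def using v env by (subst tab_val, simp) (simp add: expr_val_fmax)
  also have "\<dots> = Max (insert (?r 0) (?r ` {m. m \<le> n}))" using val by (intro arg_cong[where f = Max] arg_cong2[where f = insert] image_cong) auto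
  also have "\<dots> = Max (?r ` {m. m \<le> n})" by (rule arg_cong[where f = Max]) auto
  finally have mb: "h0 40 v = Max (?r ` {m. m \<le> n})" .
  have fin: "finite (?r ` {m. m \<le> n})" "?r ` {m. m \<le> n} \<noteq> {}" by auto
  obtain j0 where "j0 \<le> n" "Max (?r ` {m. m \<le> n}) = ?r j0" using Max_in[OF fin] by auto
  let ?env = "env(3 := v)"
  have ex: "\<exists>k\<le>?env 0. bval (RLeq (RLoad 40 (V 3)) (?val (V 4))) (store_of (?env(4 := k)) h0)"
    using \<open>j0 \<le> n\<close> \<open>Max (?r ` {m. m \<le> n}) = ?r j0\<close> env mb val[of j0]
    by (intro exI[of _ j0]) (simp add: o)
  have "h1 41 v = expr_val (flast (RLeq (RLoad 40 (V 3)) (?val (V 4))) (RLoad 37 (V 4))) ?env h0"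
    unfolding h1_def using v env by (subst tab_val) simp_all
  moreover have "\<exists>k\<le>?env 0. bval (RLeq (RLoad 40 (V 3)) (?val (V 4))) (store_of (?env(4 := k)) h0) \<and>
      expr_val (flast (RLeq (RLoad 40 (V 3)) (?val (V 4))) (RLoad 37 (V 4))) ?env h0 = rval (RLoad 37 (V 4)) (store_of (?env(4 := k)) h0)"
    by (rule expr_val_flast[OF _ _ ex]) simp_all
  ultimately obtain j where j: "j \<le> n" "h0 40 v \<le> ?r j" "h1 41 v = h 37 j"
    using env val by (auto simp: o not_less)
  have best: "?r j' \<le> ?r j" if "j' \<le> n" for j'
  proof -
    have "?r j' \<le> Max (?r ` {m. m \<le> n})" using fin that by (intro Max_ge) auto
    with j(2) mb show ?thesis by simp
  qed
  have vs: "h1 41 v = rcand I i f j" using j tabs(5)[OF iv(3)] by simp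
  have "?r j \<le> h0 40 v" unfolding mb using fin j(1) by (intro Max_ge) auto
  then have mb': "h1 40 v = ?r j" using j(2) by (simp add: o)
  have "h' RES v = Max (insert (h RES v) ((\<lambda>m. point_value I i (min_cap I i v) f f (lcand I i f m) (rcand I i f j) - x i) `
        {m. m \<le> n \<and> 2 * x (f - 1) \<le> rcand I i f j - lcand I i f m \<and> rcand I i f j - lcand I i f m \<le> 2 * x f}))"
    unfolding res h2
    by (intro arg_cong[where f = Max] arg_cong2[where f = insert] image_cong)
      (auto simp: iv vs mb' tabs(1)[OF iv(1) v] tabs(2-4) point_value_edge)
  with best j(1) show "\<exists>j\<le>n. (\<forall>j'\<le>n. ?r j' \<le> ?r j) \<and>
      h' RES v = Max (insert (h RES v) ((\<lambda>m. point_value I i (min_cap I i v) f f (lcand I i f m) (rcand I i f j) - x i) `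
        {m. m \<le> n \<and> 2 * x (f - 1) \<le> rcand I i f j - lcand I i f m \<and> rcand I i f j - lcand I i f m \<le> 2 * x f}))"
    by blast
qed

lemma update_block:
  assumes env: "env 0 = n" "env 1 = i" "env 2 = f" "i \<le> n" "f \<le> n"
    and inp: "X < 11" "Hi < 11" "RES < 11" "RES \<noteq> X" "RES \<noteq> Hi" "h X = pos I" "h Hi = whi I"
    and tabs: "\<And>v. i < v \<Longrightarrow> v \<le> n \<Longrightarrow> h 12 v = min_cap I i v" "h 13 0 = rest I i" "h 11 f = box_top I i f"
      "\<And>m. m \<le> n \<Longrightarrow> h 20 m = zL I f m" "\<And>m. m \<le> n \<Longrightarrow> h 21 m = cL I f m" "\<And>m. m \<le> n \<Longrightarrow> h 22 m = tL I i f m"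
      "\<And>m. m \<le> n \<Longrightarrow> h 30 m = zR I (Suc f) m" "\<And>m. m \<le> n \<Longrightarrow> h 32 m = cR I i (Suc f) m" "\<And>m. m \<le> n \<Longrightarrow> h 33 m = tR I i (Suc f) m"
      "\<And>m. m \<le> n \<Longrightarrow> h 43 m = thmin I i f"
    and th: "\<And>m. m \<le> n \<Longrightarrow> rval e (store_of (env(3 := m)) h) = th m"
    and v: "v \<le> n"
  defines "h' \<equiv> run_stmt (p_update X Hi RES e) env h"
  shows "h' RES v = (if i < v \<and> 0 < up i then Max (insert (h RES v)
      ((\<lambda>m. vertex_val I i (min_cap I i v) f (max (thmin I i f) (th m)) - x i) ` {m. m \<le> n})) else h RES v)"
proof -
  have env1: "env (Suc 0) = i" using env by simp
  define t where "t m = max (thmin I i f) (th m)" for m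
  define h0 where "h0 = run_stmt (Tab 44 3 (emax (RLoad 43 (V 3)) e)) env h"
  define h1 where "h1 = run_stmt (p_hmin 20 21 22 (RSub (RLoad 44 (V 3)) (RLoad X (V 2))) 45) env h0"
  define h2 where "h2 = run_stmt (p_hmin 30 32 33 (RAdd (RLoad 44 (V 3)) (RLoad X (V 2))) 46) env h1"
  define h3 where "h3 = run_stmt (Tab 42 3 (fmax (RLoad RES (V 3)) (And (NLess (V 1) (V 3)) (RLess RZero (RLoad Hi (V 1))))
       (RSub (RSub (RDiv (RSub (RAdd (RAdd (RLoad 45 (V 4)) (RLoad 46 (V 4))) (RLoad 11 (V 2))) (RLoad 13 (NConst 0)))
          (RLoad 12 (V 3))) (RLoad 44 (V 4))) (RLoad X (V 1))))) env h2"
  have h': "h' = run_stmt (Tab RES 3 (Pure (RLoad 42 (V 3)))) env h3"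
    unfolding h'_def p_update_def h3_def h2_def h1_def h0_def by (simp only: run_stmt.simps)
  have o0: "b \<noteq> 44 \<Longrightarrow> h0 b = h b" for b unfolding h0_def by (rule tab_other)
  have o1: "b \<noteq> 45 \<Longrightarrow> h1 b = h0 b" for b unfolding h1_def by (rule run_stmt_frame) (simp add: p_hmin_def Let_def)
  have o2: "b \<noteq> 46 \<Longrightarrow> h2 b = h1 b" for b unfolding h2_def by (rule run_stmt_frame) (simp add: p_hmin_def Let_def)
  note o = o0 o1 o2
  have 44: "h0 44 m = t m" if "m \<le> n" for m
    unfolding h0_def using that env tabs(10)[OF that] th[OF that] by (subst tab_val) (simp_all add: expr_val_emax t_def)
  have 45: "h1 45 m = left_max I i f (t m - x f)" if "m \<le> n" for m
    unfolding h1_def left_max_def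
    by (rule hmin_block(1)[where Z = 20 and C = 21 and T = 22 and e = "RSub (RLoad 44 (V 3)) (RLoad X (V 2))"
        and u = "\<lambda>m. t m - x f" and A = 45 and env = env and n = n and h = h0 and z = "zL I f" and c = "cL I f" and t = "tL I i f"])
      (use that env inp in \<open>simp_all add: cL_def o tabs 44\<close>)
  have 46: "h2 46 m = right_max I i (Suc f) (t m + x f)" if "m \<le> n" for m
    unfolding h2_def right_max_def
    by (rule hmin_block(1)[where Z = 30 and C = 32 and T = 33 and e = "RAdd (RLoad 44 (V 3)) (RLoad X (V 2))"
        and u = "\<lambda>m. t m + x f" and A = 46 and env = env and n = n and h = h1 and z = "zR I (Suc f)" and c = "cR I i (Suc f)" and t = "tR I i (Suc f)"])
      (use that env inp in \<open>simp_all add: cR_def o tabs 44\<close>)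
  have res: "h' RES v = h3 42 v" unfolding h' using v env by (subst tab_val) simp_all
  have mid: "mid I i f (Suc f) = box_top I i f" by (simp add: mid_def psum_Suc)
  have h3: "h3 42 v = Max (insert (h RES v) ((\<lambda>m. (h1 45 m + h2 46 m + h 11 f - h 13 0) / h 12 v - h0 44 m - x i) `
      {m. m \<le> n \<and> i < v \<and> 0 < up i}))"
    unfolding h3_def using v env env1 inp by (subst tab_val, simp) (simp add: expr_val_fmax o)
  show ?thesis
  proof (cases "i < v \<and> 0 < up i")
    case True
    have "(\<lambda>m. (h1 45 m + h2 46 m + h 11 f - h 13 0) / h 12 v - h0 44 m - x i) ` {m. m \<le> n \<and> i < v \<and> 0 < up i} =
      (\<lambda>m. vertex_val I i (min_cap I i v) f (max (thmin I i f) (th m)) - x i) ` {m. m \<le> n}"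
      by (rule image_cong)
        (use True v in \<open>auto simp: 44 45 46 tabs(1-3) vertex_val_def point_value_def mid t_def[symmetric]\<close>)
    with True show ?thesis unfolding res h3 by simp
  next
    case False
    then show ?thesis unfolding res h3 by auto
  qed
qed

text \<open>The two halves of the loop invariant for the value \<open>y\<close> of the result cell \<open>v\<close>: it is a limit of
  regrets, and it dominates the values of the slots with left boundary \<open>f\<close>.\<close>

definition approachable :: "nat \<Rightarrow> real \<Rightarrow> bool" where
  "approachable v y \<longleftrightarrow> y = - x v \<or> (\<forall>e>0. \<exists>i<v. \<exists>s\<in>scenarios I. 0 < s i \<and>
     y - e \<le> psum s (Suc i) / min_cap I i v - x i - opt_evac_time I s)"

definition covered :: "nat \<Rightarrow> nat \<Rightarrow> nat \<Rightarrow> real \<Rightarrow> bool" where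
  "covered i v f y \<longleftrightarrow>
     (\<forall>u w. admissible I i f (Suc f) u w \<longrightarrow> point_value I i (min_cap I i v) f (Suc f) u w - x i \<le> y) \<and>
     (\<forall>u w. admissible I i f f u w \<longrightarrow> point_value I i (min_cap I i v) f f u w - x i \<le> y \<or>
        (\<exists>f' a b. admissible I i f' (Suc f') a b \<and> point_value I i (min_cap I i v) f f u w \<le> point_value I i (min_cap I i v) f' (Suc f') a b))"

section \<open>Loop invariants for one side\<close>

lemma approachable_point_value:
  assumes "admissible I i f g u w" "i < v" "v \<le> n" "0 < up i"
  shows "approachable v (point_value I i (min_cap I i v) f g u w - x i)"
  unfolding approachable_def
proof (rule disjI2, intro allI impI)
  fix e :: real assume "0 < e"
  from sound[OF assms this] obtain s where "s \<in> scenarios I" "0 < s i"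
    "point_value I i (min_cap I i v) f g u w - e \<le> psum s (Suc i) / min_cap I i v - opt_evac_time I s" .
  with assms(2) show "\<exists>i'<v. \<exists>s\<in>scenarios I. 0 < s i' \<and>
      point_value I i (min_cap I i v) f g u w - x i - e \<le> psum s (Suc i') / min_cap I i' v - x i' - opt_evac_time I s"
    by (intro exI[of _ i] conjI bexI[of _ s]) auto
qed

lemma approachable_Max: "approachable v y \<Longrightarrow> finite S \<Longrightarrow> (\<And>z. z \<in> S \<Longrightarrow> approachable v z) \<Longrightarrow> approachable v (Max (insert y S))"
  using Max_in[of "insert y S"] by auto

lemma admissible_vertex_val: "f \<le> n \<Longrightarrow> thmin I i f \<le> w \<Longrightarrow> admissible I i f (Suc f) (w - x f) (w + x f)"
  by (auto simp: admissible_def slot_def thmin_def)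

lemma approachable_vertex_val:
  assumes "f \<le> n" "i < v" "v \<le> n" "0 < up i"
  shows "approachable v (vertex_val I i (min_cap I i v) f (max (thmin I i f) w) - x i)"
  unfolding vertex_val_def using assms by (intro approachable_point_value admissible_vertex_val) auto

text \<open>Result cells only grow, so what earlier slots and vertices have covered stays covered,
  while every value entered is approachable.\<close>

lemma slot_step:
  assumes env: "env 0 = n" "env 1 = i" "env 2 = f" "i \<le> n" "f \<le> n"
    and inp: "X < 11" "Cp < 11" "Lo < 11" "Hi < 11" "RES < 11" "RES \<noteq> X" "RES \<noteq> Cp" "RES \<noteq> Lo" "RES \<noteq> Hi"
      "h X = pos I" "h Cp = cap I" "h Lo = wlo I" "h Hi = whi I"
    and tabs: "\<And>t. t \<le> n \<Longrightarrow> h 11 t = box_top I i t" "\<And>v. i < v \<Longrightarrow> v \<le> n \<Longrightarrow> h 12 v = min_cap I i v" "h 13 0 = rest I i"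
    and v: "v \<le> n"
  defines "h' \<equiv> run_stmt (p_slot X Cp Lo Hi RES) env h"
  shows "h RES v \<le> h' RES v" "approachable v (h RES v) \<Longrightarrow> approachable v (h' RES v)"
    "i < v \<Longrightarrow> 0 < up i \<Longrightarrow> covered i v f (h' RES v)"
proof -
  define h1 where "h1 = run_stmt (p_left X Cp Lo) env h"
  define h2 where "h2 = run_stmt (p_right X Cp Lo (V 2)) env h1"
  define h3 where "h3 = run_stmt (p_edge X Hi RES) env h2"
  define h4 where "h4 = run_stmt (p_right X Cp Lo (NAdd (V 2) (NConst 1))) env h3"
  define h5 where "h5 = run_stmt (Tab 43 3 (emax (RAdd (RLoad 24 (V 3)) (RLoad X (V 2))) (RSub (RLoad 35 (V 3)) (RLoad X (V 2))))) env h4"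
  define h6 where "h6 = run_stmt (p_update X Hi RES (RAdd (RLoad 26 (V 3)) (RLoad X (V 2)))) env h5"
  have h': "h' = run_stmt (p_update X Hi RES (RSub (RLoad 37 (V 3)) (RLoad X (V 2)))) env h6"
    unfolding h'_def p_slot_def p_vertex_def h6_def h5_def h4_def h3_def h2_def h1_def by (simp only: run_stmt.simps)
  have o1: "b \<notin> {20..27} \<Longrightarrow> h1 b = h b" for b
    unfolding h1_def by (rule run_stmt_frame) (auto simp: writes_defs)
  have o2: "b \<notin> {30..38} \<Longrightarrow> h2 b = h1 b" for b
    unfolding h2_def by (rule run_stmt_frame) (auto simp: writes_defs)
  have o3: "b \<notin> {40..42} \<Longrightarrow> b \<noteq> RES \<Longrightarrow> h3 b = h2 b" for b
    unfolding h3_def by (rule run_stmt_frame) (auto simp: writes_defs)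
  have o4: "b \<notin> {30..38} \<Longrightarrow> h4 b = h3 b" for b
    unfolding h4_def by (rule run_stmt_frame) (auto simp: writes_defs)
  have o5: "b \<noteq> 43 \<Longrightarrow> h5 b = h4 b" for b unfolding h5_def by (rule tab_other)
  have o6: "b \<notin> {42..46} \<Longrightarrow> b \<noteq> RES \<Longrightarrow> h6 b = h5 b" for b
    unfolding h6_def by (rule run_stmt_frame) (auto simp: writes_defs)
  have L: "m \<le> n \<Longrightarrow> h1 20 m = zL I f m" "m \<le> n \<Longrightarrow> h1 21 m = cL I f m" "m \<le> n \<Longrightarrow> h1 22 m = tL I i f m"
    "m \<le> n \<Longrightarrow> h1 24 m = umin I i f" "m \<le> n \<Longrightarrow> h1 26 m = lcand I i f m"
    "m \<le> n \<Longrightarrow> h1 27 m = left_max I i f (lcand I i f m)" for m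
    unfolding h1_def by (rule left_block(1-6)[OF env inp(1-3,10-12) tabs(1)]; assumption)+
  have in1: "h1 X = pos I" "h1 Cp = cap I" "h1 Lo = wlo I" "h1 Hi = whi I" "\<And>t. t \<le> n \<Longrightarrow> h1 11 t = box_top I i t"
    using inp tabs(1) by (simp_all add: o1)
  have R: "m \<le> n \<Longrightarrow> h2 37 m = rcand I i f m" "m \<le> n \<Longrightarrow> h2 38 m = right_max I i f (rcand I i f m)" if "0 < f" for m
    using right_block(5,6)[where X = X and Cp = Cp and Lo = Lo and h = h1 and ge = "V 2" and g = f, OF env(1,2,4) _ _ that _ inp(1-3) in1(1-3,5)]
      env unfolding h2_def by simp_all
  have t2: "\<And>v. i < v \<Longrightarrow> v \<le> n \<Longrightarrow> h2 12 v = min_cap I i v" "h2 13 0 = rest I i"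
      "\<And>m. m \<le> n \<Longrightarrow> h2 26 m = lcand I i f m" "\<And>m. m \<le> n \<Longrightarrow> h2 27 m = left_max I i f (lcand I i f m)"
    using tabs L by (simp_all add: o1 o2)
  have in2: "h2 X = pos I" "h2 Hi = whi I" "h2 RES = h RES" using in1 inp by (simp_all add: o2 o1)
  let ?C = "min_cap I i v"
  have E1: "\<not> (i < v \<and> 0 < up i \<and> 0 < f) \<Longrightarrow> h3 RES v = h RES v"
    unfolding h3_def in2(3)[symmetric]
    by (rule edge_block(1)[OF env inp(1,4,5,6,9) in2(1,2)]) (use t2 R v in auto)
  have E2: "\<exists>j\<le>n. (\<forall>j'\<le>n. right_value I i ?C f (rcand I i f j') \<le> right_value I i ?C f (rcand I i f j)) \<and>
      h3 RES v = Max (insert (h RES v) ((\<lambda>m. point_value I i ?C f f (lcand I i f m) (rcand I i f j) - x i) `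
        {m. m \<le> n \<and> 2 * x (f - 1) \<le> rcand I i f j - lcand I i f m \<and> rcand I i f j - lcand I i f m \<le> 2 * x f}))"
    if "i < v" "0 < up i" "0 < f"
    unfolding h3_def in2(3)[symmetric]
    by (rule edge_block(2)[OF env inp(1,4,5,6,9) in2(1,2)]) (use t2 R v that in auto)
  have in3: "h3 X = pos I" "h3 Cp = cap I" "h3 Lo = wlo I" "h3 Hi = whi I" "\<And>t. t \<le> n \<Longrightarrow> h3 11 t = box_top I i t"
    using inp in1 by (simp_all add: o3 o2)
  have ge: "nval (NAdd (V 2) (NConst 1)) (store_of env h3) = Suc f" using env by simp
  have R': "m \<le> n \<Longrightarrow> h4 30 m = zR I (Suc f) m" "m \<le> n \<Longrightarrow> h4 32 m = cR I i (Suc f) m" "m \<le> n \<Longrightarrow> h4 33 m = tR I i (Suc f) m"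
    "m \<le> n \<Longrightarrow> h4 35 m = vmin I i (Suc f)" "m \<le> n \<Longrightarrow> h4 37 m = rcand I i (Suc f) m" for m
    using right_block(1-5)[where X = X and Cp = Cp and Lo = Lo and h = h3 and ge = "NAdd (V 2) (NConst 1)" and g = "Suc f",
        OF env(1,2,4) ge _ _ _ inp(1-3) in3(1-3,5)] env unfolding h4_def by simp_all
  have in5: "h5 X = pos I" "h5 Hi = whi I" "h5 RES = h3 RES" using in3 inp by (simp_all add: o5 o4)
  have in6: "h6 X = pos I" "h6 Hi = whi I" using in5 inp by (simp_all add: o6)
  have t5: "\<And>v. i < v \<Longrightarrow> v \<le> n \<Longrightarrow> h5 12 v = min_cap I i v" "h5 13 0 = rest I i" "h5 11 f = box_top I i f"
      "\<And>m. m \<le> n \<Longrightarrow> h5 20 m = zL I f m" "\<And>m. m \<le> n \<Longrightarrow> h5 21 m = cL I f m" "\<And>m. m \<le> n \<Longrightarrow> h5 22 m = tL I i f m"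
      "\<And>m. m \<le> n \<Longrightarrow> h5 30 m = zR I (Suc f) m" "\<And>m. m \<le> n \<Longrightarrow> h5 32 m = cR I i (Suc f) m" "\<And>m. m \<le> n \<Longrightarrow> h5 33 m = tR I i (Suc f) m"
    using t2 R' L inp in3 env by (simp_all add: o5 o4 o3 o2)
  have l5: "\<And>m. m \<le> n \<Longrightarrow> h5 26 m = lcand I i f m" "\<And>m. m \<le> n \<Longrightarrow> h5 37 m = rcand I i (Suc f) m"
    using t2 R' inp by (simp_all add: o5 o4 o3)
  have 43: "h5 43 m = thmin I i f" if "m \<le> n" for m
    unfolding h5_def using that env inp L(4)[OF that] R'(4)[OF that] in3
    by (subst tab_val) (simp_all add: expr_val_emax thmin_def o4 o3 o2)
  have t6: "\<And>v. i < v \<Longrightarrow> v \<le> n \<Longrightarrow> h6 12 v = min_cap I i v" "h6 13 0 = rest I i" "h6 11 f = box_top I i f"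
      "\<And>m. m \<le> n \<Longrightarrow> h6 20 m = zL I f m" "\<And>m. m \<le> n \<Longrightarrow> h6 21 m = cL I f m" "\<And>m. m \<le> n \<Longrightarrow> h6 22 m = tL I i f m"
      "\<And>m. m \<le> n \<Longrightarrow> h6 30 m = zR I (Suc f) m" "\<And>m. m \<le> n \<Longrightarrow> h6 32 m = cR I i (Suc f) m" "\<And>m. m \<le> n \<Longrightarrow> h6 33 m = tR I i (Suc f) m"
      "\<And>m. m \<le> n \<Longrightarrow> h6 43 m = thmin I i f"
    using t5 43 inp by (simp_all add: o6) (simp add: h6_def run_stmt_frame writes_defs)
  have l6: "\<And>m. m \<le> n \<Longrightarrow> h6 37 m = rcand I i (Suc f) m" using l5 inp by (simp add: o6)
  have U1: "h6 RES v = (if i < v \<and> 0 < up i then Max (insert (h3 RES v)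
      ((\<lambda>m. vertex_val I i ?C f (max (thmin I i f) (lcand I i f m + x f)) - x i) ` {m. m \<le> n})) else h3 RES v)"
    unfolding h6_def in5(3)[symmetric]
    by (rule update_block[OF env inp(1,4,5,6,9) in5(1,2) t5 43 _ v]) (use env l5 in5 in simp_all)
  have U2: "h' RES v = (if i < v \<and> 0 < up i then Max (insert (h6 RES v)
      ((\<lambda>m. vertex_val I i ?C f (max (thmin I i f) (rcand I i (Suc f) m - x f)) - x i) ` {m. m \<le> n})) else h6 RES v)"
    unfolding h'
    by (rule update_block[OF env inp(1,4,5,6,9) in6(1,2) t6 _ v]) (use env l6 in6 in simp_all)
  have m3: "h RES v \<le> h3 RES v"
  proof (cases "i < v \<and> 0 < up i \<and> 0 < f")
    case True
    then obtain S where "h3 RES v = Max (insert (h RES v) S)" "finite S" using E2 by fastforce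
    then show ?thesis by simp
  qed (simp add: E1)
  have m6: "h3 RES v \<le> h6 RES v" unfolding U1 by auto
  have m': "h6 RES v \<le> h' RES v" unfolding U2 by auto
  show "h RES v \<le> h' RES v" using m3 m6 m' by simp
  show "approachable v (h' RES v)" if r: "approachable v (h RES v)"
  proof -
    have "approachable v (h3 RES v)"
    proof (cases "i < v \<and> 0 < up i \<and> 0 < f")
      case True
      then obtain j where "h3 RES v = Max (insert (h RES v) ((\<lambda>m. point_value I i ?C f f (lcand I i f m) (rcand I i f j) - x i) `
        {m. m \<le> n \<and> 2 * x (f - 1) \<le> rcand I i f j - lcand I i f m \<and> rcand I i f j - lcand I i f m \<le> 2 * x f}))"
        using E2 by blast
      then show ?thesis using r True v env
        by (auto intro!: approachable_Max approachable_point_value simp: admissible_def slot_def lcand_def rcand_def cand_ge)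
    next
      case False
      with E1 r show ?thesis by simp
    qed
    then have "approachable v (h6 RES v)" unfolding U1 using env v by (auto intro!: approachable_Max approachable_vertex_val)
    then show ?thesis unfolding U2 using env v by (auto intro!: approachable_Max approachable_vertex_val)
  qed
  assume iv: "i < v" "0 < up i"
  have C: "0 < ?C" using iv v min_cap_pos by simp
  show "covered i v f (h' RES v)" unfolding covered_def
  proof (intro conjI allI impI)
    fix u w assume d: "admissible I i f (Suc f) u w"
    have 1: "vertex_val I i ?C f (max (thmin I i f) (lcand I i f j + x f)) - x i \<le> h' RES v" if "j \<le> n" for j
    proof -
      have "vertex_val I i ?C f (max (thmin I i f) (lcand I i f j + x f)) - x i \<le> h6 RES v"
        unfolding U1 using iv that by (auto intro!: Max_ge)
      with m' show ?thesis by simp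
    qed
    have 2: "vertex_val I i ?C f (max (thmin I i f) (rcand I i (Suc f) j - x f)) - x i \<le> h' RES v" if "j \<le> n" for j
      unfolding U2 using iv that by (auto intro!: Max_ge)
    obtain j where "j \<le> n" and j: "point_value I i ?C f (Suc f) u w \<le> vertex_val I i ?C f (max (thmin I i f) (lcand I i f j + x f)) \<or>
      point_value I i ?C f (Suc f) u w \<le> vertex_val I i ?C f (max (thmin I i f) (rcand I i (Suc f) j - x f))"
      using vertex_cands[OF d env(4) C] by blast
    from j 1[OF \<open>j \<le> n\<close>] 2[OF \<open>j \<le> n\<close>] show "point_value I i ?C f (Suc f) u w - x i \<le> h' RES v" by linarith
  next
    fix u w assume d: "admissible I i f f u w"
    then have f: "0 < f" by (simp add: admissible_def slot_def)
    obtain j where j: "j \<le> n" "\<And>j'. j' \<le> n \<Longrightarrow> right_value I i ?C f (rcand I i f j') \<le> right_value I i ?C f (rcand I i f j)"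
      "h3 RES v = Max (insert (h RES v) ((\<lambda>m. point_value I i ?C f f (lcand I i f m) (rcand I i f j) - x i) `
        {m. m \<le> n \<and> 2 * x (f - 1) \<le> rcand I i f j - lcand I i f m \<and> rcand I i f j - lcand I i f m \<le> 2 * x f}))"
      using E2[OF iv f] by blast
    have ge: "vmin I i f \<le> rcand I i f j" by (simp add: rcand_def cand_ge)
    from edge_cands[OF d env(4) C ge j(2)] consider m where "m \<le> n" "2 * x (f - 1) \<le> rcand I i f j - lcand I i f m"
        "rcand I i f j - lcand I i f m \<le> 2 * x f" "point_value I i ?C f f u w \<le> point_value I i ?C f f (lcand I i f m) (rcand I i f j)"
      | f' a b where "admissible I i f' (Suc f') a b" "point_value I i ?C f f u w \<le> point_value I i ?C f' (Suc f') a b" by blast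
    then show "point_value I i ?C f f u w - x i \<le> h' RES v \<or>
        (\<exists>f' a b. admissible I i f' (Suc f') a b \<and> point_value I i ?C f f u w \<le> point_value I i ?C f' (Suc f') a b)"
    proof cases
      case 1
      have "point_value I i ?C f f (lcand I i f m) (rcand I i f j) - x i \<le> h3 RES v"
        unfolding j(3) using 1 by (intro Max_ge) auto
      with 1(4) m6 m' show ?thesis by linarith
    qed blast
  qed
qed

end

text \<open>The evacuation from the left to a sink \<open>y\<close> with left vertices \<open>{..<v}\<close> has maximal regret
  \<open>max 0 (y + R v)\<close>.\<close>

definition sided :: "path_instance \<Rightarrow> (nat \<Rightarrow> real) \<Rightarrow> bool" where
  "sided I R \<longleftrightarrow> (\<forall>v\<le>edges I. - pos I v \<le> R v \<and>
     (R v = - pos I v \<or> (\<forall>e>0. \<exists>i<v. \<exists>s\<in>scenarios I. 0 < s i \<and>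
        R v - e \<le> psum s (Suc i) / min_cap I i v - pos I i - opt_evac_time I s)) \<and>
     (\<forall>i<v. \<forall>s\<in>scenarios I. 0 < s i \<longrightarrow>
        psum s (Suc i) / min_cap I i v - pos I i - opt_evac_time I s \<le> R v))"

context path
begin

lemma covered_mono: "covered i v f y \<Longrightarrow> y \<le> z \<Longrightarrow> covered i v f z"
  unfolding covered_def by (meson order_trans)

text \<open>The escape clause of \<open>covered\<close> does not say which vertex slot dominates an
  edge value, so it is discharged only when all slots have been covered.\<close>

lemma covered_all:
  assumes "\<And>f. f \<le> n \<Longrightarrow> covered i v f y" "admissible I i f g u w"
  shows "point_value I i (min_cap I i v) f g u w - x i \<le> y"
proof -
  have f: "f \<le> n" "g = Suc f \<or> g = f" using assms(2) by (auto simp: admissible_def slot_def)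
  have 1: "point_value I i (min_cap I i v) f' (Suc f') a b - x i \<le> y" if "admissible I i f' (Suc f') a b" for f' a b
  proof -
    have "f' \<le> n" using that by (simp add: admissible_def slot_def)
    from assms(1)[OF this] that show ?thesis by (simp add: covered_def)
  qed
  show ?thesis
  proof (cases "g = Suc f")
    case False
    with f assms(1)[OF f(1)] assms(2) have "point_value I i (min_cap I i v) f g u w - x i \<le> y \<or>
      (\<exists>f' a b. admissible I i f' (Suc f') a b \<and> point_value I i (min_cap I i v) f g u w \<le> point_value I i (min_cap I i v) f' (Suc f') a b)"
      by (auto simp: covered_def)
    with 1 show ?thesis by force
  qed (use 1 assms(2) in auto)
qed

text \<open>Approachability yields the lower half of \<open>sided\<close>. For the upper half,
  \<open>complete\<close> turns each regret term into values of slots, one for every competing sink,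
  and these are covered.\<close>

lemma side:
  assumes env: "env 0 = n"
    and inp: "X < 11" "Cp < 11" "Lo < 11" "Hi < 11" "RES < 11" "RES \<noteq> X" "RES \<noteq> Cp" "RES \<noteq> Lo" "RES \<noteq> Hi"
      "h X = pos I" "h Cp = cap I" "h Lo = wlo I" "h Hi = whi I"
  shows "sided I (run_stmt (p_side X Cp Lo Hi RES) env h RES)"
proof -
  define inputs where "inputs h \<longleftrightarrow> h X = pos I \<and> h Cp = cap I \<and> h Lo = wlo I \<and> h Hi = whi I" for h :: heap
  define Q where "Q k h \<longleftrightarrow> inputs h \<and> (\<forall>v\<le>n. - x v \<le> h RES v \<and> approachable v (h RES v) \<and>
     (\<forall>i<k. i < v \<longrightarrow> 0 < up i \<longrightarrow> (\<forall>f\<le>n. covered i v f (h RES v))))" for k and h :: heap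
  define h0 where "h0 = run_stmt (Tab RES 3 (Pure (RSub RZero (RLoad X (V 3))))) env h"
  let ?tabs = "p_tabs Cp Lo Hi"
  define h' where "h' = run_stmt (p_side X Cp Lo Hi RES) env h"
  have h': "h' = run_stmt (ForS 1 (?tabs ;; ForS 2 (p_slot X Cp Lo Hi RES))) env h0"
    unfolding h'_def p_side_def h0_def by (rule run_stmt.simps(2))
  have "h0 RES v = - x v" if "v \<le> n" for v
    unfolding h0_def using that env inp by (subst tab_val) simp_all
  moreover have "inputs h0" using inp unfolding inputs_def h0_def by (simp add: tab_other)
  ultimately have "Q 0 h0" by (simp add: Q_def approachable_def)
  then have "Q (Suc (env 0)) h'" unfolding h'
  proof (rule ForS_rule)
    fix i h1 assume i: "i \<le> env 0" and Q: "Q i h1"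
    let ?env = "env(1 := i)"
    have e: "?env 0 = n" "?env 1 = i" "?env (Suc 0) = i" "i \<le> n" using env i by auto
    define h2 where "h2 = run_stmt ?tabs ?env h1"
    have in1: "h1 X = pos I" "h1 Cp = cap I" "h1 Lo = wlo I" "h1 Hi = whi I" using Q by (auto simp: Q_def inputs_def)
    have o: "b \<notin> {11, 12, 13} \<Longrightarrow> h2 b = h1 b" for b
      unfolding h2_def by (rule run_stmt_frame) (auto simp: p_tabs_def)
    have in2: "h2 X = pos I" "h2 Cp = cap I" "h2 Lo = wlo I" "h2 Hi = whi I" "h2 RES = h1 RES"
      using in1 inp by (simp_all add: o)
    define k1 where "k1 = run_stmt (Tab 11 3 (IfE (NLess (V 1) (V 3)) (Pure (RLoad Lo (V 3))) (Pure (RLoad Hi (V 3))))) ?env h1"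
    define k2 where "k2 = run_stmt (Tab 12 3 (fmin (RLoad Cp (V 1)) (And (NLeq (V 1) (V 4)) (NLess (V 4) (V 3))) (RLoad Cp (V 4)))) ?env k1"
    have h2: "h2 = run_stmt (Tab 13 3 (fsum (NLess (V 1) (V 4)) (RLoad Lo (V 4)))) ?env k2"
      unfolding h2_def p_tabs_def k1_def k2_def by (simp only: run_stmt.simps)
    have p: "b \<noteq> 11 \<Longrightarrow> k1 b = h1 b" "b \<noteq> 12 \<Longrightarrow> k2 b = k1 b" "b \<noteq> 13 \<Longrightarrow> h2 b = k2 b" for b
      unfolding k1_def k2_def h2 by (rule tab_other; simp)+
    have t11: "h2 11 t = box_top I i t" if "t \<le> n" for t
    proof -
      have "k1 11 t = box_top I i t"
        unfolding k1_def using that e in1 inp by (subst tab_val) (simp_all add: box_top_def)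
      then show ?thesis by (simp add: p)
    qed
    have t12: "h2 12 v = min_cap I i v" if "i < v" "v \<le> n" for v
    proof -
      have "k2 12 v = Min (insert (cap I i) (cap I ` {k. k \<le> n \<and> \<not> k < i \<and> k < v}))"
        unfolding k2_def using that e in1 inp by (subst tab_val, simp) (simp add: expr_val_fmin p)
      also have "\<dots> = min_cap I i v" using that by (intro Min_cap_image) auto
      finally show ?thesis by (simp add: p)
    qed
    have t13: "h2 13 0 = rest I i"
    proof -
      have "h2 13 0 = (\<Sum>k\<in>{k. k \<le> n \<and> i < k}. k2 Lo k)"
        unfolding h2 using e in1 inp by (subst tab_val, simp) (simp add: expr_val_fsum)
      also have "\<dots> = rest I i" unfolding rest_def
        using e in1 inp by (intro sum_cong_eq) (auto simp: p)
      finally show ?thesis .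
    qed
    define P where "P k h \<longleftrightarrow> Q i h \<and> (\<forall>t\<le>n. h 11 t = box_top I i t) \<and> (\<forall>v\<le>n. i < v \<longrightarrow> h 12 v = min_cap I i v) \<and>
        h 13 0 = rest I i \<and> (\<forall>v\<le>n. i < v \<longrightarrow> 0 < up i \<longrightarrow> (\<forall>f<k. covered i v f (h RES v)))" for k and h :: heap
    have "P 0 h2" using Q t11 t12 t13 in2 by (simp add: P_def Q_def inputs_def)
    then have "P (Suc (?env 0)) (run_stmt (ForS 2 (p_slot X Cp Lo Hi RES)) ?env h2)"
    proof (rule ForS_rule)
      fix f h3 assume f: "f \<le> ?env 0" and P: "P f h3"
      let ?env2 = "?env(2 := f)"
      let ?h = "run_stmt (p_slot X Cp Lo Hi RES) ?env2 h3"
      have e2: "?env2 0 = n" "?env2 1 = i" "?env2 2 = f" "i \<le> n" "f \<le> n" using e f by auto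
      have in3: "h3 X = pos I" "h3 Cp = cap I" "h3 Lo = wlo I" "h3 Hi = whi I"
        using P by (auto simp: P_def Q_def inputs_def)
      have t3: "\<And>t. t \<le> n \<Longrightarrow> h3 11 t = box_top I i t" "\<And>v. i < v \<Longrightarrow> v \<le> n \<Longrightarrow> h3 12 v = min_cap I i v" "h3 13 0 = rest I i"
        using P by (auto simp: P_def)
      have step: "h3 RES v \<le> ?h RES v" "approachable v (h3 RES v) \<Longrightarrow> approachable v (?h RES v)"
        "i < v \<Longrightarrow> 0 < up i \<Longrightarrow> covered i v f (?h RES v)" if "v \<le> n" for v
        by (rule slot_step[OF e2 inp(1-9) in3]; use t3 that in simp)+
      have fr: "?h b = h3 b" if "b \<notin> {20..46}" "b \<noteq> RES" for b
        using that by (intro run_stmt_frame) (auto simp: p_slot_def writes_defs)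
      have "?h X = h3 X" "?h Cp = h3 Cp" "?h Lo = h3 Lo" "?h Hi = h3 Hi" "?h 11 = h3 11" "?h 12 = h3 12" "?h 13 = h3 13"
        by (rule fr; use inp in simp)+
      moreover have "covered i' v f' (?h RES v)" if "v \<le> n" "covered i' v f' (h3 RES v)" for i' f' v
        using that covered_mono step(1) by blast
      ultimately show "P (Suc f) ?h" using P step unfolding P_def Q_def inputs_def
        by (auto simp: less_Suc_eq intro: order_trans)
    qed
    then have "Q (Suc i) (run_stmt (ForS 2 (p_slot X Cp Lo Hi RES)) ?env h2)" (is "Q _ ?h")
      unfolding e(1) P_def Q_def by (auto simp: less_Suc_eq[of _ i] less_Suc_eq_le[of _ n] simp del: run_stmt.simps)
    then show "Q (Suc i) (run_stmt (?tabs ;; ForS 2 (p_slot X Cp Lo Hi RES)) ?env h1)"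
      unfolding run_stmt.simps(2) h2_def .
  qed
  then have fin: "- x v \<le> h' RES v" "approachable v (h' RES v)" "i < v \<Longrightarrow> 0 < up i \<Longrightarrow> f \<le> n \<Longrightarrow> covered i v f (h' RES v)"
    if "v \<le> n" for i f v using that env unfolding Q_def by (auto simp: less_Suc_eq_le)
  have "psum s (Suc i) / min_cap I i v - x i - opt_evac_time I s \<le> h' RES v"
    if v: "v \<le> n" "i < v" "s \<in> scenarios I" "0 < s i" for v i s
  proof -
    have "s i \<le> up i" using v by (auto simp: scenarios_def PiE_def Pi_def)
    \<comment> \<open>Only vertices that can have positive weight matter, which is why the program
      may skip those with upper weight 0.\<close>
    then have u: "0 < up i" using v by simp
    have "psum s (Suc i) / min_cap I i v - x i - h' RES v \<le> evac_time I y s" if "y \<in> sinks I" for y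
    proof -
      have "0 < min_cap I i v" using v min_cap_pos by simp
      from complete[OF v(3,4) _ that this] obtain f g a b where d: "admissible I i f g a b"
        "psum s (Suc i) / min_cap I i v - evac_time I y s \<le> point_value I i (min_cap I i v) f g a b" using v by auto
      have "point_value I i (min_cap I i v) f g a b - x i \<le> h' RES v"
        by (rule covered_all[OF fin(3)[OF v(1,2) u] d(1)])
      with d(2) show ?thesis by simp
    qed
    then have "psum s (Suc i) / min_cap I i v - x i - h' RES v \<le> opt_evac_time I s" by (rule le_opt)
    then show ?thesis by simp
  qed
  with fin show ?thesis unfolding sided_def h'_def[symmetric] by (auto simp: approachable_def)
qed

end

section \<open>The mirrored path\<close>

text \<open>The values outside the index ranges are those that \<open>p_mirror\<close> leaves in the
  arrays: tables fill the cells up to \<open>n\<close>, including one surplus capacity cell, and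
  later cells are 0. So arrays and components agree as functions, as \<open>side\<close>
  demands.\<close>

definition mirror :: "path_instance \<Rightarrow> path_instance" where
  "mirror I = \<lparr>edges = edges I,
     pos = (\<lambda>a. if a \<le> edges I then pos I (edges I) - pos I (edges I - a) else 0),
     cap = (\<lambda>a. if a \<le> edges I then cap I (edges I - (a + 1)) else 0),
     wlo = (\<lambda>a. if a \<le> edges I then wlo I (edges I - a) else 0),
     whi = (\<lambda>a. if a \<le> edges I then whi I (edges I - a) else 0)\<rparr>"

definition rev_scen :: "path_instance \<Rightarrow> scenario \<Rightarrow> scenario" where
  "rev_scen I s = (\<lambda>a\<in>{..edges I}. s (edges I - a))"

lemma mirror_simps [simp]: "edges (mirror I) = edges I"
  "a \<le> edges I \<Longrightarrow> pos (mirror I) a = pos I (edges I) - pos I (edges I - a)"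
  "a < edges I \<Longrightarrow> cap (mirror I) a = cap I (edges I - (a + 1))"
  "a \<le> edges I \<Longrightarrow> wlo (mirror I) a = wlo I (edges I - a)"
  "a \<le> edges I \<Longrightarrow> whi (mirror I) a = whi I (edges I - a)"
  by (simp_all add: mirror_def)

lemma psum_rev: "m \<le> Suc (edges I) \<Longrightarrow>
  psum (rev_scen I s) m = psum s (Suc (edges I)) - psum s (Suc (edges I) - m)"
proof (induction m)
  case (Suc m)
  then have "Suc (edges I) - m = Suc (edges I - m)" by simp
  with Suc show ?case by (simp add: psum_Suc rev_scen_def)
qed simp

lemma min_cap_mirror:
  assumes "a < b" "b \<le> edges I"
  shows "min_cap (mirror I) a b = min_cap I (edges I - b) (edges I - a)"
proof -
  let ?n = "edges I"
  have "cap (mirror I) ` {a..<b} = cap I ` ((\<lambda>t. ?n - (t + 1)) ` {a..<b})"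
    unfolding image_image using assms by (intro image_cong) auto
  also have "(\<lambda>t. ?n - (t + 1)) ` {a..<b} = {?n - b..<?n - a}"
  proof
    show "{?n - b..<?n - a} \<subseteq> (\<lambda>t. ?n - (t + 1)) ` {a..<b}"
    proof
      fix t assume "t \<in> {?n - b..<?n - a}"
      then show "t \<in> (\<lambda>t. ?n - (t + 1)) ` {a..<b}"
        using assms by (intro image_eqI[of _ _ "?n - (t + 1)"]) auto
    qed
  qed (use assms in auto)
  finally show ?thesis by (simp add: min_cap_def)
qed

context path
begin

lemma path_mirror: "path (mirror I)"
proof
  show "valid_instance (mirror I)" unfolding valid_instance_def
  proof (intro conjI allI impI)
    fix i assume i: "i < edges (mirror I)"
    then have "n - Suc i < n - i" by auto
    with i show "pos (mirror I) i < pos (mirror I) (Suc i)" using x_less[of "n - Suc i" "n - i"] by simp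
    show "0 < cap (mirror I) i" using i valid by (simp add: valid_instance_def)
  qed (use lo_nonneg lo_up in auto)
qed

text \<open>The \<open>Suc n - g\<close> vertices to the right of the slot become the left vertices
  of its mirror image, and the other boundary is converted likewise.\<close>

lemma at_slot_mirror:
  assumes "at_slot f g y"
  shows "path.at_slot (mirror I) (Suc n - g) (Suc n - f) (x n - y)"
  unfolding path.at_slot_def[OF path_mirror]
proof (cases "g = Suc f")
  case True
  with assms show "Suc n - g \<le> edges (mirror I) \<and>
    (Suc n - f = Suc (Suc n - g) \<and> x n - y = pos (mirror I) (Suc n - g) \<or>
     Suc n - f = Suc n - g \<and> 0 < Suc n - g \<and> pos (mirror I) (Suc n - g - 1) < x n - y \<and> x n - y < pos (mirror I) (Suc n - g))"
    by (auto simp: at_slot_def Suc_diff_le)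
next
  case False
  with assms have f: "g = f" "0 < f" "f \<le> n" "x (f - 1) < y" "y < x f" by (auto simp: at_slot_def)
  then have "Suc n - f \<le> n" "n - (Suc n - f) = f - 1" "Suc n - f - 1 \<le> n" "n - (Suc n - f - 1) = f" by auto
  with f show "Suc n - g \<le> edges (mirror I) \<and>
    (Suc n - f = Suc (Suc n - g) \<and> x n - y = pos (mirror I) (Suc n - g) \<or>
     Suc n - f = Suc n - g \<and> 0 < Suc n - g \<and> pos (mirror I) (Suc n - g - 1) < x n - y \<and> x n - y < pos (mirror I) (Suc n - g))"
    by simp
qed

text \<open>Equality is shown by comparing upper bounds: both sides satisfy the same threshold
  conditions after exchanging prefixes with suffixes and \<open>k\<close> with
  \<open>n - k\<close>.\<close>

lemma evac_mirror:
  assumes "y \<in> sinks I"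
  shows "evac_left (mirror I) (x n - y) (rev_scen I s) = evac_right I y s"
    "evac_right (mirror I) (x n - y) (rev_scen I s) = evac_left I y s"
proof -
  obtain f g where at: "at_slot f g y" using sink_slot[OF assms] .
  note at' = at_slot_mirror[OF at]
  have fg: "f \<le> n" "0 < g" "g \<le> Suc n" using at by (auto simp: at_slot_def)
  let ?r = "rev_scen I s"
  have "evac_left (mirror I) (x n - y) ?r \<le> \<theta> \<longleftrightarrow> evac_right I y s \<le> \<theta>" for \<theta>
    unfolding path.evac_left_le_iff[OF path_mirror at'] evac_right_le_iff[OF at]
  proof (intro conj_cong refl iffI allI impI)
    fix l assume *: "\<forall>k<Suc n - g. 0 < psum ?r (Suc k) \<longrightarrow>
        x n - y - pos (mirror I) k + psum ?r (Suc k) / min_cap (mirror I) k (Suc n - g) \<le> \<theta>"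
      and l: "g \<le> l \<and> l \<le> n \<and> 0 < psum s (Suc n) - psum s l"
    have k: "n - l < Suc n - g" "n - (Suc n - g) = g - 1" "Suc n - g \<le> n" "n - (n - l) = l" using l fg by auto
    from *[rule_format, OF k(1)] show "x l - y + (psum s (Suc n) - psum s l) / min_cap I (g - 1) l \<le> \<theta>"
      using l k min_cap_mirror[of "n - l" "Suc n - g" I] by (simp add: psum_rev)
  next
    fix k assume *: "\<forall>l. g \<le> l \<and> l \<le> n \<and> 0 < psum s (Suc n) - psum s l \<longrightarrow>
       x l - y + (psum s (Suc n) - psum s l) / min_cap I (g - 1) l \<le> \<theta>"
      and k: "k < Suc n - g" "0 < psum ?r (Suc k)"
    have k': "g \<le> n - k" "n - (Suc n - g) = g - 1" "Suc n - g \<le> n" "k \<le> n" using k fg by auto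
    from *[rule_format, of "n - k"] show "x n - y - pos (mirror I) k + psum ?r (Suc k) / min_cap (mirror I) k (Suc n - g) \<le> \<theta>"
      using k k' min_cap_mirror[of k "Suc n - g" I] by (simp add: psum_rev)
  qed
  then show "evac_left (mirror I) (x n - y) ?r = evac_right I y s" by (meson order.antisym order.refl)
  have "evac_right (mirror I) (x n - y) ?r \<le> \<theta> \<longleftrightarrow> evac_left I y s \<le> \<theta>" for \<theta>
    unfolding path.evac_right_le_iff[OF path_mirror at'] evac_left_le_iff[OF at] mirror_simps(1)
  proof (intro conj_cong refl iffI allI impI)
    fix k assume *: "\<forall>l. Suc n - f \<le> l \<and> l \<le> n \<and> 0 < psum ?r (Suc n) - psum ?r l \<longrightarrow>
       pos (mirror I) l - (x n - y) + (psum ?r (Suc n) - psum ?r l) / min_cap (mirror I) (Suc n - f - 1) l \<le> \<theta>"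
      and k: "k < f" "0 < psum s (Suc k)"
    have k': "Suc n - f \<le> n - k" "n - (n - k) = k" "Suc n - (n - k) = Suc k" "Suc n - f - 1 < n - k" "n - k \<le> Suc n"
      "n - (Suc n - f - 1) = f" using k fg by auto
    from *[rule_format, of "n - k"] show "y - x k + psum s (Suc k) / min_cap I k f \<le> \<theta>"
      using k k' min_cap_mirror[of "Suc n - f - 1" "n - k" I] by (simp add: psum_rev)
  next
    fix l assume *: "\<forall>k<f. 0 < psum s (Suc k) \<longrightarrow> y - x k + psum s (Suc k) / min_cap I k f \<le> \<theta>"
      and l: "Suc n - f \<le> l \<and> l \<le> n \<and> 0 < psum ?r (Suc n) - psum ?r l"
    have k': "n - l < f" "Suc n - l = Suc (n - l)" "Suc n - f - 1 < l" "n - (Suc n - f - 1) = f" using l fg by auto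
    from *[rule_format, of "n - l"] show "pos (mirror I) l - (x n - y) + (psum ?r (Suc n) - psum ?r l) / min_cap (mirror I) (Suc n - f - 1) l \<le> \<theta>"
      using l k' min_cap_mirror[of "Suc n - f - 1" l I] by (simp add: psum_rev)
  qed
  then show "evac_right (mirror I) (x n - y) ?r = evac_left I y s" by (meson order.antisym order.refl)
qed

lemma sinks_mirror: "sinks (mirror I) = (\<lambda>y. x n - y) ` sinks I"
  by (simp add: sinks_def x0)

lemma opt_mirror: "opt_evac_time (mirror I) (rev_scen I s) = opt_evac_time I s"
  unfolding opt_evac_time_def sinks_mirror image_image
  by (intro arg_cong[where f = Inf] image_cong) (simp_all add: evac_time_def evac_mirror max.commute)

lemma rev_scenarios: "s \<in> scenarios I \<Longrightarrow> rev_scen I s \<in> scenarios (mirror I)"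
  unfolding scenarios_def rev_scen_def by (rule PiE_I) (auto simp: PiE_def Pi_def)

lemma scenarios_mirror:
  assumes "r \<in> scenarios (mirror I)"
  obtains s where "s \<in> scenarios I" "r = rev_scen I s"
proof
  let ?s = "rev_scen I r"
  have r: "\<And>t. t \<le> n \<Longrightarrow> r t \<in> {lo (n - t)..up (n - t)}" "\<And>t. \<not> t \<le> n \<Longrightarrow> r t = undefined"
    using assms by (auto simp: scenarios_def PiE_def Pi_def extensional_def)
  show "?s \<in> scenarios I"
    unfolding scenarios_def
  proof (rule PiE_I)
    fix t assume "t \<in> {..n}"
    then show "?s t \<in> {lo t..up t}" using r(1)[of "n - t"] by (simp add: rev_scen_def)
  qed (simp add: rev_scen_def)
  show "r = rev_scen I ?s"
  proof
    fix t show "r t = rev_scen I ?s t" using r(2)[of t] by (simp add: rev_scen_def)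
  qed
qed

end

context path
begin

section \<open>Maximal regret of a fixed sink\<close>

lemma psum_last_positive:
  assumes "\<And>t. t \<le> k \<Longrightarrow> 0 \<le> s t" "0 < psum s (Suc k)"
  obtains i where "i \<le> k" "0 < s i" "psum s (Suc i) = psum s (Suc k)"
  using assms
proof (induction k arbitrary: thesis)
  case (Suc k)
  show ?case
  proof (cases "0 < s (Suc k)")
    case False
    then have "s (Suc k) = 0" using Suc.prems(2)[of "Suc k"] by simp
    then have eq: "psum s (Suc (Suc k)) = psum s (Suc k)" by (simp add: psum_Suc)
    then obtain i where "i \<le> k" "0 < s i" "psum s (Suc i) = psum s (Suc k)"
      using Suc.IH Suc.prems(2,3) by (metis le_SucI)
    with Suc.prems(1)[of i] eq show ?thesis by simp
  qed (use Suc.prems(1) in auto)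
qed (auto simp: psum_Suc)

lemma scenario_nonneg: "s \<in> scenarios I \<Longrightarrow> t \<le> n \<Longrightarrow> 0 \<le> s t"
  using lo_nonneg[of t] by (force simp: scenarios_def PiE_def Pi_def)

lemma opt_nonneg: "0 \<le> opt_evac_time I s"
  by (rule le_opt) (rule evac_nonneg)

lemma sided_bound: "sided I R \<Longrightarrow> v \<le> n \<Longrightarrow> i < v \<Longrightarrow> s \<in> scenarios I \<Longrightarrow> 0 < s i \<Longrightarrow>
    psum s (Suc i) / min_cap I i v - x i - opt_evac_time I s \<le> R v"
  and sided_near: "sided I R \<Longrightarrow> v \<le> n \<Longrightarrow> R v \<noteq> - x v \<Longrightarrow> 0 < e \<Longrightarrow>
    \<exists>i<v. \<exists>s\<in>scenarios I. 0 < s i \<and> R v - e \<le> psum s (Suc i) / min_cap I i v - x i - opt_evac_time I s"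
  unfolding sided_def by blast+

text \<open>A vertex \<open>k\<close> that sends flow is dominated by the last vertex
  \<open>i \<le> k\<close> of positive weight: the prefix sum is the same, the distance no shorter
  and the capacity no larger.\<close>

lemma left_regret_upper:
  assumes "sided I R" "at_slot f g y" "s \<in> scenarios I"
  shows "evac_left I y s - opt_evac_time I s \<le> max 0 (y + R f)"
proof -
  have f: "f \<le> n" using assms(2) by (simp add: at_slot_def)
  have y: "x k \<le> y" if "k < f" for k using left_iff[OF assms(2), of k] that f by simp
  have "evac_left I y s \<le> max 0 (y + R f) + opt_evac_time I s"
    unfolding evac_left_le_iff[OF assms(2)]
  proof (intro conjI allI impI)
    show "0 \<le> max 0 (y + R f) + opt_evac_time I s" using opt_nonneg[of s] by simp
    fix k assume k: "k < f" "0 < psum s (Suc k)"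
    obtain i where i: "i \<le> k" "0 < s i" "psum s (Suc i) = psum s (Suc k)"
      using psum_last_positive[of k s] scenario_nonneg[OF assms(3)] k f by (metis order.trans less_imp_le)
    have "psum s (Suc i) / min_cap I i f - x i - opt_evac_time I s \<le> R f"
      using sided_bound[OF assms(1) f _ assms(3) i(2)] i(1) k(1) by simp
    moreover have "psum s (Suc k) / min_cap I k f \<le> psum s (Suc k) / min_cap I i f"
      using i k f min_cap_anti[of i k f f] min_cap_pos[of i f] min_cap_pos[of k f] by (intro divide_left_mono) auto
    moreover have "x i \<le> x k" using i k f by (intro x_le) auto
    ultimately show "y - x k + psum s (Suc k) / min_cap I k f \<le> max 0 (y + R f) + opt_evac_time I s"
      using i(3) by (simp add: max_def)
  qed
  then show ?thesis by simp
qed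

lemma scenarios_nonempty: "scenarios I \<noteq> {}"
proof -
  have "restrict lo {..n} \<in> scenarios I"
    unfolding scenarios_def by (rule PiE_I) (auto simp: lo_up)
  then show ?thesis by blast
qed

text \<open>The value 0 is reached by any scenario, as regrets are nonnegative. A positive value
  excludes the default \<open>R f = - x f\<close>, so scenarios approaching \<open>R f\<close>
  exist.\<close>

lemma left_regret_attained:
  assumes "sided I R" "at_slot f g y" "y \<in> sinks I" "0 < e"
  shows "\<exists>s\<in>scenarios I. max 0 (y + R f) - e \<le> regret I y s"
proof -
  have f: "f \<le> n" using assms(2) by (simp add: at_slot_def)
  obtain s0 where s0: "s0 \<in> scenarios I" using scenarios_nonempty by blast
  have r0: "0 \<le> regret I y s0" using opt_le[OF assms(3)] by (simp add: regret_def)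
  show ?thesis
  proof (cases "y + R f \<le> 0")
    case True
    then show ?thesis using s0 r0 assms(4) by (intro bexI[of _ s0]) auto
  next
    case False
    have "y \<le> x f" using at_slot_bounds[OF assms(2)] by simp
    with False have "R f \<noteq> - x f" by simp
    then obtain i s where i: "i < f" "s \<in> scenarios I" "0 < s i"
      "R f - e \<le> psum s (Suc i) / min_cap I i f - x i - opt_evac_time I s"
      using sided_near[OF assms(1) f _ assms(4)] by blast
    have "0 < psum s (Suc i)"
      using psum_mono_idx[of 0 i s] scenario_nonneg[OF i(2)] i(1,3) f by (simp add: psum_Suc)
    then have "y - x i + psum s (Suc i) / min_cap I i f \<le> evac_left I y s"
      using evac_left_le_iff[OF assms(2), of s "evac_left I y s"] i(1) by auto
    then have "y + R f - e \<le> regret I y s" using i(4) by (simp add: regret_def evac_time_def)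
    with False i(2) show ?thesis by (intro bexI[of _ s]) auto
  qed
qed

lemma regret_mirror: "y \<in> sinks I \<Longrightarrow> regret (mirror I) (x n - y) (rev_scen I s) = regret I y s"
  by (simp add: regret_def opt_mirror evac_time_def evac_mirror max.commute)

text \<open>The left and the right part of the regret have the same subtrahend, and a supremum of
  maxima is the maximum of the suprema. The right part is the left part of the mirrored
  path.\<close>

lemma max_regret_formula:
  assumes L: "sided I L" and R: "sided (mirror I) R" and at: "at_slot f g y" and y: "y \<in> sinks I"
  shows "max_regret I y = max 0 (max (y + L f) (x n - y + R (Suc n - g)))" (is "_ = ?M")
proof -
  note at' = at_slot_mirror[OF at]
  have y': "x n - y \<in> sinks (mirror I)" using y by (simp add: sinks_mirror)
  have ub: "regret I y s \<le> ?M" if "s \<in> scenarios I" for s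
  proof -
    have "evac_right I y s - opt_evac_time I s \<le> max 0 (x n - y + R (Suc n - g))"
      using path.left_regret_upper[OF path_mirror R at' rev_scenarios[OF that]]
      by (simp add: evac_mirror[OF y] opt_mirror)
    with left_regret_upper[OF L at that] show ?thesis
      by (simp add: regret_def evac_time_def max_def split: if_splits)
  qed
  have ex: "\<exists>s\<in>scenarios I. ?M - e \<le> regret I y s" if e: "0 < e" for e
  proof -
    obtain s where s: "s \<in> scenarios I" "max 0 (y + L f) - e \<le> regret I y s"
      using left_regret_attained[OF L at y e] by blast
    obtain r where r: "r \<in> scenarios (mirror I)"
      "max 0 (x n - y + R (Suc n - g)) - e \<le> regret (mirror I) (x n - y) r"
      using path.left_regret_attained[OF path_mirror R at' y' e] by blast
    obtain s' where s': "s' \<in> scenarios I" "r = rev_scen I s'" using scenarios_mirror[OF r(1)] .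
    have "max 0 (x n - y + R (Suc n - g)) - e \<le> regret I y s'"
      using r(2) s'(2) regret_mirror[OF y] by simp
    with s s'(1) show ?thesis
      by (cases "y + L f \<le> x n - y + R (Suc n - g)") (force simp: max_def split: if_splits)+
  qed
  have bd: "bdd_above (regret I y ` scenarios I)" using ub by (intro bdd_aboveI2)
  show ?thesis unfolding max_regret_def
  proof (rule antisym)
    show "(SUP s\<in>scenarios I. regret I y s) \<le> ?M" using scenarios_nonempty ub by (intro cSUP_least)
    show "?M \<le> (SUP s\<in>scenarios I. regret I y s)"
    proof (rule field_le_epsilon)
      fix e :: real assume "0 < e"
      from ex[OF this] obtain s where "s \<in> scenarios I" "?M - e \<le> regret I y s" by blast
      with cSUP_upper[OF this(1) bd] show "?M \<le> (SUP s\<in>scenarios I. regret I y s) + e" by linarith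
    qed
  qed
qed

section \<open>Minimising over the sink\<close>

definition vertex_value where
  "vertex_value L R v = max 0 (max (x v + L v) (x n - x v + R (n - v)))"

text \<open>The infimum over the open edge of the maximum of 0, a line of slope 1 and a line of
  slope -1. The lines cross at half the sum of their constants; if the crossing lies outside the
  edge, the limit of the rising line at the left end or of the falling line at the right end
  decides.\<close>

definition edge_value where
  "edge_value L R f = max 0 (max (max ((L f + (x n + R (Suc n - f))) / 2) (x (f - 1) + L f)) (x n + R (Suc n - f) - x f))"

lemma minmax_formula:
  assumes L: "sided I L" and R: "sided (mirror I) R"
  shows "minmax_regret I = Min (vertex_value L R ` {v. v \<le> n} \<union> edge_value L R ` {f. 0 < f \<and> f \<le> n})"
    (is "_ = Min ?S")
proof -
  have S: "finite ?S" "?S \<noteq> {}" by auto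
  have xs: "x v \<in> sinks I" if "v \<le> n" for v
    using that x_le[of 0 v] x_le[of v n] by (simp add: sinks_def)
  have vv: "max_regret I (x v) = vertex_value L R v" if v: "v \<le> n" for v
  proof -
    have "at_slot v (Suc v) (x v)" using v by (simp add: at_slot_def)
    from max_regret_formula[OF L R this xs[OF v]] show ?thesis by (simp add: vertex_value_def)
  qed
  have edge: "max_regret I y = max 0 (max (y + L f) (x n - y + R (Suc n - f)))"
    and edge_sink: "y \<in> sinks I" if "0 < f" "f \<le> n" "x (f - 1) < y" "y < x f" for f y
  proof -
    have "at_slot f f y" using that by (simp add: at_slot_def)
    moreover have "f - 1 \<le> n" using that by simp
    then show "y \<in> sinks I" using that xs[of f] xs[of "f - 1"] by (auto simp: sinks_def)
    ultimately show "max_regret I y = max 0 (max (y + L f) (x n - y + R (Suc n - f)))"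
      by (rule max_regret_formula[OF L R])
  qed
  have lb: "Min ?S \<le> max_regret I y" if y: "y \<in> sinks I" for y
  proof -
    obtain f g where at: "at_slot f g y" using sink_slot[OF y] .
    then consider "f \<le> n" "y = x f" | "0 < f" "f \<le> n" "x (f - 1) < y" "y < x f" by (auto simp: at_slot_def)
    then show ?thesis
    proof cases
      case 1
      then have "Min ?S \<le> vertex_value L R f" using S by (intro Min_le) auto
      with vv 1 show ?thesis by simp
    next
      case 2
      have "Min ?S \<le> edge_value L R f" using S 2 by (intro Min_le) auto
      also have "\<dots> \<le> max 0 (max (y + L f) (x n - y + R (Suc n - f)))"
        unfolding edge_value_def using 2 by (auto simp: max_def)
      finally show ?thesis using edge[OF 2] by simp
    qed
  qed
  have bd: "bdd_below (max_regret I ` sinks I)" using lb by (intro bdd_belowI2)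
  have ub: "minmax_regret I \<le> max_regret I y" if "y \<in> sinks I" for y
    unfolding minmax_regret_def using bd that by (rule cINF_lower)
  show ?thesis
  proof (rule antisym)
    show "Min ?S \<le> minmax_regret I"
      unfolding minmax_regret_def using sinks_nonempty lb by (intro cINF_greatest)
    have "minmax_regret I \<le> edge_value L R f" if f: "0 < f" "f \<le> n" for f
    proof (rule field_le_epsilon)
      fix e :: real assume e: "0 < e"
      define p q m where "p = x (f - 1)" and "q = x f" and "m = (x n + R (Suc n - f) - L f) / 2"
      have pq: "p < q" unfolding p_def q_def using f by (intro x_less) auto
      define d where "d = min e ((q - p) / 3)"
      have d: "0 < d" "d \<le> e" "3 * d \<le> q - p" using e pq by (auto simp: d_def min_def)
      \<comment> \<open>The crossing point \<open>m\<close>, clamped to distance \<open>d\<close>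
        from the ends because the edge is open; since \<open>d \<le> e\<close> and the slopes are 1
        and -1, clamping costs at most \<open>e\<close>.\<close>
      define y where "y = (if m < p + d then p + d else if q - d < m then q - d else m)"
      have y: "p < y" "y < q" using d by (auto simp: y_def)
      have "max 0 (max (y + L f) (x n - y + R (Suc n - f))) \<le> edge_value L R f + e"
        unfolding edge_value_def p_def[symmetric] q_def[symmetric] y_def
        using d by (auto simp: m_def max_def field_simps)
      moreover have "x (f - 1) < y" "y < x f" using y by (simp_all add: p_def q_def)
      ultimately show "minmax_regret I \<le> edge_value L R f + e"
        using ub[OF edge_sink[OF f, of y]] edge[OF f, of y] by linarith
    qed
    moreover have "minmax_regret I \<le> vertex_value L R v" if "v \<le> n" for v
      using ub[OF xs[OF that]] vv[OF that] by simp
    ultimately show "minmax_regret I \<le> Min ?S" using S by auto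
  qed
qed

end


section \<open>Normalised instances and the main theorem\<close>

text \<open>The input arrays vanish outside the index range of the instance, where an instance is arbitrary.\<close>

definition norm_inst :: "path_instance \<Rightarrow> path_instance" where
  "norm_inst I = \<lparr>edges = edges I, pos = rarr (initial_store I) 0, cap = rarr (initial_store I) 1,
     wlo = rarr (initial_store I) 2, whi = rarr (initial_store I) 3\<rparr>"

lemma norm_simps [simp]: "edges (norm_inst I) = edges I"
  "a \<le> edges I \<Longrightarrow> pos (norm_inst I) a = pos I a"
  "a < edges I \<Longrightarrow> cap (norm_inst I) a = cap I a"
  "a \<le> edges I \<Longrightarrow> wlo (norm_inst I) a = wlo I a"
  "a \<le> edges I \<Longrightarrow> whi (norm_inst I) a = whi I a"
  by (simp_all add: norm_inst_def initial_store_def)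

lemma path_norm: "path I \<Longrightarrow> path (norm_inst I)"
  by (auto simp: path_def valid_instance_def)

context path
begin

lemma evac_norm:
  assumes "y \<in> sinks I"
  shows "evac_time (norm_inst I) y s = evac_time I y s"
proof -
  have p: "path (norm_inst I)" by (rule path_norm) (rule path_axioms)
  obtain f g where at: "at_slot f g y" using sink_slot[OF assms] .
  then have at': "path.at_slot (norm_inst I) f g y"
    by (auto simp: path.at_slot_def[OF p] at_slot_def)
  have fg: "f \<le> n" "0 < g" using at by (auto simp: at_slot_def)
  have min_cap: "min_cap (norm_inst I) a b = min_cap I a b" if "b \<le> n" for a b
    unfolding min_cap_def using that by (intro arg_cong[where f = Min] image_cong) auto
  have "evac_time (norm_inst I) y s \<le> \<theta> \<longleftrightarrow> evac_time I y s \<le> \<theta>" for \<theta>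
    unfolding path.evac_le_iff[OF p at'] evac_le_iff[OF at] using fg by (simp add: min_cap)
  then show ?thesis by (meson order.antisym order.refl)
qed

lemma minmax_norm: "minmax_regret (norm_inst I) = minmax_regret I"
proof -
  have s: "sinks (norm_inst I) = sinks I" by (simp add: sinks_def)
  have sc: "scenarios (norm_inst I) = scenarios I"
    unfolding scenarios_def by (auto intro!: PiE_cong)
  have o: "opt_evac_time (norm_inst I) t = opt_evac_time I t" for t
    unfolding opt_evac_time_def s by (intro arg_cong[where f = Inf] image_cong) (simp_all add: evac_norm)
  have "max_regret (norm_inst I) y = max_regret I y" if "y \<in> sinks I" for y
    unfolding max_regret_def sc regret_def o evac_norm[OF that] ..
  then show ?thesis unfolding minmax_regret_def s by (intro arg_cong[where f = Inf] image_cong) simp_all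
qed

end

definition p_mirror :: stmt where
  "p_mirror =
     Tab 6 3 (Pure (RSub (RLoad 0 (V 0)) (RLoad 0 (NSub (V 0) (V 3))))) ;;
     Tab 7 3 (Pure (RLoad 1 (NSub (V 0) (NAdd (V 3) (NConst 1))))) ;;
     Tab 8 3 (Pure (RLoad 2 (NSub (V 0) (V 3)))) ;;
     Tab 9 3 (Pure (RLoad 3 (NSub (V 0) (V 3))))"

text \<open>\<open>emax\<close> compares two plain expressions, so nested maxima are spread over
  several tables. The entry for \<open>f = 0\<close> in array 54 belongs to no edge and is excluded
  by the last guard.\<close>

definition p_result :: stmt where
  "p_result =
    (let b = RAdd (RLoad 0 (V 0)) (RLoad 10 (NSub (NAdd (V 0) (NConst 1)) (V 3)))
     in Tab 50 3 (emax (RAdd (RLoad 0 (V 3)) (RLoad 5 (V 3)))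
          (RAdd (RSub (RLoad 0 (V 0)) (RLoad 0 (V 3))) (RLoad 10 (NSub (V 0) (V 3))))) ;;
        Tab 51 3 (emax RZero (RLoad 50 (V 3))) ;;
        Tab 52 3 (emax (RDiv (RAdd (RLoad 5 (V 3)) b) Two) (RAdd (RLoad 0 (NSub (V 3) (NConst 1))) (RLoad 5 (V 3)))) ;;
        Tab 53 3 (emax (RLoad 52 (V 3)) (RSub b (RLoad 0 (V 3)))) ;;
        Tab 54 3 (emax RZero (RLoad 53 (V 3))) ;;
        Tab 55 3 (fmin (RLoad 51 (NConst 0)) (NLess (NConst 0) (NConst 1)) (RLoad 51 (V 4))) ;;
        Tab 4 3 (fmin (RLoad 55 (NConst 0)) (NLess (NConst 0) (V 4)) (RLoad 54 (V 4))))"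

definition prog :: stmt where
  "prog = p_side 0 1 2 3 5 ;; p_mirror ;; p_side 6 7 8 9 10 ;; p_result"

lemmas prog_defs = prog_def p_side_def p_tabs_def p_slot_def p_mirror_def p_result_def writes_defs

text \<open>The loops over \<open>i\<close> and \<open>f\<close>, a table and a fold.\<close>

lemma stmt_depth_prog: "stmt_depth prog \<le> 4"
  by (simp add: prog_defs fsum_def fmax_def fmin_def fmin2_def flast_def emax_def)

lemma stmt_ok_prog: "stmt_ok {0} prog"
  by (simp add: prog_defs fsum_def fmax_def fmin_def fmin2_def flast_def emax_def)

context path
begin

lemma result_block:
  assumes env: "env 0 = n" and inp: "h 0 = pos I" "h 5 = L" "h 10 = R"
  shows "run_stmt p_result env h 4 0 =
    Min (vertex_value L R ` {v. v \<le> n} \<union> edge_value L R ` {f. 0 < f \<and> f \<le> n})"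
proof -
  let ?b = "RAdd (RLoad 0 (V 0)) (RLoad 10 (NSub (NAdd (V 0) (NConst 1)) (V 3)))"
  define h0 where "h0 = run_stmt (Tab 50 3 (emax (RAdd (RLoad 0 (V 3)) (RLoad 5 (V 3)))
          (RAdd (RSub (RLoad 0 (V 0)) (RLoad 0 (V 3))) (RLoad 10 (NSub (V 0) (V 3)))))) env h"
  define h1 where "h1 = run_stmt (Tab 51 3 (emax RZero (RLoad 50 (V 3)))) env h0"
  define h2 where "h2 = run_stmt (Tab 52 3 (emax (RDiv (RAdd (RLoad 5 (V 3)) ?b) Two) (RAdd (RLoad 0 (NSub (V 3) (NConst 1))) (RLoad 5 (V 3))))) env h1"
  define h3 where "h3 = run_stmt (Tab 53 3 (emax (RLoad 52 (V 3)) (RSub ?b (RLoad 0 (V 3))))) env h2"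
  define h4 where "h4 = run_stmt (Tab 54 3 (emax RZero (RLoad 53 (V 3)))) env h3"
  define h5 where "h5 = run_stmt (Tab 55 3 (fmin (RLoad 51 (NConst 0)) (NLess (NConst 0) (NConst 1)) (RLoad 51 (V 4)))) env h4"
  have h': "run_stmt p_result env h = run_stmt (Tab 4 3 (fmin (RLoad 55 (NConst 0)) (NLess (NConst 0) (V 4)) (RLoad 54 (V 4)))) env h5"
    unfolding p_result_def Let_def h5_def h4_def h3_def h2_def h1_def h0_def by (simp only: run_stmt.simps)
  have o: "b \<noteq> 50 \<Longrightarrow> h0 b = h b" "b \<noteq> 51 \<Longrightarrow> h1 b = h0 b" "b \<noteq> 52 \<Longrightarrow> h2 b = h1 b" "b \<noteq> 53 \<Longrightarrow> h3 b = h2 b"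
    "b \<noteq> 54 \<Longrightarrow> h4 b = h3 b" "b \<noteq> 55 \<Longrightarrow> h5 b = h4 b" for b
    unfolding h0_def h1_def h2_def h3_def h4_def h5_def by (rule tab_other; assumption)+
  have 0: "h0 50 v = max (x v + L v) (x n - x v + R (n - v))" if "v \<le> n" for v
    unfolding h0_def using that env inp by (subst tab_val) (simp_all add: expr_val_emax)
  have 1: "h1 51 v = vertex_value L R v" if "v \<le> n" for v
    unfolding h1_def using that env 0[OF that] by (subst tab_val) (simp_all add: expr_val_emax vertex_value_def)
  have 2: "h2 52 f = max ((L f + (x n + R (Suc n - f))) / 2) (x (f - 1) + L f)" if "f \<le> n" for f
    unfolding h2_def using that env inp by (subst tab_val) (simp_all add: expr_val_emax o)
  have 3: "h3 53 f = max (max ((L f + (x n + R (Suc n - f))) / 2) (x (f - 1) + L f)) (x n + R (Suc n - f) - x f)" if "f \<le> n" for f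
    unfolding h3_def using that env inp 2[OF that] by (subst tab_val) (simp_all add: expr_val_emax o)
  have 4: "h4 54 f = edge_value L R f" if "f \<le> n" for f
    unfolding h4_def using that env 3[OF that] by (subst tab_val) (simp_all add: expr_val_emax edge_value_def)
  have "h5 55 0 = Min (insert (h4 51 0) (h4 51 ` {v. v \<le> n}))"
    unfolding h5_def using env by (subst tab_val, simp) (simp add: expr_val_fmin)
  also have "insert (h4 51 0) (h4 51 ` {v. v \<le> n}) = vertex_value L R ` {v. v \<le> n}"
    using 1 by (auto simp: o intro!: image_eqI[of _ _ 0])
  finally have 5: "h5 55 0 = Min (vertex_value L R ` {v. v \<le> n})" .
  have "run_stmt p_result env h 4 0 = Min (insert (h5 55 0) (h5 54 ` {f. f \<le> n \<and> 0 < f}))"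
    unfolding h' using env by (subst tab_val, simp) (simp add: expr_val_fmin)
  also have "h5 54 ` {f. f \<le> n \<and> 0 < f} = edge_value L R ` {f. 0 < f \<and> f \<le> n}"
    using 4 by (auto simp: o)
  also have "Min (insert (h5 55 0) (edge_value L R ` {f. 0 < f \<and> f \<le> n})) =
     Min (vertex_value L R ` {v. v \<le> n} \<union> edge_value L R ` {f. 0 < f \<and> f \<le> n})"
  proof (cases "{f. 0 < f \<and> f \<le> n} = {}")
    case False
    then have "Min (vertex_value L R ` {v. v \<le> n} \<union> edge_value L R ` {f. 0 < f \<and> f \<le> n}) =
      min (Min (vertex_value L R ` {v. v \<le> n})) (Min (edge_value L R ` {f. 0 < f \<and> f \<le> n}))"
      by (intro Min_Un) auto
    with False 5 show ?thesis by simp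
  next
    case True
    show ?thesis unfolding True 5 by simp
  qed
  finally show ?thesis .
qed

lemma prog_correct:
  assumes env: "env 0 = n" and inp: "h 0 = pos I" "h 1 = cap I" "h 2 = wlo I" "h 3 = whi I"
    and zero: "h 6 = (\<lambda>_. 0)" "h 7 = (\<lambda>_. 0)" "h 8 = (\<lambda>_. 0)" "h 9 = (\<lambda>_. 0)"
  shows "run_stmt prog env h 4 0 = minmax_regret I"
proof -
  define h1 where "h1 = run_stmt (p_side 0 1 2 3 5) env h"
  define h2 where "h2 = run_stmt p_mirror env h1"
  define h3 where "h3 = run_stmt (p_side 6 7 8 9 10) env h2"
  have p: "run_stmt prog env h = run_stmt p_result env h3"
    unfolding prog_def h1_def h2_def h3_def by (simp only: run_stmt.simps)
  have L: "sided I (h1 5)" unfolding h1_def by (rule side) (use env inp in simp_all)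
  have o1: "h1 b = h b" if "b < 11" "b \<noteq> 5" for b
    unfolding h1_def using that by (intro run_stmt_frame) (auto simp: p_side_def p_tabs_def p_slot_def writes_defs)
  have o2: "h2 b = h1 b" if "b \<notin> {6, 7, 8, 9}" for b
    unfolding h2_def using that by (intro run_stmt_frame) (auto simp: p_mirror_def)
  have o3: "h3 b = h2 b" if "b < 10" for b
    unfolding h3_def using that by (intro run_stmt_frame) (auto simp: p_side_def p_tabs_def p_slot_def writes_defs)
  have m: "h2 6 = pos (mirror I)" "h2 7 = cap (mirror I)" "h2 8 = wlo (mirror I)" "h2 9 = whi (mirror I)"
    unfolding h2_def p_mirror_def using env inp zero by (auto simp: mirror_def o1 fun_eq_iff)
  have R: "sided (mirror I) (h3 10)"
    unfolding h3_def by (rule path.side[OF path_mirror]) (use env m in simp_all)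
  have "h3 0 = pos I" "h3 5 = h1 5" using inp by (simp_all add: o1 o2 o3)
  then show ?thesis
    unfolding p minmax_formula[OF L R] using result_block[where h = h3 and L = "h1 5" and R = "h3 10" and env = env] env by simp
qed

end

text \<open>The factor 16 comes from \<open>Suc n \<le> 2 * n\<close>, and from \<open>n = 3\<close>
  on the logarithm is at least 1.\<close>

lemma poly_bigo: "(\<lambda>n. real (K * Suc n ^ 4)) \<in> O(\<lambda>n. real n ^ 4 * ln (real n))"
proof (rule bigoI)
  show "eventually (\<lambda>n. norm (real (K * Suc n ^ 4)) \<le> (16 * real K) * norm (real n ^ 4 * ln (real n))) sequentially"
  proof (rule eventually_sequentiallyI)
    fix n :: nat assume n: "3 \<le> n"
    have "real (Suc n) ^ 4 \<le> (2 * real n) ^ 4" using n by (intro power_mono) auto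
    also have "\<dots> = 16 * real n ^ 4 * 1" by (simp add: power_mult_distrib)
    also have "1 \<le> ln (real n)" using n exp_le by (subst ln_ge_iff) auto
    then have "16 * real n ^ 4 * 1 \<le> 16 * real n ^ 4 * ln (real n)" by (intro mult_left_mono) auto
    finally have "real K * real (Suc n) ^ 4 \<le> real K * (16 * real n ^ 4 * ln (real n))"
      by (intro mult_left_mono) auto
    moreover have "0 \<le> ln (real n)" using n by simp
    ultimately show "norm (real (K * Suc n ^ 4)) \<le> (16 * real K) * norm (real n ^ 4 * ln (real n))"
      by (simp add: abs_mult mult_ac)
  qed
qed

theorem theorem1:
  "\<exists>(p :: com) (T :: nat \<Rightarrow> nat).
     (\<lambda>n. real (T n)) \<in> O(\<lambda>n. real n ^ 4 * ln (real n)) \<and>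
     (\<forall>I :: path_instance. valid_instance I \<longrightarrow>
        (\<exists>t \<sigma>. exec p (initial_store I) t \<sigma> \<and> t \<le> T (edges I) \<and>
               result \<sigma> = minmax_regret I))"
proof (rule exI[of _ "compile_stmt prog"], rule exI[of _ "\<lambda>n. stmt_cost prog * Suc n ^ 4"], intro conjI allI impI)
  show "(\<lambda>n. real (stmt_cost prog * Suc n ^ 4)) \<in> O(\<lambda>n. real n ^ 4 * ln (real n))"
    by (rule poly_bigo)
next
  fix I :: path_instance assume "valid_instance I"
  then have p: "path I" by (simp add: path_def)
  define env where "env = (\<lambda>a::nat. if a = 0 then edges I else 0)"
  let ?h = "rarr (initial_store I)"
  obtain t \<sigma> where 1: "exec (compile_stmt prog) (initial_store I) t \<sigma>" "t \<le> stmt_cost prog * Suc (edges I) ^ stmt_depth prog"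
    "agree {..<100} (rarr \<sigma>) (run_stmt prog env ?h)"
    using compile_stmt_exec[OF stmt_ok_prog, of "initial_store I" env ?h]
    by (auto simp: env_def initial_store_def agree_def)
  have "t \<le> stmt_cost prog * Suc (edges I) ^ 4"
    using 1(2) pow_le[OF stmt_depth_prog, of "stmt_cost prog" "edges I"] by (rule order_trans)
  moreover have "result \<sigma> = run_stmt prog env ?h 4 0" using 1(3) by (simp add: result_def agree_def)
  moreover have "run_stmt prog env ?h 4 0 = minmax_regret (norm_inst I)"
  proof (rule path.prog_correct[OF path_norm[OF p]])
    show "env 0 = edges (norm_inst I)" by (simp add: env_def)
    show "?h 0 = pos (norm_inst I)" "?h 1 = cap (norm_inst I)" "?h 2 = wlo (norm_inst I)" "?h 3 = whi (norm_inst I)"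
      by (simp_all add: norm_inst_def)
    show "?h 6 = (\<lambda>_. 0)" "?h 7 = (\<lambda>_. 0)" "?h 8 = (\<lambda>_. 0)" "?h 9 = (\<lambda>_. 0)"
      by (simp_all add: initial_store_def)
  qed
  ultimately show "\<exists>t \<sigma>. exec (compile_stmt prog) (initial_store I) t \<sigma> \<and> t \<le> stmt_cost prog * Suc (edges I) ^ 4 \<and>
      result \<sigma> = minmax_regret I"
    using 1(1) path.minmax_norm[OF p] by auto
qed

end
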